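(* Let $G$ be a Mal'cev group. For every weakly almost periodic, continuous, isometric Banach $G$-module $\mathcal{E}$ such that $\mathcal{E}^G=0$ we have $\underline{H}^n(G,\mathcal{E})=0$ for all $n\in\mathbb{N}$.
   Context: A Mal'cev group is a locally compact, compactly generated group which embeds as a closed cocompact subgroup of a connected simply connected nilpotent Lie group (equivalently, a torsion-free nilpotent Lie group). A continuous isometric Banach $G$-module is a Banach space with a linear isometric $G$-action such that the action map $G\times\mathcal{E}\to\mathcal{E}$ is continuous; it is weakly almost periodic if every orbit $G.\xi$ is relatively weakly compact. $\underline{H}^n(G,\mathcal{E})$ denotes reduced continuous cohomology: continuous $n$-cocycles modulo the closure of the continuous $n$-coboundaries. *)

theory Defs
  imports "HOL-Analysis.Analysis" "HOL-Algebra.Group" "HOL-Algebra.Generated_Groups"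
begin

definition topological_group :: "'g monoid \<Rightarrow> 'g topology \<Rightarrow> bool" where
  "topological_group G T \<longleftrightarrow> group G \<and> topspace T = carrier G \<and> Hausdorff_space T \<and>
     continuous_map (prod_topology T T) T (\<lambda>(x, y). x \<otimes>\<^bsub>G\<^esub> y) \<and>
     continuous_map T T (m_inv G)"

inductive_set iter_partials :: "'a::euclidean_space set \<Rightarrow> ('a \<Rightarrow> 'b::real_normed_vector) \<Rightarrow> ('a \<Rightarrow> 'b) set"
  for S f where
  base: "f \<in> iter_partials S f"
| step: "g \<in> iter_partials S f \<Longrightarrow> (\<forall>x\<in>S. g differentiable (at x)) \<Longrightarrow> b \<in> Basis \<Longrightarrow>
         (\<lambda>x. frechet_derivative g (at x) b) \<in> iter_partials S f"

definition smooth_on :: "'a::euclidean_space set \<Rightarrow> ('a \<Rightarrow> 'b::real_normed_vector) \<Rightarrow> bool" where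
  "smooth_on S f \<longleftrightarrow> open S \<and>
     (\<forall>g\<in>iter_partials S f. (\<forall>x\<in>S. g differentiable (at x)) \<and> continuous_on S g)"

definition smooth_atlas :: "'n::finite itself \<Rightarrow> 'x topology \<Rightarrow> ('x set \<times> ('x \<Rightarrow> real^'n)) set \<Rightarrow> bool" where
  "smooth_atlas _ X A \<longleftrightarrow>
     (\<forall>(U, \<phi>)\<in>A. openin X U \<and> open (\<phi> ` U) \<and>
        homeomorphic_map (subtopology X U) (top_of_set (\<phi> ` U)) \<phi>) \<and>
     \<Union>(fst ` A) = topspace X \<and>
     (\<forall>(U, \<phi>)\<in>A. \<forall>(V, \<psi>)\<in>A. smooth_on (\<phi> ` (U \<inter> V)) (\<psi> \<circ> inv_into U \<phi>))"

definition lie_group :: "'n::finite itself \<Rightarrow> 'l monoid \<Rightarrow> 'l topology \<Rightarrow> bool" where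
  "lie_group _ L X \<longleftrightarrow> topological_group L X \<and> second_countable X \<and>
     (\<exists>A :: ('l set \<times> ('l \<Rightarrow> real^'n)) set. smooth_atlas TYPE('n) X A \<and>
        (\<forall>(U, \<phi>)\<in>A. \<forall>(V, \<psi>)\<in>A. \<forall>(W, \<theta>)\<in>A.
           smooth_on {(a, b). a \<in> \<phi> ` U \<and> b \<in> \<psi> ` V \<and>
                              inv_into U \<phi> a \<otimes>\<^bsub>L\<^esub> inv_into V \<psi> b \<in> W}
                     (\<lambda>(a, b). \<theta> (inv_into U \<phi> a \<otimes>\<^bsub>L\<^esub> inv_into V \<psi> b))) \<and>
        (\<forall>(U, \<phi>)\<in>A. \<forall>(V, \<psi>)\<in>A.
           smooth_on {a. a \<in> \<phi> ` U \<and> inv\<^bsub>L\<^esub> (inv_into U \<phi> a) \<in> V}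
                     (\<lambda>a. \<psi> (inv\<^bsub>L\<^esub> (inv_into U \<phi> a)))))"

primrec lower_central :: "'g monoid \<Rightarrow> nat \<Rightarrow> 'g set" where
  "lower_central G 0 = carrier G"
| "lower_central G (Suc k) = generate G
     {x \<otimes>\<^bsub>G\<^esub> y \<otimes>\<^bsub>G\<^esub> inv\<^bsub>G\<^esub> x \<otimes>\<^bsub>G\<^esub> inv\<^bsub>G\<^esub> y | x y. x \<in> lower_central G k \<and> y \<in> carrier G}"

definition nilpotent_group :: "'g monoid \<Rightarrow> bool" where
  "nilpotent_group G \<longleftrightarrow> group G \<and> (\<exists>k. lower_central G k = {\<one>\<^bsub>G\<^esub>})"

definition simply_connected_space :: "'x topology \<Rightarrow> bool" where
  "simply_connected_space X \<longleftrightarrow> path_connected_space X \<and>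
     (\<forall>g. pathin X g \<and> g 1 = g 0 \<longrightarrow>
        homotopic_with (\<lambda>h. h 0 = g 0 \<and> h 1 = g 0) (subtopology euclideanreal {0..1}) X g (\<lambda>_. g 0))"

text \<open>Connected simply connected nilpotent Lie group of dimension CARD('n), or the trivial
  (0-dimensional) Lie group.\<close>
definition csc_nilpotent_lie_group :: "'n::finite itself \<Rightarrow> 'l monoid \<Rightarrow> 'l topology \<Rightarrow> bool" where
  "csc_nilpotent_lie_group _ L X \<longleftrightarrow>
     (topological_group L X \<and> carrier L = {\<one>\<^bsub>L\<^esub>}) \<or>
     (lie_group TYPE('n) L X \<and> connected_space X \<and> simply_connected_space X \<and> nilpotent_group L)"

definition malcev_group :: "'n::finite itself \<Rightarrow> 'l itself \<Rightarrow> 'g monoid \<Rightarrow> 'g topology \<Rightarrow> bool" where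
  "malcev_group _ _ G T \<longleftrightarrow> topological_group G T \<and> locally_compact_space T \<and>
     (\<exists>K. compactin T K \<and> generate G K = carrier G) \<and>
     (\<exists>(L :: 'l monoid) X f. csc_nilpotent_lie_group TYPE('n) L X \<and> f \<in> hom G L \<and>
        embedding_map T X f \<and> closedin X (f ` carrier G) \<and>
        (\<exists>C. compactin X C \<and> carrier L = {c \<otimes>\<^bsub>L\<^esub> f g | c g. c \<in> C \<and> g \<in> carrier G}))"

definition isometric_banach_module :: "'g monoid \<Rightarrow> 'g topology \<Rightarrow> ('g \<Rightarrow> 'e::banach \<Rightarrow> 'e) \<Rightarrow> bool" where
  "isometric_banach_module G T \<rho> \<longleftrightarrow>
     (\<forall>g\<in>carrier G. linear (\<rho> g) \<and> (\<forall>\<xi>. norm (\<rho> g \<xi>) = norm \<xi>)) \<and>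
     (\<forall>\<xi>. \<rho> \<one>\<^bsub>G\<^esub> \<xi> = \<xi>) \<and>
     (\<forall>g\<in>carrier G. \<forall>h\<in>carrier G. \<forall>\<xi>. \<rho> (g \<otimes>\<^bsub>G\<^esub> h) \<xi> = \<rho> g (\<rho> h \<xi>)) \<and>
     continuous_map (prod_topology T euclidean) euclidean (\<lambda>(g, \<xi>). \<rho> g \<xi>)"

definition weak_topology :: "'e::real_normed_vector topology" where
  "weak_topology = topology_generated_by
     {{x. f x \<in> U} | (f :: 'e \<Rightarrow> real) U. bounded_linear f \<and> open U}"

definition weakly_almost_periodic :: "'g monoid \<Rightarrow> ('g \<Rightarrow> 'e::real_normed_vector \<Rightarrow> 'e) \<Rightarrow> bool" where
  "weakly_almost_periodic G \<rho> \<longleftrightarrow>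
     (\<forall>\<xi>. compactin weak_topology (weak_topology closure_of ((\<lambda>g. \<rho> g \<xi>) ` carrier G)))"

definition fixed_vectors :: "'g monoid \<Rightarrow> ('g \<Rightarrow> 'e \<Rightarrow> 'e) \<Rightarrow> 'e set" where
  "fixed_vectors G \<rho> = {\<xi>. \<forall>g\<in>carrier G. \<rho> g \<xi> = \<xi>}"

definition power_top :: "'g topology \<Rightarrow> nat \<Rightarrow> (nat \<Rightarrow> 'g) topology" where
  "power_top T n = product_topology (\<lambda>_. T) {..<n}"

definition cochains :: "'g topology \<Rightarrow> nat \<Rightarrow> ((nat \<Rightarrow> 'g) \<Rightarrow> 'e::real_normed_vector) set" where
  "cochains T n = {c. continuous_map (power_top T n) euclidean c}"

definition coboundary :: "'g monoid \<Rightarrow> ('g \<Rightarrow> 'e \<Rightarrow> 'e) \<Rightarrow> nat \<Rightarrow> ((nat \<Rightarrow> 'g) \<Rightarrow> 'e) \<Rightarrow>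
    (nat \<Rightarrow> 'g) \<Rightarrow> 'e::real_normed_vector" where
  "coboundary G \<rho> n c x =
     \<rho> (x 0) (c (restrict (\<lambda>i. x (Suc i)) {..<n}))
     + (\<Sum>i<n. (-1) ^ Suc i *\<^sub>R
          c (restrict (\<lambda>j. if j < i then x j else if j = i then x i \<otimes>\<^bsub>G\<^esub> x (Suc i) else x (Suc j)) {..<n}))
     + (-1) ^ Suc n *\<^sub>R c (restrict x {..<n})"

definition cocycles :: "'g monoid \<Rightarrow> 'g topology \<Rightarrow> ('g \<Rightarrow> 'e \<Rightarrow> 'e) \<Rightarrow> nat \<Rightarrow> ((nat \<Rightarrow> 'g) \<Rightarrow> 'e::real_normed_vector) set" where
  "cocycles G T \<rho> n = {c \<in> cochains T n. \<forall>x\<in>topspace (power_top T (Suc n)). coboundary G \<rho> n c x = 0}"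

definition coboundaries :: "'g monoid \<Rightarrow> 'g topology \<Rightarrow> ('g \<Rightarrow> 'e \<Rightarrow> 'e) \<Rightarrow> nat \<Rightarrow> ((nat \<Rightarrow> 'g) \<Rightarrow> 'e::real_normed_vector) set" where
  "coboundaries G T \<rho> n = (if n = 0 then {\<lambda>_. 0} else coboundary G \<rho> (n - 1) ` cochains T (n - 1))"

definition compact_open_closure :: "'g topology \<Rightarrow> nat \<Rightarrow> ((nat \<Rightarrow> 'g) \<Rightarrow> 'e::real_normed_vector) set \<Rightarrow> ((nat \<Rightarrow> 'g) \<Rightarrow> 'e) set" where
  "compact_open_closure T n B = {c. \<forall>K. compactin (power_top T n) K \<longrightarrow>
      (\<forall>\<epsilon>>0. \<exists>b\<in>B. \<forall>x\<in>K. norm (c x - b x) < \<epsilon>)}"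

definition reduced_cohomology_vanishes :: "'g monoid \<Rightarrow> 'g topology \<Rightarrow> ('g \<Rightarrow> 'e::real_normed_vector \<Rightarrow> 'e) \<Rightarrow> nat \<Rightarrow> bool" where
  "reduced_cohomology_vanishes G T \<rho> n \<longleftrightarrow>
     cocycles G T \<rho> n \<subseteq> compact_open_closure T n (coboundaries G T \<rho> n)"

end

theory Submission
  imports Defs "HOL-Complex_Analysis.Great_Picard"
begin

text \<open>
  A Mal'cev group \<open>G\<close> is a nilpotent topological group. Let \<open>Z\<^sub>i\<close> be the upper central series and
  \<open>V\<^sub>i\<close> the vectors fixed by \<open>Z\<^sub>i\<close>, so that \<open>V\<^sub>0\<close> is the whole module and \<open>V\<^sub>k = 0\<close> once \<open>Z\<^sub>k = G\<close>.
  The group \<open>Z\<^sub>i\<^sub>+\<^sub>1\<close> acts on \<open>V\<^sub>i\<close> by commuting \<open>G\<close>-equivariant isometries with relatively weakly compact orbits,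
  so the mean ergodic theorem gives an equivariant projection \<open>P\<^sub>i\<close> from \<open>V\<^sub>i\<close> to \<open>V\<^sub>i\<^sub>+\<^sub>1\<close> that is a strong limit of
  convex averages of \<open>Z\<^sub>i\<^sub>+\<^sub>1\<close>. It suffices that a cocycle \<open>c\<close> with values in \<open>V\<^sub>i\<close> differs from \<open>P\<^sub>i c\<close> by a
  limit of coboundaries, and hence that \<open>z c - c\<close> is such a limit for every \<open>z \<in> Z\<^sub>i\<^sub>+\<^sub>1\<close>.

  The latter follows from the algebraic fact that some power of \<open>\<theta> = z - 1\<close> maps \<open>c\<close> to a coboundary: Cesaro
  means of \<open>z\<close> composed with \<open>\<theta>\<close> tend to zero in norm, which lowers the power to one. For central \<open>z\<close> the
  fact is classical, as \<open>z\<close> acts trivially on cohomology. In general one resolves the homogeneous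
  cochains by auxiliary points in the conjugacy class of \<open>z\<close>, first modulo \<open>Z\<^sub>i\<close>, then modulo \<open>Z\<^sub>i\<^sub>-\<^sub>1\<close>, and so on.
  With a point given exactly, translation by it is homotopic to the identity. Each resolution is
  contracted by inserting a point that is already present, without choosing sections of quotients.
\<close>

section \<open>Hahn-Banach separation\<close>

text \<open>Weak compactness is given for single orbits, not for their convex hulls. The mean
  ergodic theorem therefore rests on a dichotomy: either all averages of a vector can be averaged
  further towards one finite-dimensional hull, where norm compactness yields a nearly fixed point,
  or they escape every such hull, and separating functionals then contradict weak compactness of the
  orbit alone.

  The algebraic obstacle is that \<open>z\<close> is central only modulo \<open>Z\<^sub>i\<close>.
  It commutes with the group on \<open>V\<^sub>i\<close>, but cochains are functions on
  \<open>G\<close> and not on the quotient, and left translation of simplices by \<open>z\<close> is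
  not equivariant. Translation by \<open>x\<^sub>0 z x\<^sub>0\<^sup>-\<^sup>1\<close> is, yet this
  conjugate changes when a face drops \<open>x\<^sub>0\<close>. The auxiliary points absorb this
  change one central layer at a time. Removing a layer corrects primitives repeatedly and may cost a
  factor of \<theta> each time, whence a power.

  Passing to closures is used twice: Cesaro means remove that power, and averages replace the
  projection uniformly on compact sets. All primitives are kept inside \<open>V\<^sub>i\<close>, as
  only there the operators involved commute with the group.\<close>

definition sublinear_fun :: "('a::real_vector \<Rightarrow> real) \<Rightarrow> bool" where
  "sublinear_fun p \<longleftrightarrow> (\<forall>x y. p (x + y) \<le> p x + p y) \<and> (\<forall>c x. 0 \<le> c \<longrightarrow> p (c *\<^sub>R x) \<le> c * p x)"

lemma sublinear_fun_zero:
  assumes "sublinear_fun p" shows "p 0 = 0"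
proof -
  have "p (0 + 0) \<le> p 0 + p 0" "p (0 *\<^sub>R 0) \<le> 0 * p 0"
    using assms unfolding sublinear_fun_def by blast+
  then show ?thesis by simp
qed

lemma sublinear_fun_neg:
  assumes "sublinear_fun p" shows "- p (- x) \<le> p x"
proof -
  have "p (x + - x) \<le> p x + p (- x)"
    using assms unfolding sublinear_fun_def by blast
  then show ?thesis using sublinear_fun_zero[OF assms] by simp
qed

lemma sublinear_fun_scale:
  assumes "sublinear_fun p" "0 \<le> c" shows "p (c *\<^sub>R x) = c * p x"
proof (cases "c = 0")
  case True then show ?thesis using sublinear_fun_zero[OF assms(1)] by simp
next
  case False
  then have c: "c > 0" using assms by simp
  have "p (inverse c *\<^sub>R (c *\<^sub>R x)) \<le> inverse c * p (c *\<^sub>R x)"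
    using assms c unfolding sublinear_fun_def by (meson inverse_nonnegative_iff_nonnegative)
  then have "p x \<le> inverse c * p (c *\<^sub>R x)" using c by simp
  then have "c * p x \<le> p (c *\<^sub>R x)" using c by (simp add: field_simps)
  moreover have "p (c *\<^sub>R x) \<le> c * p x"
    using assms unfolding sublinear_fun_def by blast
  ultimately show ?thesis by simp
qed

text \<open>Two members of a chain are comparable, so the smaller one bounds both summands at once;
  for an arbitrary family subadditivity of the infimum could fail.\<close>

lemma sublinear_fun_Inf_chain:
  assumes ne: "C \<noteq> {}" and sub: "\<And>q. q \<in> C \<Longrightarrow> sublinear_fun q"
    and lower: "\<And>x. bdd_below ((\<lambda>q. q x) ` C)"
    and chain: "\<And>q r. q \<in> C \<Longrightarrow> r \<in> C \<Longrightarrow> q \<le> r \<or> r \<le> q"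
  shows "sublinear_fun (\<lambda>x. INF q\<in>C. q x)"
  unfolding sublinear_fun_def
proof (intro conjI allI impI)
  fix x y
  have *: "(INF q\<in>C. q (x + y)) \<le> q x + r y" if "q \<in> C" "r \<in> C" for q r
  proof -
    have "q \<le> r \<or> r \<le> q" using chain that by blast
    with that obtain m where m: "m \<in> C" "m \<le> q" "m \<le> r" by (metis order_refl)
    have "(INF q\<in>C. q (x + y)) \<le> m (x + y)" using m lower by (intro cINF_lower)
    also have "\<dots> \<le> m x + m y" using sub[OF m(1)] unfolding sublinear_fun_def by blast
    also have "\<dots> \<le> q x + r y" using m by (intro add_mono) (auto simp: le_fun_def)
    finally show ?thesis .
  qed
  have "(INF q\<in>C. q (x + y)) - r y \<le> (INF q\<in>C. q x)" if "r \<in> C" for r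
    by (rule cINF_greatest[OF ne]) (use *[OF _ that] in \<open>simp add: algebra_simps\<close>)
  then have "(INF q\<in>C. q (x + y)) - (INF q\<in>C. q x) \<le> (INF q\<in>C. q y)"
    by (intro cINF_greatest[OF ne]) (simp add: algebra_simps)
  then show "(INF q\<in>C. q (x + y)) \<le> (INF q\<in>C. q x) + (INF q\<in>C. q y)" by simp
next
  fix c :: real and x assume c: "0 \<le> c"
  show "(INF q\<in>C. q (c *\<^sub>R x)) \<le> c * (INF q\<in>C. q x)"
  proof (cases "c = 0")
    case True
    obtain q where "q \<in> C" using ne by blast
    then have "(INF q\<in>C. q (c *\<^sub>R x)) \<le> q (c *\<^sub>R x)" using lower by (intro cINF_lower)
    then show ?thesis using True sublinear_fun_zero[OF sub[OF \<open>q \<in> C\<close>]] by simp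
  next
    case False
    then have c: "c > 0" using c by simp
    have "(INF q\<in>C. q (c *\<^sub>R x)) / c \<le> q x" if "q \<in> C" for q
    proof -
      have "(INF q\<in>C. q (c *\<^sub>R x)) \<le> q (c *\<^sub>R x)" using that lower by (intro cINF_lower)
      then show ?thesis using sublinear_fun_scale[OF sub[OF that], of c x] c by (simp add: field_simps)
    qed
    then have "(INF q\<in>C. q (c *\<^sub>R x)) / c \<le> (INF q\<in>C. q x)" by (intro cINF_greatest[OF ne])
    then show ?thesis using c by (simp add: field_simps)
  qed
qed

text \<open>The lowering step of Hahn-Banach along the ray of \<open>a\<close>. If \<open>q\<close>
  is minimal then \<open>r = q\<close>, and the third claim becomes superadditivity of
  \<open>q\<close>.\<close>

lemma sublinear_fun_shift:
  fixes a :: "'a::real_vector"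
  assumes sub: "sublinear_fun q"
  defines "r \<equiv> \<lambda>x. INF t\<in>{0..}. q (x + t *\<^sub>R a) - t * q a"
  shows "sublinear_fun r" "r \<le> q" "r x \<le> q (x + a) - q a"
proof -
  have add: "q (x + y) \<le> q x + q y" for x y using sub unfolding sublinear_fun_def by blast
  have lower: "bdd_below ((\<lambda>t. q (x + t *\<^sub>R a) - t * q a) ` {0..})" for x
  proof (rule bdd_belowI2)
    fix t :: real assume "t \<in> {0..}"
    then have "t * q a = q (t *\<^sub>R a)" using sublinear_fun_scale[OF sub] by simp
    also have "\<dots> = q ((x + t *\<^sub>R a) + (- x))" by simp
    also have "\<dots> \<le> q (x + t *\<^sub>R a) + q (- x)" by (rule add)
    finally show "- q (- x) \<le> q (x + t *\<^sub>R a) - t * q a" by simp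
  qed
  have le: "r x \<le> q (x + t *\<^sub>R a) - t * q a" if "t \<ge> 0" for x t
    unfolding r_def using lower that by (intro cINF_lower) auto
  show "r x \<le> q (x + a) - q a" using le[of 1 x] by simp
  show "r \<le> q" using le[of 0] by (simp add: le_fun_def)
  show "sublinear_fun r" unfolding sublinear_fun_def
  proof (intro conjI allI impI)
    fix x y
    have *: "r (x + y) \<le> (q (x + s *\<^sub>R a) - s * q a) + (q (y + t *\<^sub>R a) - t * q a)" if "s \<ge> 0" "t \<ge> 0" for s t
    proof -
      have "r (x + y) \<le> q ((x + y) + (s + t) *\<^sub>R a) - (s + t) * q a" using that by (intro le) auto
      also have "(x + y) + (s + t) *\<^sub>R a = (x + s *\<^sub>R a) + (y + t *\<^sub>R a)" by (simp add: algebra_simps)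
      finally show ?thesis using add[of "x + s *\<^sub>R a" "y + t *\<^sub>R a"] by (simp add: algebra_simps)
    qed
    have "r (x + y) - (q (y + t *\<^sub>R a) - t * q a) \<le> r x" if "t \<ge> 0" for t
      unfolding r_def by (rule cINF_greatest) (use * that in \<open>auto simp: r_def algebra_simps\<close>)
    then have "r (x + y) - r x \<le> q (y + t *\<^sub>R a) - t * q a" if "t \<ge> 0" for t
      using that by (simp add: algebra_simps)
    then have "r (x + y) - r x \<le> r y"
      unfolding r_def by (intro cINF_greatest) auto
    then show "r (x + y) \<le> r x + r y" by simp
  next
    fix c :: real and x assume c: "0 \<le> c"
    show "r (c *\<^sub>R x) \<le> c * r x"
    proof (cases "c = 0")
      case True
      have "r 0 \<le> q (0 + 0 *\<^sub>R a) - 0 * q a" by (rule le) simp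
      then show ?thesis using True sublinear_fun_zero[OF sub] by simp
    next
      case False
      then have c: "c > 0" using c by simp
      have "r (c *\<^sub>R x) / c \<le> q (x + t *\<^sub>R a) - t * q a" if "t \<ge> 0" for t
      proof -
        have "r (c *\<^sub>R x) \<le> q (c *\<^sub>R x + (c * t) *\<^sub>R a) - (c * t) * q a" using that c by (intro le) auto
        also have "c *\<^sub>R x + (c * t) *\<^sub>R a = c *\<^sub>R (x + t *\<^sub>R a)" by (simp add: algebra_simps)
        also have "q (c *\<^sub>R (x + t *\<^sub>R a)) = c * q (x + t *\<^sub>R a)" using c sublinear_fun_scale[OF sub] by simp
        finally show ?thesis using c by (simp add: field_simps)
      qed
      then have "r (c *\<^sub>R x) / c \<le> r x" unfolding r_def by (intro cINF_greatest) auto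
      then show ?thesis using c by (simp add: field_simps)
    qed
  qed
qed

text \<open>A minimal sublinear functional below \<open>p\<close> is linear.\<close>
lemma sublinear_dominates_linear:
  fixes p :: "'a::real_vector \<Rightarrow> real"
  assumes p: "sublinear_fun p"
  obtains f where "linear f" "\<And>x. f x \<le> p x"
proof -
  define A where "A = {q. sublinear_fun q \<and> q \<le> p}"
  \<comment> \<open>The order is reversed, so that a maximal element in Zorn's lemma is a minimal
    functional.\<close>
  define R where "R = (\<lambda>q r. (r::'a \<Rightarrow> real) \<le> q)"
  have po: "partial_order_on A (relation_of R A)"
    unfolding partial_order_on_def preorder_on_def refl_on_def trans_def antisym_def relation_of_def R_def
    by auto
  have ch: "\<exists>u\<in>A. \<forall>a\<in>C. R a u" if "C \<in> Chains (relation_of R A)" for C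
  proof (cases "C = {}")
    case True
    then show ?thesis using p by (auto simp: A_def)
  next
    case False
    have CA: "C \<subseteq> A" and chain: "\<And>q r. q \<in> C \<Longrightarrow> r \<in> C \<Longrightarrow> q \<le> r \<or> r \<le> q"
      using that unfolding Chains_def relation_of_def R_def by auto
    have lower: "bdd_below ((\<lambda>q. q x) ` C)" for x
    proof (rule bdd_belowI2)
      fix q assume "q \<in> C"
      then have q: "sublinear_fun q" "q \<le> p" using CA by (auto simp: A_def)
      show "- p (- x) \<le> q x" using sublinear_fun_neg[OF q(1), of x] q(2) by (metis le_fun_def neg_le_iff_le order_trans)
    qed
    define u where "u = (\<lambda>x. INF q\<in>C. q x)"
    have u_le: "u \<le> q" if "q \<in> C" for q
      unfolding u_def le_fun_def using lower that by (auto intro: cINF_lower)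
    have "sublinear_fun u" unfolding u_def
      by (rule sublinear_fun_Inf_chain[OF False _ lower chain]) (use CA A_def in auto)
    moreover obtain q where "q \<in> C" using False by blast
    ultimately have "u \<in> A" using u_le CA unfolding A_def by force
    then show ?thesis using u_le unfolding R_def by blast
  qed
  obtain m where m: "m \<in> A" and min: "\<And>a. a \<in> A \<Longrightarrow> a \<le> m \<Longrightarrow> a = m"
    using predicate_Zorn[OF po ch] unfolding R_def by blast
  have sub: "sublinear_fun m" and mp: "m \<le> p" using m by (auto simp: A_def)
  have sup: "m x + m a \<le> m (x + a)" for x a
  proof -
    let ?r = "\<lambda>x. INF t\<in>{0..}. m (x + t *\<^sub>R a) - t * m a"
    have "?r \<in> A" using sublinear_fun_shift(1,2)[OF sub, of a] mp by (auto simp: A_def)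
    then have "?r = m" using min sublinear_fun_shift(2)[OF sub, of a] by blast
    then have "m x \<le> m (x + a) - m a" using sublinear_fun_shift(3)[OF sub, where x = x and a = a] by (metis (no_types, lifting))
    then show ?thesis by simp
  qed
  have add: "m (x + y) = m x + m y" for x y
    using sup[of x y] sub unfolding sublinear_fun_def by (simp add: order_antisym)
  have neg: "m (- x) = - m x" for x using add[of x "- x"] sublinear_fun_zero[OF sub] by simp
  have "m (c *\<^sub>R x) = c * m x" for c x
  proof (cases "c \<ge> 0")
    case True then show ?thesis by (rule sublinear_fun_scale[OF sub])
  next
    case False
    then have "m ((- c) *\<^sub>R x) = - c * m x" by (intro sublinear_fun_scale[OF sub]) simp
    then show ?thesis using neg[of "c *\<^sub>R x"] by simp
  qed
  then have "linear m" using add by (intro linearI) auto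
  then show ?thesis using that mp by (auto simp: le_fun_def)
qed

text \<open>\<open>p\<close> is the norm lowered along \<open>D\<close>. Taking \<open>t = 1\<close>
  at \<open>- d\<close> gives \<open>p (- d) \<le> - \<delta>\<close>, so every linear \<psi> below
  \<open>p\<close> has \<open>\<psi> d \<ge> \<delta>\<close>. Convexity of \<open>D\<close> makes
  \<open>p\<close> subadditive, and \<open>far\<close> bounds it below.\<close>

lemma separation_from_zero:
  fixes D :: "'e::real_normed_vector set"
  assumes conv: "convex D" and ne: "D \<noteq> {}" and far: "\<And>d. d \<in> D \<Longrightarrow> \<delta> \<le> norm d" and "\<delta> \<ge> 0"
  obtains \<psi> where "bounded_linear \<psi>" "\<And>x. \<bar>\<psi> x\<bar> \<le> norm x" "\<And>d. d \<in> D \<Longrightarrow> \<delta> \<le> \<psi> d"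
proof -
  let ?I = "{0::real..} \<times> D"
  define h :: "'e \<Rightarrow> real \<times> 'e \<Rightarrow> real" where "h = (\<lambda>x (t, d). norm (x + t *\<^sub>R d) - t * \<delta>)"
  define p where "p = (\<lambda>x. INF i\<in>?I. h x i)"
  have lower: "bdd_below (h x ` ?I)" for x
  proof (rule bdd_belowI2)
    fix i assume "i \<in> ?I"
    then obtain t d where i: "i = (t, d)" "t \<ge> 0" "d \<in> D" by auto
    have "norm (t *\<^sub>R d) \<le> norm (x + t *\<^sub>R d) + norm x"
      using norm_triangle_ineq4[of "x + t *\<^sub>R d" x] by simp
    moreover have "t * \<delta> \<le> norm (t *\<^sub>R d)" using i far by (simp add: mult_left_mono)
    ultimately show "- norm x \<le> h x i" by (simp add: h_def i)
  qed
  have le: "p x \<le> norm (x + t *\<^sub>R d) - t * \<delta>" if "t \<ge> 0" "d \<in> D" for x t d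
    using cINF_lower[OF lower, of "(t, d)" x] that by (simp add: p_def h_def)
  have ge: "b \<le> p x" if "\<And>t d. t \<ge> 0 \<Longrightarrow> d \<in> D \<Longrightarrow> b \<le> norm (x + t *\<^sub>R d) - t * \<delta>" for b x
    unfolding p_def by (rule cINF_greatest) (use ne that in \<open>auto simp: h_def\<close>)
  have pn: "p x \<le> norm x" for x using le[of 0 _ x] ne by auto
  have "sublinear_fun p" unfolding sublinear_fun_def
  proof (intro conjI allI impI)
    fix x y
    have *: "p (x + y) \<le> (norm (x + s *\<^sub>R d) - s * \<delta>) + (norm (y + t *\<^sub>R e) - t * \<delta>)"
      if st: "s \<ge> 0" "t \<ge> 0" "d \<in> D" "e \<in> D" for s t d e
    proof (cases "s + t = 0")
      case True
      then have "s = 0" "t = 0" using st by auto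
      then show ?thesis using pn[of "x + y"] norm_triangle_ineq[of x y] by simp
    next
      case False
      then have pos: "s + t > 0" using st by simp
      define f where "f = (s / (s + t)) *\<^sub>R d + (t / (s + t)) *\<^sub>R e"
      have "f \<in> D" unfolding f_def using conv st pos
        by (intro convexD) (auto simp: add_divide_distrib[symmetric])
      then have "p (x + y) \<le> norm ((x + y) + (s + t) *\<^sub>R f) - (s + t) * \<delta>" using st by (intro le) auto
      also have "(x + y) + (s + t) *\<^sub>R f = (x + s *\<^sub>R d) + (y + t *\<^sub>R e)"
      proof -
        have "(s + t) *\<^sub>R f = s *\<^sub>R d + t *\<^sub>R e"
          unfolding f_def scaleR_add_right scaleR_scaleR using pos by simp
        then show ?thesis by simp
      qed
      finally show ?thesis using norm_triangle_ineq[of "x + s *\<^sub>R d" "y + t *\<^sub>R e"] by (simp add: algebra_simps)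
    qed
    have "p (x + y) - (norm (y + t *\<^sub>R e) - t * \<delta>) \<le> p x" if "t \<ge> 0" "e \<in> D" for t e
    proof (rule ge)
      fix s :: real and d assume "s \<ge> 0" "d \<in> D"
      then show "p (x + y) - (norm (y + t *\<^sub>R e) - t * \<delta>) \<le> norm (x + s *\<^sub>R d) - s * \<delta>"
        using *[of s t d e] that by simp
    qed
    then have "p (x + y) - p x \<le> p y" by (intro ge) (simp add: algebra_simps)
    then show "p (x + y) \<le> p x + p y" by simp
  next
    fix c :: real and x assume c: "0 \<le> c"
    show "p (c *\<^sub>R x) \<le> c * p x"
    proof (cases "c = 0")
      case True then show ?thesis using pn[of 0] by simp
    next
      case False
      then have c: "c > 0" using c by simp
      have "p (c *\<^sub>R x) / c \<le> p x"
      proof (rule ge)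
        fix t :: real and d assume td: "t \<ge> 0" "d \<in> D"
        have "p (c *\<^sub>R x) \<le> norm (c *\<^sub>R x + (c * t) *\<^sub>R d) - (c * t) * \<delta>" using td c by (intro le) auto
        also have "c *\<^sub>R x + (c * t) *\<^sub>R d = c *\<^sub>R (x + t *\<^sub>R d)" by (simp add: algebra_simps)
        also have "norm (c *\<^sub>R (x + t *\<^sub>R d)) = c * norm (x + t *\<^sub>R d)" using c by simp
        finally show "p (c *\<^sub>R x) / c \<le> norm (x + t *\<^sub>R d) - t * \<delta>" using c by (simp add: field_simps)
      qed
      then show ?thesis using c by (simp add: field_simps)
    qed
  qed
  then obtain \<psi> where lin: "linear \<psi>" and dom: "\<And>x. \<psi> x \<le> p x" using sublinear_dominates_linear by blast
  have abs: "\<bar>\<psi> x\<bar> \<le> norm x" for x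
    using dom[of x] pn[of x] dom[of "- x"] pn[of "- x"] linear_neg[OF lin, of x] by simp
  have bl: "bounded_linear \<psi>"
    using lin abs by (intro bounded_linear_intro[where K = 1]) (auto simp: linear_add linear_scale)
  have "\<delta> \<le> \<psi> d" if "d \<in> D" for d
    using dom[of "- d"] le[of 1 d "- d"] that linear_neg[OF lin, of d] by simp
  then show ?thesis using that bl abs by blast
qed

section \<open>Mean ergodic theorem for commuting isometries\<close>

text \<open>Finitely supported probabilities that all charge the sets \<open>B n\<close> uniformly: a replacement
  for the reverse Fatou lemma. Passing to a subsequence, the masses of the finite unions
  \<open>B n \<union> \<dots> \<union> B m\<close> converge, and \<open>M n\<close> is chosen so that enlarging the union beyond it gains little.\<close>
lemma uniformly_charged_sets_meet:
  fixes p :: "nat \<Rightarrow> 's \<Rightarrow> real"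
  assumes fin: "\<And>N. finite (D N)" and nonneg: "\<And>N s. s \<in> D N \<Longrightarrow> 0 \<le> p N s"
    and one: "\<And>N. sum (p N) (D N) = 1"
    and big: "\<And>n N. n \<le> N \<Longrightarrow> \<epsilon> \<le> sum (p N) (D N \<inter> B n)" and "\<epsilon> > 0"
  obtains M where "\<And>j. \<exists>N. \<exists>s\<in>D N. \<forall>n\<le>j. \<exists>l\<in>{n..M n}. s \<in> B l"
proof -
  define \<mu> where "\<mu> N X = sum (p N) (D N \<inter> X)" for N X
  define U where "U n m = (\<Union>l\<in>{n..m}. B l)" for n m :: nat
  have mono: "\<mu> N X \<le> \<mu> N Y" if "X \<subseteq> Y" for N X Y
    unfolding \<mu>_def using that fin nonneg by (intro sum_mono2) auto
  have pos: "0 \<le> \<mu> N X" for N X unfolding \<mu>_def using nonneg by (intro sum_nonneg) auto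
  have le1: "\<mu> N X \<le> 1" for N X using mono[of X UNIV N] one[of N] by (simp add: \<mu>_def)
  have diff: "\<mu> N (Y - X) = \<mu> N Y - \<mu> N X" if "X \<subseteq> Y" for N X Y
  proof -
    have "D N \<inter> (Y - X) = (D N \<inter> Y) - (D N \<inter> X)" by blast
    moreover have "D N \<inter> X \<subseteq> D N \<inter> Y" using that by blast
    ultimately show ?thesis unfolding \<mu>_def using fin by (simp add: sum_diff)
  qed
  \<comment> \<open>The masses lie between 0 and 1 and the index pairs are countable, so a diagonal
    subsequence makes all of them converge.\<close>
  have "\<exists>k. strict_mono (k :: nat \<Rightarrow> nat) \<and> (\<forall>x. \<exists>l. (\<lambda>N. (\<lambda>x. \<mu> (k N) (U (fst x) (snd x))) x) \<longlonglongrightarrow> l)"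
    by (rule function_convergent_subsequence[of UNIV "\<lambda>N x. \<mu> N (U (fst x) (snd x))" 1])
      (use pos le1 in auto)
  then obtain k where k: "strict_mono (k :: nat \<Rightarrow> nat)"
    and "\<And>x. \<exists>l. (\<lambda>N. \<mu> (k N) (U (fst x) (snd x))) \<longlonglongrightarrow> l"
    by blast
  then have "\<forall>n m. \<exists>l. (\<lambda>N. \<mu> (k N) (U n m)) \<longlonglongrightarrow> l" by (metis fst_conv snd_conv)
  then obtain L where L: "\<And>n m. (\<lambda>N. \<mu> (k N) (U n m)) \<longlonglongrightarrow> L n m" by metis
  have L_mono: "L n m \<le> L n m'" if "m \<le> m'" for n m m'
  proof (rule LIMSEQ_le[OF L L], intro exI allI impI)
    show "\<mu> (k N) (U n m) \<le> \<mu> (k N) (U n m')" for N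
    proof -
      have "{n..m} \<subseteq> {n..m'}" using that by auto
      then show ?thesis unfolding U_def by (intro mono UN_mono order_refl)
    qed
  qed
  have L_le1: "L n m \<le> 1" for n m by (rule LIMSEQ_le_const2[OF L]) (use le1 in auto)
  \<comment> \<open>\<open>M n\<close> nearly attains the supremum of \<open>L n\<close>. The
    allowances \<open>\<epsilon> / 2 ^ (n + 2)\<close> add up to at most \<epsilon> / 2, and
    \<open>M n \<ge> n\<close> keeps \<open>B n\<close> inside its union.\<close>
  have "\<exists>m\<ge>n. \<forall>m'. L n m' < L n m + \<epsilon> / 2 ^ (n + 2)" for n
  proof -
    have bdd: "bdd_above (range (L n))" using L_le1 by (intro bdd_aboveI2[where M = 1]) auto
    have "(SUP m. L n m) - \<epsilon> / 2 ^ (n + 2) < (SUP m. L n m)" using \<open>\<epsilon> > 0\<close> by simp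
    then obtain m where m: "(SUP m. L n m) - \<epsilon> / 2 ^ (n + 2) < L n m"
      using less_cSUP_iff[OF _ bdd] by auto
    have "L n m' < L n (max m n) + \<epsilon> / 2 ^ (n + 2)" for m'
      using cSUP_upper[OF _ bdd, of m'] m L_mono[of m "max m n" n] by simp
    then show ?thesis by (intro exI[of _ "max m n"]) simp
  qed
  then obtain M where M: "\<And>n. M n \<ge> n" "\<And>n m'. L n m' < L n (M n) + \<epsilon> / 2 ^ (n + 2)" by metis
  have "\<exists>N. \<exists>s\<in>D N. \<forall>n\<le>j. \<exists>l\<in>{n..M n}. s \<in> B l" for j
  proof -
    have "\<forall>\<^sub>F N in sequentially. \<mu> (k N) (U n (max (M j) (M n))) - \<mu> (k N) (U n (M n)) < \<epsilon> / 2 ^ (n + 2)" for n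
    proof -
      have "(\<lambda>N. \<mu> (k N) (U n (max (M j) (M n))) - \<mu> (k N) (U n (M n))) \<longlonglongrightarrow> L n (max (M j) (M n)) - L n (M n)"
        by (intro tendsto_diff L)
      moreover have "L n (max (M j) (M n)) - L n (M n) < \<epsilon> / 2 ^ (n + 2)"
        using M(2)[of n "max (M j) (M n)"] by simp
      ultimately show ?thesis by (rule order_tendstoD(2))
    qed
    then have "\<forall>\<^sub>F N in sequentially. \<forall>n\<in>{..<j}. \<mu> (k N) (U n (max (M j) (M n))) - \<mu> (k N) (U n (M n)) < \<epsilon> / 2 ^ (n + 2)"
      by (intro eventually_ball_finite) auto
    moreover have "\<forall>\<^sub>F N in sequentially. j \<le> k N"
      using filterlim_subseq[OF k] unfolding filterlim_at_top by blast
    ultimately obtain N where N: "j \<le> k N"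
      "\<And>n. n < j \<Longrightarrow> \<mu> (k N) (U n (max (M j) (M n))) - \<mu> (k N) (U n (M n)) < \<epsilon> / 2 ^ (n + 2)"
      using eventually_happens'[OF sequentially_bot eventually_conj] by (metis (no_types, lifting) lessThan_iff)
    let ?V = "\<lambda>n. U n (M n)"
    have small: "\<mu> (k N) (?V j - ?V n) \<le> \<epsilon> / 2 ^ (n + 2)" if "n < j" for n
    proof -
      have sub: "?V n \<subseteq> U n (max (M j) (M n))" "?V j \<subseteq> U n (max (M j) (M n))"
        using that unfolding U_def by (intro UN_mono; auto)+
      have "\<mu> (k N) (?V j - ?V n) \<le> \<mu> (k N) (U n (max (M j) (M n)) - ?V n)"
        using sub by (intro mono) blast
      also have "\<dots> \<le> \<epsilon> / 2 ^ (n + 2)" using diff[OF sub(1)] N(2)[OF that] by simp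
      finally show ?thesis .
    qed
    have geo: "(\<Sum>n<i. \<epsilon> / 2 ^ (n + 2)) = \<epsilon> / 2 - \<epsilon> / 2 ^ (i + 1)" for i
      by (induction i) (auto simp: field_simps)
    \<comment> \<open>Intersecting the \<open>j\<close>-th union with the earlier ones costs at most
      one allowance each, so more than \<epsilon> / 2 of the mass survives.\<close>
    have "\<mu> (k N) (?V j) - (\<Sum>n<i. \<epsilon> / 2 ^ (n + 2)) \<le> \<mu> (k N) (?V j \<inter> (\<Inter>n<i. ?V n))" if "i \<le> j" for i
      using that
    proof (induction i)
      case (Suc i)
      let ?W = "?V j \<inter> (\<Inter>n<i. ?V n)"
      have "\<mu> (k N) (?W \<inter> ?V i) = \<mu> (k N) ?W - \<mu> (k N) (?W - ?V i)"
      proof -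
        have "?W - (?W \<inter> ?V i) = ?W - ?V i" by blast
        then show ?thesis using diff[of "?W \<inter> ?V i" ?W "k N", OF Int_lower1] by simp
      qed
      moreover have "\<mu> (k N) (?W - ?V i) \<le> \<mu> (k N) (?V j - ?V i)" by (intro mono) blast
      moreover have "?W \<inter> ?V i = ?V j \<inter> (\<Inter>n<Suc i. ?V n)" by (auto simp: less_Suc_eq)
      ultimately show ?case using Suc small[of i] by (simp add: algebra_simps)
    qed simp
    from this[of j] have this0: "\<mu> (k N) (?V j) - (\<Sum>n<j. \<epsilon> / 2 ^ (n + 2)) \<le> \<mu> (k N) (?V j \<inter> (\<Inter>n<j. ?V n))" by simp
    have "\<mu> (k N) (?V j) - \<epsilon> / 2 < \<mu> (k N) (?V j \<inter> (\<Inter>n<j. ?V n))"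
    proof -
      have "\<epsilon> / 2 ^ (j + 1) > 0" using \<open>\<epsilon> > 0\<close> by simp
      then show ?thesis using this0 geo[of j] by linarith
    qed
    moreover have "\<epsilon> \<le> \<mu> (k N) (?V j)"
    proof -
      have "B j \<subseteq> ?V j" using M(1)[of j] unfolding U_def by auto
      then show ?thesis using big[OF N(1)] mono[of "B j" "?V j" "k N"] by (simp add: \<mu>_def)
    qed
    ultimately have "\<mu> (k N) (?V j \<inter> (\<Inter>n<j. ?V n)) > 0" using \<open>\<epsilon> > 0\<close> by simp
    then obtain s where "s \<in> D (k N)" "s \<in> ?V j \<inter> (\<Inter>n<j. ?V n)"
      unfolding \<mu>_def by (metis (no_types, lifting) Int_iff less_irrefl sum.empty all_not_in_conv)
    then have "\<forall>n\<le>j. \<exists>l\<in>{n..M n}. s \<in> B l" unfolding U_def by (auto simp: le_less)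
    then show ?thesis using \<open>s \<in> D (k N)\<close> by blast
  qed
  then show ?thesis by (rule that)
qed

section \<open>Averages over a commuting family of contractions\<close>

inductive_set convex_averages :: "('e::real_vector \<Rightarrow> 'e) set \<Rightarrow> ('e \<Rightarrow> 'e) set" for U where
  base: "u \<in> U \<Longrightarrow> u \<in> convex_averages U"
| convex: "a \<in> convex_averages U \<Longrightarrow> b \<in> convex_averages U \<Longrightarrow> 0 \<le> t \<Longrightarrow> t \<le> 1 \<Longrightarrow>
    (\<lambda>x. t *\<^sub>R a x + (1 - t) *\<^sub>R b x) \<in> convex_averages U"

lemma closedin_weak_ge: "bounded_linear f \<Longrightarrow> closedin weak_topology {x. c \<le> f x}"
  and closedin_weak_zero: "bounded_linear f \<Longrightarrow> closedin weak_topology {x. f x = 0}"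
  for f :: "'e::real_normed_vector \<Rightarrow> real"
proof -
  have op: "openin weak_topology {x. f x \<in> W}" if "bounded_linear f" "open W" for f :: "'e \<Rightarrow> real" and W
    unfolding weak_topology_def using that by (intro topology_generated_by_Basis) blast
  have top: "topspace (weak_topology :: 'e topology) = UNIV"
    using openin_subset[OF op[OF bounded_linear_zero open_UNIV]] by auto
  assume f: "bounded_linear f"
  have "UNIV - {x. c \<le> f x} = {x. f x \<in> {..<c}}" by auto
  then show "closedin weak_topology {x. c \<le> f x}"
    using op[OF f, of "{..<c}"] by (simp add: closedin_def top)
  have "UNIV - {x. f x = 0} = {x. f x \<in> - {0}}" by auto
  then show "closedin weak_topology {x. f x = 0}"
    using op[OF f, of "- {0}"] by (metis closedin_def top subset_UNIV open_Compl closed_singleton)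
qed

text \<open>A functional bounded below on a translate of a subspace must vanish on that subspace, so
  the separating functional annihilates \<open>Y\<close>.\<close>

lemma closure_span_separation:
  fixes Y :: "'e::real_normed_vector set"
  assumes "\<And>\<phi> :: 'e \<Rightarrow> real. bounded_linear \<phi> \<Longrightarrow> (\<forall>x\<in>Y. \<phi> x = 0) \<Longrightarrow> \<phi> y = 0"
  shows "y \<in> closure (span Y)"
proof (rule ccontr)
  assume "y \<notin> closure (span Y)"
  then obtain \<delta> where \<delta>: "\<delta> > 0" "\<And>x. x \<in> span Y \<Longrightarrow> \<delta> \<le> dist x y"
    unfolding closure_approachable by (meson not_le)
  let ?D = "(+) y ` span Y"
  have "convex ?D" by (intro convex_translation) (simp add: subspace_imp_convex)
  moreover have "?D \<noteq> {}" using span_zero by blast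
  moreover have "\<delta> \<le> norm d" if "d \<in> ?D" for d
    using that \<delta>(2)[OF span_neg] by (auto simp: dist_norm norm_minus_commute add.commute)
  ultimately obtain \<psi> where \<psi>: "bounded_linear \<psi>" "\<And>x. \<bar>\<psi> x\<bar> \<le> norm x" "\<And>d. d \<in> ?D \<Longrightarrow> \<delta> \<le> \<psi> d"
    using separation_from_zero[of ?D \<delta>] \<delta>(1) by (metis less_imp_le)
  interpret \<psi>: bounded_linear \<psi> by fact
  have "\<psi> x = 0" if "x \<in> span Y" for x
  proof (rule ccontr)
    assume nz: "\<psi> x \<noteq> 0"
    \<comment> \<open>The scalar is chosen so that \<psi> takes the value \<delta> - 1 on the
      translated point.\<close>
    have "((\<delta> - \<psi> y - 1) / \<psi> x) *\<^sub>R x \<in> span Y" using that by (rule span_scale)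
    then have "\<delta> \<le> \<psi> (y + ((\<delta> - \<psi> y - 1) / \<psi> x) *\<^sub>R x)" by (intro \<psi>(3)) blast
    then show False using nz by (simp add: \<psi>.add \<psi>.scaleR)
  qed
  then have "\<psi> y = 0" by (intro assms \<psi>(1)) (auto intro: span_base)
  moreover have "\<delta> \<le> \<psi> (y + 0)" by (intro \<psi>(3)) (use span_zero in blast)
  ultimately show False using \<delta>(1) by simp
qed

text \<open>Commutation is asked only on \<open>V\<close>, because
  \<open>Z\<^sub>i\<^sub>+\<^sub>1\<close> acts commutatively on \<open>V\<^sub>i\<close> but in
  general not on the whole module.\<close>

locale commuting_contractions =
  fixes U :: "('e::banach \<Rightarrow> 'e) set" and V :: "'e set"
  assumes ne: "U \<noteq> {}"
    and lin: "u \<in> U \<Longrightarrow> linear u"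
    and contr: "u \<in> U \<Longrightarrow> norm (u x) \<le> norm x"
    and comp: "u \<in> U \<Longrightarrow> v \<in> U \<Longrightarrow> u \<circ> v \<in> U"
    and subsp: "subspace V"
    and closed: "closed V"
    and inv: "u \<in> U \<Longrightarrow> x \<in> V \<Longrightarrow> u x \<in> V"
    and comm: "u \<in> U \<Longrightarrow> v \<in> U \<Longrightarrow> x \<in> V \<Longrightarrow> u (v x) = v (u x)"
begin

abbreviation "A \<equiv> convex_averages U"

lemma avg_linear: "a \<in> A \<Longrightarrow> linear a"
  by (induction rule: convex_averages.induct)
    (auto simp: lin linear_add linear_scale algebra_simps intro!: linearI)

lemma avg_norm: "a \<in> A \<Longrightarrow> norm (a x) \<le> norm x"
proof (induction arbitrary: x rule: convex_averages.induct)
  case (convex a b t)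
  have "norm (t *\<^sub>R a x + (1 - t) *\<^sub>R b x) \<le> t * norm (a x) + (1 - t) * norm (b x)"
    using convex norm_triangle_ineq[of "t *\<^sub>R a x" "(1 - t) *\<^sub>R b x"] by simp
  also have "\<dots> \<le> t * norm x + (1 - t) * norm x"
    using convex by (intro add_mono mult_left_mono) auto
  finally show ?case by (simp add: algebra_simps)
qed (rule contr)

lemma avg_diff: "a \<in> A \<Longrightarrow> a (x - y) = a x - a y"
  using avg_linear linear_diff by blast

lemma avg_lipschitz: "a \<in> A \<Longrightarrow> norm (a x - a y) \<le> norm (x - y)"
  using avg_norm[of a "x - y"] by (simp add: avg_diff)

lemma avg_inv: "a \<in> A \<Longrightarrow> x \<in> V \<Longrightarrow> a x \<in> V"
  by (induction rule: convex_averages.induct) (auto simp: inv subsp subspace_add subspace_scale)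

lemma avg_comp: assumes "a \<in> A" "b \<in> A" shows "(\<lambda>x. a (b x)) \<in> A"
  using assms
proof (induction a rule: convex_averages.induct)
  case (base u)
  from base(2) show ?case
  proof (induction b rule: convex_averages.induct)
    case (base v)
    then show ?case using comp[OF \<open>u \<in> U\<close>, of v] convex_averages.base by (simp add: comp_def)
  next
    case (convex a b t)
    have "(\<lambda>x. u (t *\<^sub>R a x + (1 - t) *\<^sub>R b x)) = (\<lambda>x. t *\<^sub>R u (a x) + (1 - t) *\<^sub>R u (b x))"
      using lin[OF \<open>u \<in> U\<close>] by (simp add: linear_add linear_scale)
    then show ?case using convex_averages.convex[OF convex.IH convex.hyps(3,4)] by simp
  qed
next
  case (convex a b t)
  then show ?case by (intro convex_averages.convex) auto
qed

lemma avg_comm: assumes "a \<in> A" "b \<in> A" "x \<in> V" shows "a (b x) = b (a x)"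
  using assms
proof (induction a arbitrary: x rule: convex_averages.induct)
  case (base u)
  from base(2,3) show ?case
  proof (induction b arbitrary: x rule: convex_averages.induct)
    case (base v) then show ?case using comm \<open>u \<in> U\<close> by blast
  next
    case (convex a b t)
    then show ?case using lin[OF \<open>u \<in> U\<close>] by (simp add: linear_add linear_scale)
  qed
next
  case (convex a b' t)
  then show ?case using avg_linear[OF \<open>b \<in> A\<close>] by (simp add: linear_add linear_scale)
qed

text \<open>The inductive form suits algebra with averages;
  \<open>uniformly_charged_sets_meet\<close> needs an explicit finite probability on
  \<open>U\<close>.\<close>

lemma avg_rep:
  assumes "a \<in> A"
  shows "\<exists>D p. finite D \<and> D \<subseteq> U \<and> (\<forall>u\<in>D. (0::real) \<le> p u) \<and> sum p D = 1 \<and> (\<forall>x. a x = (\<Sum>u\<in>D. p u *\<^sub>R u x))"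
  using assms
proof (induction rule: convex_averages.induct)
  case (base u)
  then show ?case by (intro exI[of _ "{u}"] exI[of _ "\<lambda>_. 1"]) auto
next
  case (convex a b t)
  obtain D p where a: "finite D" "D \<subseteq> U" "\<forall>u\<in>D. (0::real) \<le> p u" "sum p D = 1" "\<And>x. a x = (\<Sum>u\<in>D. p u *\<^sub>R u x)"
    using convex.IH(1) by blast
  obtain E q where b: "finite E" "E \<subseteq> U" "\<forall>u\<in>E. (0::real) \<le> q u" "sum q E = 1" "\<And>x. b x = (\<Sum>u\<in>E. q u *\<^sub>R u x)"
    using convex.IH(2) by blast
  define p' where "p' u = (if u \<in> D then p u else 0)" for u
  define q' where "q' u = (if u \<in> E then q u else 0)" for u
  have fin: "finite (D \<union> E)" using a b by simp
  have pD: "sum p' (D \<union> E) = 1" "(\<Sum>u\<in>D \<union> E. p' u *\<^sub>R u x) = a x" for x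
    unfolding a(4)[symmetric] a(5)
    by (rule sum.mono_neutral_cong_right; use fin in \<open>auto simp: p'_def\<close>)+
  have qE: "sum q' (D \<union> E) = 1" "(\<Sum>u\<in>D \<union> E. q' u *\<^sub>R u x) = b x" for x
    unfolding b(4)[symmetric] b(5)
    by (rule sum.mono_neutral_cong_right; use fin in \<open>auto simp: q'_def\<close>)+
  have "(\<Sum>u\<in>D \<union> E. t * p' u + (1 - t) * q' u) = 1"
    by (simp add: sum.distrib sum_distrib_left[symmetric] pD qE)
  moreover have "t *\<^sub>R a x + (1 - t) *\<^sub>R b x = (\<Sum>u\<in>D \<union> E. (t * p' u + (1 - t) * q' u) *\<^sub>R u x)" for x
    by (simp add: scaleR_add_left sum.distrib pD(2)[symmetric] qE(2)[symmetric] scaleR_sum_right)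
  moreover have "\<forall>u\<in>D \<union> E. 0 \<le> t * p' u + (1 - t) * q' u"
    using a(3) b(3) convex.hyps by (auto simp: p'_def q'_def)
  ultimately show ?case using fin a(2) b(2)
    by (intro exI[of _ "D \<union> E"] exI[of _ "\<lambda>u. t * p' u + (1 - t) * q' u"]) auto
qed

lemma funpow_mem: "u \<in> U \<Longrightarrow> u ^^ Suc n \<in> U"
  by (induction n) (auto simp: comp)

text \<open>The exponents start at one because the identity is not assumed to lie in
  \<open>U\<close>.\<close>

lemma cesaro_mem: "u \<in> U \<Longrightarrow> (\<lambda>x. (1 / real (Suc n)) *\<^sub>R (\<Sum>k\<le>n. (u ^^ Suc k) x)) \<in> A"
proof (induction n)
  case 0 then show ?case by (simp add: convex_averages.base)
next
  case (Suc n)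
  define t where "t = real (Suc n) / real (Suc (Suc n))"
  have "(\<lambda>x. t *\<^sub>R ((1 / real (Suc n)) *\<^sub>R (\<Sum>k\<le>n. (u ^^ Suc k) x)) + (1 - t) *\<^sub>R (u ^^ Suc (Suc n)) x) \<in> A"
    by (rule convex_averages.convex[OF Suc.IH[OF Suc.prems] convex_averages.base[OF funpow_mem[OF Suc.prems]]])
      (auto simp: t_def divide_le_eq_1)
  moreover have "1 - t = 1 / real (Suc (Suc n))" "t * (1 / real (Suc n)) = 1 / real (Suc (Suc n))"
    unfolding t_def by (auto simp: field_simps)
  ultimately show ?case by (simp only: scaleR_scaleR sum.atMost_Suc scaleR_add_right)
qed

text \<open>For a single operator a long Cesaro mean telescopes to two terms. For a convex
  combination the means found for the two parts are composed: by commutation and contraction the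
  composite still absorbs each part.\<close>

lemma avg_absorb:
  assumes "b \<in> A" "\<epsilon> > 0"
  shows "\<exists>a\<in>A. \<forall>x\<in>V. norm (b (a x) - a x) \<le> \<epsilon> * norm x"
  using assms(1)
proof (induction rule: convex_averages.induct)
  case (base u)
  obtain n where n: "2 / \<epsilon> < real n" using reals_Archimedean2 by blast
  let ?a = "\<lambda>x. (1 / real (Suc n)) *\<^sub>R (\<Sum>k\<le>n. (u ^^ Suc k) x)"
  have "norm (u (?a x) - ?a x) \<le> \<epsilon> * norm x" for x
  proof -
    have "u (?a x) - ?a x = (1 / real (Suc n)) *\<^sub>R (\<Sum>k\<le>n. (u ^^ Suc (Suc k)) x - (u ^^ Suc k) x)"
      using lin[OF base] by (simp add: linear_scale linear_sum sum_subtractf scaleR_diff_right)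
    also have "(\<Sum>k\<le>n. (u ^^ Suc (Suc k)) x - (u ^^ Suc k) x) = (u ^^ Suc (Suc n)) x - (u ^^ Suc 0) x"
      by (induction n) auto
    finally have "norm (u (?a x) - ?a x) = (1 / real (Suc n)) * norm ((u ^^ Suc (Suc n)) x - (u ^^ Suc 0) x)"
      by simp
    also have "\<dots> \<le> (1 / real (Suc n)) * (norm x + norm x)"
      using norm_triangle_ineq4[of "(u ^^ Suc (Suc n)) x" "(u ^^ Suc 0) x"]
        contr[OF funpow_mem[OF base, of "Suc n"], of x] contr[OF funpow_mem[OF base, of 0], of x]
      by (intro mult_left_mono) (linarith | simp)+
    also have "\<dots> = (2 / real (Suc n)) * norm x" by simp
    also have "\<dots> \<le> \<epsilon> * norm x"
    proof (rule mult_right_mono)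
      have "2 \<le> \<epsilon> * real (Suc n)" using n \<open>\<epsilon> > 0\<close> by (simp add: field_simps)
      then show "2 / real (Suc n) \<le> \<epsilon>" by (simp add: divide_le_eq)
    qed simp
    finally show ?thesis .
  qed
  then show ?case using cesaro_mem[OF base, of n] by (intro bexI[of _ ?a] ballI)
next
  case (convex b c t)
  obtain d where d: "d \<in> A" "\<And>x. x \<in> V \<Longrightarrow> norm (b (d x) - d x) \<le> \<epsilon> * norm x" using convex.IH(1) by auto
  obtain e where e: "e \<in> A" "\<And>x. x \<in> V \<Longrightarrow> norm (c (e x) - e x) \<le> \<epsilon> * norm x" using convex.IH(2) by auto
  have "norm ((t *\<^sub>R b (d (e x)) + (1 - t) *\<^sub>R c (d (e x))) - d (e x)) \<le> \<epsilon> * norm x" if x: "x \<in> V" for x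
  proof -
    have 1: "norm (b (d (e x)) - d (e x)) \<le> \<epsilon> * norm x"
      by (rule order_trans[OF d(2)[OF avg_inv[OF e(1) x]] mult_left_mono[OF avg_norm[OF e(1)]]])
        (use \<open>\<epsilon> > 0\<close> in simp)
    have "c (d (e x)) - d (e x) = d (c (e x) - e x)"
      using avg_comm[OF convex.hyps(2) d(1) avg_inv[OF e(1) x]] by (simp add: avg_diff[OF d(1)])
    then have 2: "norm (c (d (e x)) - d (e x)) \<le> \<epsilon> * norm x"
      using order_trans[OF avg_norm[OF d(1)] e(2)[OF x]] by simp
    have "(t *\<^sub>R b (d (e x)) + (1 - t) *\<^sub>R c (d (e x))) - d (e x)
        = t *\<^sub>R (b (d (e x)) - d (e x)) + (1 - t) *\<^sub>R (c (d (e x)) - d (e x))"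
      by (simp add: algebra_simps)
    also have "norm \<dots> \<le> t * norm (b (d (e x)) - d (e x)) + (1 - t) * norm (c (d (e x)) - d (e x))"
      using convex.hyps norm_triangle_ineq[of "t *\<^sub>R (b (d (e x)) - d (e x))" "(1 - t) *\<^sub>R (c (d (e x)) - d (e x))"] by simp
    also have "\<dots> \<le> t * (\<epsilon> * norm x) + (1 - t) * (\<epsilon> * norm x)"
      using convex.hyps 1 2 by (intro add_mono mult_left_mono) auto
    finally show ?thesis by (simp add: algebra_simps)
  qed
  then show ?case using avg_comp[OF d(1) e(1)] by (intro bexI[of _ "\<lambda>x. d (e x)"]) auto
qed

text \<open>A composite of all members works, since commutation moves any chosen factor
  innermost.\<close>

lemma avg_common_multiple:
  assumes "finite I" "I \<subseteq> A"
  shows "\<exists>a\<in>A. \<forall>b\<in>I. \<exists>c\<in>A. \<forall>x\<in>V. a x = c (b x)"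
  using assms
proof (induction rule: finite_induct)
  case empty
  then show ?case using ne convex_averages.base by blast
next
  case (insert b I)
  obtain a where a: "a \<in> A" "\<And>b'. b' \<in> I \<Longrightarrow> \<exists>c\<in>A. \<forall>x\<in>V. a x = c (b' x)" using insert by auto
  have b: "b \<in> A" using insert by simp
  have "\<exists>c\<in>A. \<forall>x\<in>V. a (b x) = c (b' x)" if b': "b' \<in> insert b I" for b'
  proof (cases "b' = b")
    case True then show ?thesis using a(1) by blast
  next
    case False
    then obtain c where c: "c \<in> A" "\<And>x. x \<in> V \<Longrightarrow> a x = c (b' x)" using a(2) b' by blast
    have "\<forall>x\<in>V. a (b x) = b (c (b' x))" using c avg_comm[OF a(1) b] by simp
    then show ?thesis using avg_comp[OF b c(1)] by (intro bexI[of _ "\<lambda>x. b (c x)"]) auto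
  qed
  then show ?case using avg_comp[OF a(1) b] by (intro bexI[of _ "\<lambda>x. a (b x)"]) auto
qed

text \<open>If every point of the norm compact hull were avoided by all further averages of some
  average, a common multiple of the averages belonging to a finite net would avoid the whole hull.
  So a single \<open>f\<close> can be approached from every average, and absorption makes it nearly
  fixed.\<close>

lemma approximately_fixed:
  assumes \<xi>: "\<xi> \<in> V" and "\<delta> > 0" "finite X"
    and near: "\<And>a. a \<in> A \<Longrightarrow> \<exists>a'\<in>A. \<exists>f\<in>convex hull X. norm (a' (a \<xi>) - f) < \<delta>"
  shows "\<exists>f. (\<exists>a\<in>A. norm (a \<xi> - f) \<le> 2 * \<delta>) \<and> (\<forall>b\<in>A. norm (b f - f) \<le> 5 * \<delta>)"
proof -
  have "\<exists>f. \<forall>a\<in>A. \<exists>a'\<in>A. norm (a' (a \<xi>) - f) < 2 * \<delta>"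
  proof (rule ccontr)
    assume "\<not> ?thesis"
    then have "\<forall>f. \<exists>b. b \<in> A \<and> (\<forall>a'\<in>A. 2 * \<delta> \<le> norm (a' (b \<xi>) - f))"
      by (simp add: not_less) blast
    then obtain g where g: "\<And>f. g f \<in> A" "\<And>f a'. a' \<in> A \<Longrightarrow> 2 * \<delta> \<le> norm (a' (g f \<xi>) - f)"
      by metis
    have "compact (convex hull X)" using \<open>finite X\<close> by (rule finite_imp_compact_convex_hull)
    then obtain F where F: "finite F" "convex hull X \<subseteq> (\<Union>f\<in>F. ball f \<delta>)"
    proof (rule compactE_image)
      show "convex hull X \<subseteq> (\<Union>f\<in>convex hull X. ball f \<delta>)" using \<open>\<delta> > 0\<close> by auto
    qed auto
    obtain a where a: "a \<in> A" "\<And>b. b \<in> g ` F \<Longrightarrow> \<exists>c\<in>A. \<forall>x\<in>V. a x = c (b x)"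
    proof -
      have "finite (g ` F)" "g ` F \<subseteq> A" using F(1) g(1) by auto
      from avg_common_multiple[OF this] show ?thesis using that by blast
    qed
    obtain a' h where h: "a' \<in> A" "h \<in> convex hull X" "norm (a' (a \<xi>) - h) < \<delta>" using near[OF a(1)] by blast
    then obtain f where f: "f \<in> F" "dist f h < \<delta>" using F by auto
    obtain c where c: "c \<in> A" "a \<xi> = c (g f \<xi>)" using a(2)[of "g f"] f \<xi> by blast
    have "2 * \<delta> \<le> norm (a' (c (g f \<xi>)) - f)" using g(2)[OF avg_comp[OF h(1) c(1)]] .
    also have "\<dots> \<le> norm (a' (a \<xi>) - h) + norm (h - f)" using norm_triangle_ineq[of "a' (a \<xi>) - h" "h - f"] c by simp
    also have "\<dots> < 2 * \<delta>" using h(3) f(2) by (simp add: dist_norm norm_minus_commute)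
    finally show False by simp
  qed
  then obtain f where f: "\<And>a. a \<in> A \<Longrightarrow> \<exists>a'\<in>A. norm (a' (a \<xi>) - f) < 2 * \<delta>" by blast
  have "\<exists>a\<in>A. norm (a \<xi> - f) \<le> 2 * \<delta>"
  proof -
    obtain u where u: "u \<in> A" using ne convex_averages.base by blast
    then obtain a' where "a' \<in> A" "norm (a' (u \<xi>) - f) < 2 * \<delta>" using f by blast
    then show ?thesis using avg_comp[OF _ u] by (intro bexI[of _ "\<lambda>x. a' (u x)"]) auto
  qed
  \<comment> \<open>The constant is 2 + 1 + 2: from \<open>b f\<close> to \<open>b ?y\<close>, from
    there to \<open>?y\<close>, and from \<open>?y\<close> to \<open>f\<close>.\<close>
  moreover have "norm (b f - f) \<le> 5 * \<delta>" if b: "b \<in> A" for b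
  proof -
    have "\<delta> / (norm \<xi> + 1) > 0" using \<open>\<delta> > 0\<close> by (intro divide_pos_pos add_nonneg_pos) auto
    then obtain a where a: "a \<in> A" "\<And>x. x \<in> V \<Longrightarrow> norm (b (a x) - a x) \<le> (\<delta> / (norm \<xi> + 1)) * norm x"
      using avg_absorb[OF b] by blast
    have "(\<delta> / (norm \<xi> + 1)) * norm \<xi> = \<delta> * (norm \<xi> / (norm \<xi> + 1))" by simp
    also have "\<dots> \<le> \<delta> * 1" using \<open>\<delta> > 0\<close> by (intro mult_left_mono) (auto simp: divide_le_eq_1 add_nonneg_pos)
    finally have 1: "norm (b (a \<xi>) - a \<xi>) \<le> \<delta>" using a(2)[OF \<xi>] by simp
    obtain a' where a': "a' \<in> A" "norm (a' (a \<xi>) - f) < 2 * \<delta>" using f[OF a(1)] by blast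
    let ?y = "a' (a \<xi>)"
    have "b ?y - ?y = a' (b (a \<xi>) - a \<xi>)"
      using avg_comm[OF b a'(1) avg_inv[OF a(1) \<xi>]] by (simp add: avg_diff[OF a'(1)])
    then have 2: "norm (b ?y - ?y) \<le> \<delta>" using order_trans[OF avg_norm[OF a'(1)] 1] by simp
    have 3: "norm (b f - b ?y) \<le> 2 * \<delta>" using avg_lipschitz[OF b, of f ?y] a'(2) by (simp add: norm_minus_commute)
    show ?thesis
      using 2 3 a'(2) norm_triangle_ineq[of "b f - b ?y" "b ?y - f"] norm_triangle_ineq[of "b ?y - ?y" "?y - f"]
      by simp
  qed
  ultimately show ?thesis by blast
qed

text \<open>Two approximate fixed points are compared through the product
  \<open>a n (a m \<xi>)\<close>, which by commutation is close to both; hence they form a Cauchy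
  sequence.\<close>

lemma fixed_point_of_approximate:
  assumes \<xi>: "\<xi> \<in> V"
    and approx: "\<And>\<delta>. \<delta> > 0 \<Longrightarrow> \<exists>f. (\<exists>a\<in>A. norm (a \<xi> - f) \<le> 2 * \<delta>) \<and> (\<forall>b\<in>A. norm (b f - f) \<le> 5 * \<delta>)"
  shows "\<exists>\<eta>\<in>V. (\<forall>u\<in>U. u \<eta> = \<eta>) \<and> (\<forall>\<epsilon>>0. \<exists>a\<in>A. norm (a \<xi> - \<eta>) < \<epsilon>)"
proof -
  define \<delta> where "\<delta> n = inverse (real (Suc n))" for n
  have \<delta>: "\<delta> n > 0" "\<delta> \<longlonglongrightarrow> 0" for n
    unfolding \<delta>_def using LIMSEQ_inverse_real_of_nat by auto
  have "\<exists>f a. a \<in> A \<and> norm (a \<xi> - f) \<le> 2 * \<delta> n \<and> (\<forall>b\<in>A. norm (b f - f) \<le> 5 * \<delta> n)" for n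
    using approx[OF \<delta>(1)[of n]] by auto
  then obtain f where "\<And>n. \<exists>a. a \<in> A \<and> norm (a \<xi> - f n) \<le> 2 * \<delta> n \<and> (\<forall>b\<in>A. norm (b (f n) - f n) \<le> 5 * \<delta> n)"
    by metis
  then obtain a where *: "\<And>n. a n \<in> A \<and> norm (a n \<xi> - f n) \<le> 2 * \<delta> n \<and> (\<forall>b\<in>A. norm (b (f n) - f n) \<le> 5 * \<delta> n)"
    by metis
  have a: "a n \<in> A" and af: "norm (a n \<xi> - f n) \<le> 2 * \<delta> n" for n
    using *[of n] by auto
  have bf: "norm (b (f n) - f n) \<le> 5 * \<delta> n" if "b \<in> A" for b n
    using *[of n] that by auto
  \<comment> \<open>7 = 2 + 5, the two tolerances in \<open>approx\<close>.\<close>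
  have near: "norm (b (a n \<xi>) - f n) \<le> 7 * \<delta> n" if "b \<in> A" for b n
    using avg_lipschitz[OF that, of "a n \<xi>" "f n"] af[of n] bf[OF that, of n]
      norm_triangle_ineq[of "b (a n \<xi>) - b (f n)" "b (f n) - f n"] by simp
  have ff: "dist (f m) (f n) \<le> 7 * \<delta> m + 7 * \<delta> n" for m n
  proof -
    have "a n (a m \<xi>) = a m (a n \<xi>)" using avg_comm[OF a a \<xi>] .
    then show ?thesis using near[OF a[of n], of m] near[OF a[of m], of n]
        norm_triangle_ineq4[of "a n (a m \<xi>) - f n" "a n (a m \<xi>) - f m"] by (simp add: dist_norm norm_minus_commute)
  qed
  have "Cauchy f"
  proof (rule metric_CauchyI)
    fix e :: real assume "e > 0"
    then have "\<forall>\<^sub>F n in sequentially. \<delta> n < e / 14" by (intro order_tendstoD(2)[OF \<delta>(2)]) simp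
    then obtain N where N: "\<And>n. n \<ge> N \<Longrightarrow> \<delta> n < e / 14" by (auto simp: eventually_sequentially)
    have "dist (f m) (f n) < e" if "m \<ge> N" "n \<ge> N" for m n
      using ff[of m n] N[OF that(1)] N[OF that(2)] by linarith
    then show "\<exists>N. \<forall>m\<ge>N. \<forall>n\<ge>N. dist (f m) (f n) < e" by blast
  qed
  then obtain \<eta> where \<eta>: "f \<longlonglongrightarrow> \<eta>" using Cauchy_convergent_iff convergent_def by blast
  have "(\<lambda>n. norm (a n \<xi> - f n)) \<longlonglongrightarrow> 0"
  proof (rule tendsto_sandwich[OF _ _ tendsto_const])
    show "(\<lambda>n. 2 * \<delta> n) \<longlonglongrightarrow> 0" using tendsto_mult_left[OF \<delta>(2), of 2] by simp
    show "\<forall>\<^sub>F n in sequentially. norm (a n \<xi> - f n) \<le> 2 * \<delta> n" by (intro always_eventually allI af)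
  qed simp
  then have "(\<lambda>n. (a n \<xi> - f n) + f n) \<longlonglongrightarrow> 0 + \<eta>" by (rule tendsto_add[OF tendsto_norm_zero_cancel \<eta>])
  then have lim: "(\<lambda>n. a n \<xi>) \<longlonglongrightarrow> \<eta>" by simp
  have "\<eta> \<in> V" using closed_sequentially[OF closed _ lim] avg_inv[OF a \<xi>] by simp
  moreover have "u \<eta> = \<eta>" if u: "u \<in> U" for u
  proof -
    have "bounded_linear u"
      using lin[OF u] contr[OF u] by (intro bounded_linear_intro[where K = 1]) (auto simp: linear_add linear_scale)
    then have "(\<lambda>n. u (f n) - f n) \<longlonglongrightarrow> u \<eta> - \<eta>"
      by (rule tendsto_diff[OF bounded_linear.tendsto[OF _ \<eta>] \<eta>])
    moreover have "(\<lambda>n. norm (u (f n) - f n)) \<longlonglongrightarrow> 0"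
    proof (rule tendsto_sandwich[OF _ _ tendsto_const])
      show "(\<lambda>n. 5 * \<delta> n) \<longlonglongrightarrow> 0" using tendsto_mult_left[OF \<delta>(2), of 5] by simp
      show "\<forall>\<^sub>F n in sequentially. norm (u (f n) - f n) \<le> 5 * \<delta> n"
        by (intro always_eventually allI bf convex_averages.base u)
    qed simp
    ultimately have "u \<eta> - \<eta> = 0" by (rule LIMSEQ_unique[OF _ tendsto_norm_zero_cancel])
    then show ?thesis by simp
  qed
  moreover have "\<exists>a\<in>A. norm (a \<xi> - \<eta>) < \<epsilon>" if "\<epsilon> > 0" for \<epsilon>
  proof -
    have "\<forall>\<^sub>F n in sequentially. dist (a n \<xi>) \<eta> < \<epsilon>" by (rule tendstoD[OF lim that])
    then obtain n where "dist (a n \<xi>) \<eta> < \<epsilon>" by (auto simp: eventually_sequentially)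
    then show ?thesis using a[of n] by (auto simp: dist_norm)
  qed
  ultimately show ?thesis by blast
qed

end

section \<open>Averages that escape every finite hull\<close>

context commuting_contractions begin

text \<open>The functionals \<open>\<psi> n\<close> separate the averages from growing cubes spanned by the orbit points used so far,
  hence tend to zero on the closed span of all of them. A point of \<open>K\<close> that is large for
  infinitely many \<open>\<psi> n\<close>, provided by \<open>uniformly_charged_sets_meet\<close> and compactness, contradicts this.\<close>
lemma escaping_averages_contradiction:
  assumes \<xi>: "\<xi> \<in> V" and K: "compactin weak_topology K" "\<And>u. u \<in> U \<Longrightarrow> u \<xi> \<in> K"
    and "\<delta> > 0"
    and far: "\<And>X. finite X \<Longrightarrow> \<exists>a\<in>A. \<forall>a'\<in>A. \<forall>f\<in>convex hull X. \<delta> \<le> norm (a' (a \<xi>) - f)"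
  shows False
proof -
  obtain aa where aa: "\<And>X. finite X \<Longrightarrow> aa X \<in> A"
    and aa_far: "\<And>X a' f. finite X \<Longrightarrow> a' \<in> A \<Longrightarrow> f \<in> convex hull X \<Longrightarrow> \<delta> \<le> norm (a' (aa X \<xi>) - f)"
    using far by metis
  have "\<exists>\<psi>. bounded_linear \<psi> \<and> (\<forall>x. \<bar>\<psi> x\<bar> \<le> norm x) \<and> (\<forall>a'\<in>A. \<forall>f\<in>X. \<delta> \<le> \<psi> (a' (aa X \<xi>) - f))"
    if X: "finite X" "X \<noteq> {}" for X
  proof -
    \<comment> \<open>\<open>far\<close> covers all further averages \<open>a'\<close>, and these
      form a convex family; this is what makes the set of differences convex.\<close>
    define D where "D = (\<Union>a'\<in>A. \<Union>f\<in>convex hull X. {a' (aa X \<xi>) - f})"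
    have "convex D" unfolding convex_def
    proof (intro ballI allI impI)
      fix x y and s t :: real
      assume "x \<in> D" "y \<in> D" and st: "0 \<le> s" "0 \<le> t" "s + t = 1"
      then obtain a f b g where x: "a \<in> A" "f \<in> convex hull X" "x = a (aa X \<xi>) - f"
        and y: "b \<in> A" "g \<in> convex hull X" "y = b (aa X \<xi>) - g" unfolding D_def by blast
      have hull: "s *\<^sub>R f + t *\<^sub>R g \<in> convex hull X"
        using convex_convex_hull x y st unfolding convex_def by blast
      have t: "t = 1 - s" using st by simp
      have mem: "(\<lambda>x. s *\<^sub>R a x + t *\<^sub>R b x) \<in> A"
        using convex_averages.convex[OF x(1) y(1), of s] st unfolding t by simp
      have eq: "s *\<^sub>R x + t *\<^sub>R y = (\<lambda>x. s *\<^sub>R a x + t *\<^sub>R b x) (aa X \<xi>) - (s *\<^sub>R f + t *\<^sub>R g)"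
        by (simp add: x(3) y(3) scaleR_diff_right)
      show "s *\<^sub>R x + t *\<^sub>R y \<in> D"
        unfolding D_def eq by (rule UN_I, rule mem, rule UN_I, rule hull, rule singletonI)
    qed
    moreover have "D \<noteq> {}"
    proof -
      obtain x where "x \<in> X" using X by blast
      then have "aa X (aa X \<xi>) - x \<in> D" unfolding D_def using aa[OF X(1)] hull_inc[of x X convex] by blast
      then show ?thesis by blast
    qed
    moreover have "\<delta> \<le> norm d" if "d \<in> D" for d using that aa_far[OF X(1)] unfolding D_def by blast
    ultimately obtain \<psi> where \<psi>: "bounded_linear \<psi>" "\<And>x. \<bar>\<psi> x\<bar> \<le> norm x" "\<And>d. d \<in> D \<Longrightarrow> \<delta> \<le> \<psi> d"
      using separation_from_zero[of D \<delta>] \<open>\<delta> > 0\<close> by (metis less_imp_le)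
    have "\<forall>a'\<in>A. \<forall>f\<in>X. a' (aa X \<xi>) - f \<in> D" unfolding D_def using hull_inc[of _ X convex] by blast
    then show ?thesis using \<psi> by blast
  qed
  then have "\<forall>X. \<exists>\<psi>. finite X \<and> X \<noteq> {} \<longrightarrow>
      bounded_linear \<psi> \<and> (\<forall>x. \<bar>\<psi> x\<bar> \<le> norm x) \<and> (\<forall>a'\<in>A. \<forall>f\<in>X. \<delta> \<le> \<psi> (a' (aa X \<xi>) - f))"
    by blast
  then obtain \<Psi> where \<Psi>: "\<And>X. finite X \<Longrightarrow> X \<noteq> {} \<Longrightarrow>
      bounded_linear (\<Psi> X) \<and> (\<forall>x. \<bar>\<Psi> X x\<bar> \<le> norm x) \<and> (\<forall>a'\<in>A. \<forall>f\<in>X. \<delta> \<le> \<Psi> X (a' (aa X \<xi>) - f))"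
    by metis
  define R where "R a D p \<longleftrightarrow> finite D \<and> D \<subseteq> U \<and> (\<forall>u\<in>D. (0::real) \<le> p u) \<and> sum p D = 1 \<and>
      (\<forall>x. a x = (\<Sum>u\<in>D. p u *\<^sub>R u x))" for a D p
  have "\<forall>a\<in>A. \<exists>D p. R a D p" unfolding R_def by (intro ballI avg_rep)
  then obtain supp wt where "\<forall>a\<in>A. R a (supp a) (wt a)" by metis
  then have rep: "finite (supp a) \<and> supp a \<subseteq> U \<and> (\<forall>u\<in>supp a. (0::real) \<le> wt a u) \<and>
      sum (wt a) (supp a) = 1 \<and> (\<forall>x. a x = (\<Sum>u\<in>supp a. wt a u *\<^sub>R u x))" if "a \<in> A" for a
    using that unfolding R_def by simp
  \<comment> \<open>The factor \<open>n\<close> with both signs forces \<open>\<psi> n\<close> to be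
    of order \<open>1 / n\<close> on each collected vector; the point 0 makes
    \<open>\<psi> n\<close> at least \<delta> on the averages themselves.\<close>
  define cube where "cube n Y = insert 0 ((\<lambda>y. real n *\<^sub>R y) ` Y \<union> (\<lambda>y. - (real n *\<^sub>R y)) ` Y)" for n and Y :: "'e set"
  obtain u0 where u0: "u0 \<in> U" using ne by blast
  \<comment> \<open>\<open>Y\<close> collects the orbit points occurring in the composites formed so
    far, and \<open>C\<close> is the running composite, extended by an average that escapes the
    current cube.\<close>
  define st where "st = rec_nat ({}, u0)
    (\<lambda>n (Y, c). (Y \<union> (\<lambda>u. u \<xi>) ` supp c, \<lambda>x. aa (cube n Y) (c x)))"
  define Y where "Y n = fst (st n)" for n
  define C where "C n = snd (st n)" for n
  have Y_Suc: "Y (Suc n) = Y n \<union> (\<lambda>u. u \<xi>) ` supp (C n)"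
    and C_Suc: "C (Suc n) = (\<lambda>x. aa (cube n (Y n)) (C n x))" for n
    by (simp_all add: Y_def C_def st_def split: prod.split)
  have Y0: "Y 0 = {}" and C0: "C 0 = u0" by (simp_all add: Y_def C_def st_def)
  have CY: "C n \<in> A \<and> finite (Y n)" for n
  proof (induction n)
    case 0 then show ?case using u0 by (simp add: Y0 C0 convex_averages.base)
  next
    case (Suc n)
    then have "finite (cube n (Y n))" by (simp add: cube_def)
    then show ?case using Suc rep[of "C n"] avg_comp[OF aa] by (simp add: Y_Suc C_Suc)
  qed
  have Y_mono: "Y m \<subseteq> Y n" if "m \<le> n" for m n
    using that by (induction rule: dec_induct) (auto simp: Y_Suc)
  define \<psi> where "\<psi> n = \<Psi> (cube n (Y n))" for n
  have cube: "finite (cube n (Y n))" "cube n (Y n) \<noteq> {}" for n using CY by (auto simp: cube_def)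
  have bl: "bounded_linear (\<psi> n)" and \<psi>_le: "\<bar>\<psi> n x\<bar> \<le> norm x" for n x
    using \<Psi>[OF cube] by (auto simp: \<psi>_def)
  have \<psi>_far: "\<delta> \<le> \<psi> n (a' (aa (cube n (Y n)) \<xi>) - f)" if "a' \<in> A" "f \<in> cube n (Y n)" for n a' f
    using \<Psi>[OF cube] that by (auto simp: \<psi>_def)
  \<comment> \<open>By commutation the factor chosen at stage \<open>n\<close> can be applied first;
    the other factors form a further average, for which \<open>\<psi> n\<close> keeps its lower
    bound.\<close>
  have big: "\<delta> \<le> \<psi> n (C (Suc N) \<xi>)" if "n \<le> N" for n N
  proof -
    have "\<exists>a'\<in>A. C (Suc N) \<xi> = a' (aa (cube n (Y n)) \<xi>)"
      using that
    proof (induction N rule: dec_induct)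
      case base
      have "C (Suc n) \<xi> = C n (aa (cube n (Y n)) \<xi>)"
        using avg_comm[OF aa[OF cube(1)] _ \<xi>] CY by (simp add: C_Suc)
      then show ?case using CY by blast
    next
      case (step m)
      then obtain a' where a': "a' \<in> A" "C (Suc m) \<xi> = a' (aa (cube n (Y n)) \<xi>)" by blast
      have "C (Suc (Suc m)) \<xi> = aa (cube (Suc m) (Y (Suc m))) (a' (aa (cube n (Y n)) \<xi>))"
        using a'(2) by (simp add: C_Suc[of "Suc m"])
      then show ?case using avg_comp[OF aa[OF cube(1)[of "Suc m"]] a'(1)]
        by (intro bexI[of _ "\<lambda>x. aa (cube (Suc m) (Y (Suc m))) (a' x)"])
    qed
    then obtain a' where "a' \<in> A" "C (Suc N) \<xi> = a' (aa (cube n (Y n)) \<xi>)" by blast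
    then show ?thesis using \<psi>_far[of a' 0 n] by (simp add: cube_def)
  qed
  define r where "r = norm \<xi> + 1"
  have r: "r > 0" "norm \<xi> \<le> r" by (auto simp: r_def add_nonneg_pos)
  define B where "B n = {u. \<delta> / 2 \<le> \<psi> n (u \<xi>)}" for n
  let ?D = "\<lambda>N. supp (C (Suc N))" and ?p = "\<lambda>N. wt (C (Suc N))"
  have rep': "finite (?D N)" "?D N \<subseteq> U" "\<And>u. u \<in> ?D N \<Longrightarrow> 0 \<le> ?p N u" "sum (?p N) (?D N) = 1"
    "C (Suc N) x = (\<Sum>u\<in>?D N. ?p N u *\<^sub>R u x)" for N x
    using rep[of "C (Suc N)"] CY by blast+
  \<comment> \<open>A Markov estimate: values at most \<open>r\<close> with mean at least \<delta>
    exceed or equal \<delta> / 2 on a set of mass at least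
    \<open>\<delta> / (2 * r)\<close>.\<close>
  have charged: "\<delta> / (2 * r) \<le> sum (?p N) (?D N \<inter> B n)" if "n \<le> N" for n N
  proof -
    have "\<delta> \<le> (\<Sum>u\<in>?D N. ?p N u * \<psi> n (u \<xi>))"
    proof -
      interpret \<psi>: bounded_linear "\<psi> n" by (rule bl)
      have "\<psi> n (C (Suc N) \<xi>) = (\<Sum>u\<in>?D N. ?p N u * \<psi> n (u \<xi>))"
        by (subst rep'(5)) (simp only: \<psi>.sum \<psi>.scaleR real_scaleR_def)
      then show ?thesis using big[OF that] by simp
    qed
    also have "\<dots> \<le> (\<Sum>u\<in>?D N. ?p N u * (\<delta> / 2) + (if u \<in> B n then ?p N u * r else 0))"
    proof (rule sum_mono)
      fix u assume u: "u \<in> ?D N"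
      have "\<psi> n (u \<xi>) \<le> r" using \<psi>_le[of n "u \<xi>"] contr[of u \<xi>] subsetD[OF rep'(2) u] r by linarith
      then have "?p N u * \<psi> n (u \<xi>) \<le> ?p N u * r" using rep'(3)[OF u] by (intro mult_left_mono)
      moreover have "?p N u * \<psi> n (u \<xi>) \<le> ?p N u * (\<delta> / 2)" if "u \<notin> B n"
        using that rep'(3)[OF u] by (intro mult_left_mono) (auto simp: B_def)
      moreover have "?p N u * (\<delta> / 2) \<ge> 0" using rep'(3)[OF u] \<open>\<delta> > 0\<close> by simp
      ultimately show "?p N u * \<psi> n (u \<xi>) \<le> ?p N u * (\<delta> / 2) + (if u \<in> B n then ?p N u * r else 0)" by auto
    qed
    also have "\<dots> = \<delta> / 2 + sum (?p N) (?D N \<inter> B n) * r"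
    proof -
      have "(\<Sum>u\<in>?D N. if u \<in> B n then ?p N u * r else 0) = (\<Sum>u\<in>?D N \<inter> B n. ?p N u * r)"
        by (rule sum.inter_restrict[OF rep'(1), symmetric])
      moreover have "(\<Sum>u\<in>?D N. ?p N u * (\<delta> / 2)) = \<delta> / 2"
        by (simp only: sum_distrib_right[symmetric] rep'(4) mult_1)
      ultimately show ?thesis by (simp only: sum.distrib sum_distrib_right[symmetric])
    qed
    finally show ?thesis using r by (simp add: field_simps)
  qed
  obtain M where M: "\<And>j. \<exists>N. \<exists>u\<in>?D N. \<forall>n\<le>j. \<exists>l\<in>{n..M n}. u \<in> B l"
  proof (rule uniformly_charged_sets_meet[where D = ?D and p = ?p and B = B and \<epsilon> = "\<delta> / (2 * r)"])
    show "\<delta> / (2 * r) > 0" using r \<open>\<delta> > 0\<close> by simp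
    show "finite (?D N)" for N by (rule rep'(1))
    show "0 \<le> ?p N u" if "u \<in> ?D N" for N u using that by (rule rep'(3))
    show "sum (?p N) (?D N) = 1" for N by (rule rep'(4))
    show "\<delta> / (2 * r) \<le> sum (?p N) (?D N \<inter> B n)" if "n \<le> N" for n N using that by (rule charged)
  qed (rule that, assumption)
  define Z where "Z = (\<Union>n. Y n)"
  have inZ: "u \<xi> \<in> Z" if "u \<in> ?D N" for u N
    using that Y_Suc[of "Suc N"] unfolding Z_def by blast
  define H where "H n = (\<Union>l\<in>{n..M n}. {y. \<delta> / 2 \<le> \<psi> l y})" for n
  \<comment> \<open>The closed span of \<open>Z\<close> enters through the kernels containing
    \<open>Z\<close>, which are weakly closed and so can take part in the compactness
    argument.\<close>
  define W where "W = {{x. \<phi> x = 0} |\<phi> :: 'e \<Rightarrow> real. bounded_linear \<phi> \<and> (\<forall>x\<in>Z. \<phi> x = 0)}"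
  have "K \<inter> \<Inter> (range H \<union> W) \<noteq> {}"
  proof -
    have "closedin weak_topology (H n)" for n
      unfolding H_def by (rule closedin_Union) (auto simp only: finite_imageI finite_atLeastAtMost intro!: closedin_weak_ge[OF bl])
    moreover have "closedin weak_topology S" if "S \<in> W" for S
      using that closedin_weak_zero unfolding W_def by auto
    ultimately have "\<forall>S\<in>range H \<union> W. closedin weak_topology S" by auto
    moreover have "K \<inter> \<Inter>\<F> \<noteq> {}" if \<F>: "finite \<F>" "\<F> \<subseteq> range H \<union> W" for \<F>
    proof -
      have "finite (\<F> - W)" "\<F> - W \<subseteq> H ` UNIV" using \<F> by auto
      then obtain J where J: "finite J" "\<F> - W \<subseteq> H ` J" using finite_subset_image by (metis order_refl)
      obtain N u where u: "u \<in> ?D N" "\<forall>n\<le>Max (insert 0 J). \<exists>l\<in>{n..M n}. u \<in> B l" using M by blast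
      have "u \<xi> \<in> H n" if "n \<in> J" for n
      proof -
        have "n \<le> Max (insert 0 J)" using that J by simp
        then show ?thesis using u(2) unfolding H_def B_def by blast
      qed
      moreover have "u \<xi> \<in> S" if "S \<in> W" for S using that inZ[OF u(1)] unfolding W_def by blast
      ultimately have "u \<xi> \<in> \<Inter>\<F>" using J by blast
      moreover have "u \<xi> \<in> K" using K(2) u(1) rep'(2) by blast
      ultimately show ?thesis by blast
    qed
    ultimately show ?thesis using K(1) unfolding compactin_fip by blast
  qed
  then obtain y where y: "y \<in> \<Inter> (range H)" "y \<in> \<Inter> W" by blast
  have ycl: "y \<in> closure (span Z)"
    by (rule closure_span_separation) (use y(2) in \<open>auto simp: W_def\<close>)
  have null_Z: "(\<lambda>n. \<psi> n x) \<longlonglongrightarrow> 0" if x: "x \<in> span Z" for x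
    using x
  proof (induction rule: span_induct_alt)
    case base
    show ?case using linear_0[OF bounded_linear.linear[OF bl]] by simp
  next
    case (step c x z)
    from step(1) obtain m where m: "x \<in> Y m" unfolding Z_def by blast
    \<comment> \<open>The same vector \<open>?v\<close>, with \<open>\<psi> n ?v \<le> r\<close>, is
      separated from both \<open>n x\<close> and \<open>- n x\<close>.\<close>
    have bound: "\<bar>\<psi> n x\<bar> \<le> r * inverse (real n)" if n: "n \<ge> Suc m" for n
    proof -
      interpret \<psi>: bounded_linear "\<psi> n" by (rule bl)
      have "x \<in> Y n" using m Y_mono[of m n] n by auto
      then have c: "real n *\<^sub>R x \<in> cube n (Y n)" "- (real n *\<^sub>R x) \<in> cube n (Y n)" by (auto simp: cube_def)
      let ?v = "C n (aa (cube n (Y n)) \<xi>)"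
      have "norm ?v \<le> norm \<xi>" using avg_norm[of "C n"] avg_norm[OF aa[OF cube(1)]] CY order_trans by metis
      then have "\<psi> n ?v \<le> r" using \<psi>_le[of n ?v] r by linarith
      moreover have "\<delta> \<le> \<psi> n (?v - real n *\<^sub>R x)" "\<delta> \<le> \<psi> n (?v - - (real n *\<^sub>R x))"
        using \<psi>_far[of "C n"] CY c by blast+
      ultimately have "real n * \<bar>\<psi> n x\<bar> \<le> r"
        using \<open>\<delta> > 0\<close> n by (auto simp: \<psi>.diff \<psi>.add \<psi>.scaleR \<psi>.neg abs_if)
      then show ?thesis using n by (simp add: field_simps)
    qed
    have "(\<lambda>n. \<psi> n x) \<longlonglongrightarrow> 0"
    proof (rule Lim_null_comparison)
      show "\<forall>\<^sub>F n in sequentially. norm (\<psi> n x) \<le> r * inverse (real n)"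
        unfolding eventually_sequentially using bound by (intro exI[of _ "Suc m"]) simp
      show "(\<lambda>n. r * inverse (real n)) \<longlonglongrightarrow> 0" using tendsto_mult_left[OF lim_inverse_n, of r] by simp
    qed
    then have "(\<lambda>n. c *\<^sub>R \<psi> n x + \<psi> n z) \<longlonglongrightarrow> c *\<^sub>R 0 + 0" using step by (intro tendsto_intros)
    then show ?case
      using linear_add[OF bounded_linear.linear[OF bl]] linear_scale[OF bounded_linear.linear[OF bl]] by simp
  qed
  obtain z where z: "z \<in> span Z" "dist z y < \<delta> / 8"
    using ycl \<open>\<delta> > 0\<close> unfolding closure_approachable by (metis divide_pos_pos zero_less_numeral)
  have "\<forall>\<^sub>F n in sequentially. \<psi> n z < \<delta> / 8"
    by (rule order_tendstoD(2)[OF null_Z[OF z(1)]]) (use \<open>\<delta> > 0\<close> in simp)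
  then obtain n where n: "\<And>l. l \<ge> n \<Longrightarrow> \<psi> l z < \<delta> / 8" by (auto simp: eventually_sequentially)
  obtain l where l: "l \<ge> n" "\<delta> / 2 \<le> \<psi> l y" proof -
    have "y \<in> H n" using y(1) by blast
    then show ?thesis using that unfolding H_def by auto
  qed
  interpret \<psi>: bounded_linear "\<psi> l" by (rule bl)
  have "\<psi> l y = \<psi> l z + \<psi> l (y - z)" by (simp add: \<psi>.diff)
  also have "\<dots> < \<delta> / 8 + \<delta> / 8"
    using n[OF l(1)] \<psi>_le[of l "y - z"] z(2) by (simp add: dist_norm norm_minus_commute)
  finally show False using l(2) \<open>\<delta> > 0\<close> by simp
qed

theorem mean_ergodic:
  assumes \<xi>: "\<xi> \<in> V" and K: "compactin weak_topology K" "\<And>u. u \<in> U \<Longrightarrow> u \<xi> \<in> K"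
  shows "\<exists>\<eta>\<in>V. (\<forall>u\<in>U. u \<eta> = \<eta>) \<and> (\<forall>\<epsilon>>0. \<exists>a\<in>A. norm (a \<xi> - \<eta>) < \<epsilon>)"
proof (rule fixed_point_of_approximate[OF \<xi>])
  fix \<delta> :: real assume \<delta>: "\<delta> > 0"
  have "\<exists>X. finite X \<and> (\<forall>a\<in>A. \<exists>a'\<in>A. \<exists>f\<in>convex hull X. norm (a' (a \<xi>) - f) < \<delta>)"
  proof (rule ccontr)
    assume "\<not> ?thesis"
    then have "\<exists>a\<in>A. \<forall>a'\<in>A. \<forall>f\<in>convex hull X. \<delta> \<le> norm (a' (a \<xi>) - f)" if "finite X" for X
      using that by (meson not_le)
    then show False using escaping_averages_contradiction[where K = K and \<delta> = \<delta> and \<xi> = \<xi>] \<xi> K \<delta> by blast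
  qed
  then obtain X where X: "finite X" "\<And>a. a \<in> A \<Longrightarrow> \<exists>a'\<in>A. \<exists>f\<in>convex hull X. norm (a' (a \<xi>) - f) < \<delta>" by blast
  show "\<exists>f. (\<exists>a\<in>A. norm (a \<xi> - f) \<le> 2 * \<delta>) \<and> (\<forall>b\<in>A. norm (b f - f) \<le> 5 * \<delta>)"
    by (rule approximately_fixed[where \<xi> = \<xi> and \<delta> = \<delta> and X = X]) (fact \<xi> \<delta> X)+
qed

end

section \<open>Upper central series\<close>

text \<open>Centrality modulo the previous term is expressed by right cosets, so no quotient groups
  are formed and congruence is an equality of sets.\<close>

primrec upper_central :: "('g, 'm) monoid_scheme \<Rightarrow> nat \<Rightarrow> 'g set" where
  "upper_central G 0 = {\<one>\<^bsub>G\<^esub>}"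
| "upper_central G (Suc k) = {x \<in> carrier G. \<forall>y\<in>carrier G.
     upper_central G k #>\<^bsub>G\<^esub> (x \<otimes>\<^bsub>G\<^esub> y) = upper_central G k #>\<^bsub>G\<^esub> (y \<otimes>\<^bsub>G\<^esub> x)}"

definition uc_cong :: "('g, 'm) monoid_scheme \<Rightarrow> nat \<Rightarrow> 'g \<Rightarrow> 'g \<Rightarrow> bool" where
  "uc_cong G k a b \<longleftrightarrow> upper_central G k #>\<^bsub>G\<^esub> a = upper_central G k #>\<^bsub>G\<^esub> b"

lemma uc_cong_refl [simp]: "uc_cong G k a a" by (simp add: uc_cong_def)
lemma uc_cong_sym: "uc_cong G k a b \<Longrightarrow> uc_cong G k b a" by (simp add: uc_cong_def)
lemma uc_cong_trans: "uc_cong G k a b \<Longrightarrow> uc_cong G k b c \<Longrightarrow> uc_cong G k a c" by (simp add: uc_cong_def)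

context group begin

lemma normal_rcoset_mult:
  assumes "N \<lhd> G" "a \<in> carrier G" "a' \<in> carrier G" "b \<in> carrier G" "b' \<in> carrier G"
    and "N #> a = N #> a'" "N #> b = N #> b'"
  shows "N #> (a \<otimes> b) = N #> (a' \<otimes> b')"
  using assms normal.rcos_sum[OF assms(1)] by metis

lemma upper_central_normal: "upper_central G k \<lhd> G"
proof (induction k)
  case 0
  show ?case by (simp add: normal_inv_iff triv_subgroup)
next
  case (Suc k)
  let ?N = "upper_central G k"
  note mult = normal_rcoset_mult[OF Suc]
  have D: "x \<in> carrier G" "\<And>y. y \<in> carrier G \<Longrightarrow> ?N #> (x \<otimes> y) = ?N #> (y \<otimes> x)"
    if "x \<in> upper_central G (Suc k)" for x
    using that by auto
  have I: "x \<in> upper_central G (Suc k)" if "x \<in> carrier G" "\<And>y. y \<in> carrier G \<Longrightarrow> ?N #> (x \<otimes> y) = ?N #> (y \<otimes> x)"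
    for x
    using that by auto
  show ?case unfolding normal_inv_iff
  proof (intro conjI subgroup.intro ballI)
    show "upper_central G (Suc k) \<subseteq> carrier G" by auto
    show "\<one> \<in> upper_central G (Suc k)" by simp
  next
    fix x y assume x: "x \<in> upper_central G (Suc k)" and y: "y \<in> upper_central G (Suc k)"
    note c = D(1)[OF x] D(1)[OF y]
    show "x \<otimes> y \<in> upper_central G (Suc k)"
    proof (rule I)
      fix w assume w: "w \<in> carrier G"
      have "?N #> (x \<otimes> (y \<otimes> w)) = ?N #> (x \<otimes> (w \<otimes> y))"
        by (rule mult) (use D(2)[OF y w] c w in simp_all)
      also have "\<dots> = ?N #> ((x \<otimes> w) \<otimes> y)" using c w by (simp add: m_assoc)
      also have "\<dots> = ?N #> ((w \<otimes> x) \<otimes> y)" by (rule mult) (use D(2)[OF x w] c w in simp_all)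
      finally show "?N #> (x \<otimes> y \<otimes> w) = ?N #> (w \<otimes> (x \<otimes> y))" using c w by (simp add: m_assoc)
    qed (use c in simp)
  next
    fix x assume x: "x \<in> upper_central G (Suc k)"
    note c = D(1)[OF x]
    show "inv x \<in> upper_central G (Suc k)"
    proof (rule I)
      fix w assume w: "w \<in> carrier G"
      have "?N #> (x \<otimes> (inv x \<otimes> w \<otimes> inv x)) = ?N #> ((inv x \<otimes> w \<otimes> inv x) \<otimes> x)"
        using D(2)[OF x] c w by simp
      moreover have "x \<otimes> (inv x \<otimes> w \<otimes> inv x) = w \<otimes> inv x"
        using c w by (simp add: m_assoc[symmetric])
      moreover have "(inv x \<otimes> w \<otimes> inv x) \<otimes> x = inv x \<otimes> w"
        using c w by (simp add: m_assoc)
      ultimately show "?N #> (inv x \<otimes> w) = ?N #> (w \<otimes> inv x)" by simp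
    qed (use c in simp)
  next
    fix y x assume y: "y \<in> carrier G" and x: "x \<in> upper_central G (Suc k)"
    note c = D(1)[OF x]
    have "?N #> ((y \<otimes> x) \<otimes> inv y) = ?N #> ((x \<otimes> y) \<otimes> inv y)"
      by (rule mult) (use D(2)[OF x y] y c in simp_all)
    also have "(x \<otimes> y) \<otimes> inv y = x" using y c by (simp add: m_assoc)
    finally have e: "?N #> (y \<otimes> x \<otimes> inv y) = ?N #> x" .
    show "y \<otimes> x \<otimes> inv y \<in> upper_central G (Suc k)"
    proof (rule I)
      fix w assume w: "w \<in> carrier G"
      have "?N #> ((y \<otimes> x \<otimes> inv y) \<otimes> w) = ?N #> (x \<otimes> w)"
        by (rule mult) (use e c y w in simp_all)
      also have "\<dots> = ?N #> (w \<otimes> x)" by (rule D(2)[OF x w])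
      also have "\<dots> = ?N #> (w \<otimes> (y \<otimes> x \<otimes> inv y))" by (rule mult) (use e c y w in simp_all)
      finally show "?N #> ((y \<otimes> x \<otimes> inv y) \<otimes> w) = ?N #> (w \<otimes> (y \<otimes> x \<otimes> inv y))" .
    qed (use c y in simp)
  qed
qed

declare upper_central.simps(2) [simp del]

lemma upper_central_subgroup: "subgroup (upper_central G k) G"
  by (rule normal_imp_subgroup[OF upper_central_normal])

lemma upper_central_carrier: "x \<in> upper_central G k \<Longrightarrow> x \<in> carrier G"
  by (rule subgroup.mem_carrier[OF upper_central_subgroup])

lemma uc_cong_mult:
  "uc_cong G k a a' \<Longrightarrow> uc_cong G k b b' \<Longrightarrow> a \<in> carrier G \<Longrightarrow> a' \<in> carrier G \<Longrightarrow> b \<in> carrier G \<Longrightarrow>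
    b' \<in> carrier G \<Longrightarrow> uc_cong G k (a \<otimes> b) (a' \<otimes> b')"
  unfolding uc_cong_def by (rule normal_rcoset_mult[OF upper_central_normal])

lemma uc_cong_conj:
  "uc_cong G k a b \<Longrightarrow> a \<in> carrier G \<Longrightarrow> b \<in> carrier G \<Longrightarrow> g \<in> carrier G \<Longrightarrow>
    uc_cong G k (g \<otimes> a \<otimes> inv g) (g \<otimes> b \<otimes> inv g)"
  by (rule uc_cong_mult[OF uc_cong_mult]) simp_all

lemma uc_cong_iff:
  assumes "a \<in> carrier G" "b \<in> carrier G"
  shows "uc_cong G k a b \<longleftrightarrow> (\<exists>n\<in>upper_central G k. a = n \<otimes> b)"
proof
  assume "uc_cong G k a b"
  then have "a \<in> upper_central G k #> b"
    using rcos_self[OF assms(1) upper_central_subgroup, of k] by (simp add: uc_cong_def)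
  then show "\<exists>n\<in>upper_central G k. a = n \<otimes> b" by (auto simp: r_coset_def)
next
  assume "\<exists>n\<in>upper_central G k. a = n \<otimes> b"
  then have "a \<in> upper_central G k #> b" by (auto simp: r_coset_def)
  then show "uc_cong G k a b"
    using repr_independence[OF _ assms(2) upper_central_subgroup] by (simp add: uc_cong_def)
qed

lemma upper_central_mono: "upper_central G k \<subseteq> upper_central G (Suc k)"
proof
  fix x assume x: "x \<in> upper_central G k"
  have c: "x \<in> carrier G" using x by (rule upper_central_carrier)
  have 1: "uc_cong G k x \<one>" unfolding uc_cong_iff[OF c one_closed] using x c by (intro bexI[of _ x]) simp
  have "uc_cong G k (x \<otimes> y) (y \<otimes> x)" if y: "y \<in> carrier G" for y
  proof -
    have "uc_cong G k (x \<otimes> y) (\<one> \<otimes> y)" by (rule uc_cong_mult[OF 1]) (use y c in simp_all)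
    moreover have "uc_cong G k (y \<otimes> \<one>) (y \<otimes> x)"
      by (rule uc_cong_mult[OF _ uc_cong_sym[OF 1]]) (use y c in simp_all)
    ultimately show ?thesis using y uc_cong_trans[of G k "x \<otimes> y" y "y \<otimes> x"] by simp
  qed
  then show "x \<in> upper_central G (Suc k)" using c by (simp add: uc_cong_def upper_central.simps(2))
qed

lemma uc_cong_Suc: "uc_cong G k a b \<Longrightarrow> a \<in> carrier G \<Longrightarrow> b \<in> carrier G \<Longrightarrow> uc_cong G (Suc k) a b"
  using upper_central_mono[of k] by (auto simp: uc_cong_iff)

lemma uc_cong_0: "uc_cong G 0 a b \<Longrightarrow> a \<in> carrier G \<Longrightarrow> b \<in> carrier G \<Longrightarrow> a = b"
  by (auto simp: uc_cong_iff)

lemma upper_central_commutes: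
  "x \<in> upper_central G (Suc k) \<Longrightarrow> g \<in> carrier G \<Longrightarrow> uc_cong G k (x \<otimes> g) (g \<otimes> x)"
  by (simp add: uc_cong_def upper_central.simps(2))

text \<open>With \<open>a = n \<otimes> b\<close>, conjugation by \<open>b\<close> affects only
  \<open>n\<close>, which is central modulo the previous term. This gain of one level is what keeps
  prisms admissible.\<close>

lemma uc_cong_commutes:
  assumes "uc_cong G (Suc k) a b" "a \<in> carrier G" "b \<in> carrier G"
  shows "uc_cong G k (b \<otimes> a \<otimes> inv b) a"
proof -
  obtain n where n: "n \<in> upper_central G (Suc k)" "a = n \<otimes> b" using assms uc_cong_iff by blast
  have c: "n \<in> carrier G" using n(1) by (rule upper_central_carrier)
  have "uc_cong G k (b \<otimes> n) (n \<otimes> b)"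
    using upper_central_commutes[OF n(1) assms(3)] by (rule uc_cong_sym)
  then have "uc_cong G k ((b \<otimes> n) \<otimes> (b \<otimes> inv b)) ((n \<otimes> b) \<otimes> \<one>)"
    by (rule uc_cong_mult) (use assms c in simp_all)
  then show ?thesis using assms c n(2) by (simp add: m_assoc)
qed

lemma upper_central_conj:
  assumes "z \<in> upper_central G (Suc k)" "g \<in> carrier G"
  shows "uc_cong G k (g \<otimes> z \<otimes> inv g) z"
proof -
  have c: "z \<in> carrier G" using assms(1) by (rule upper_central_carrier)
  have "uc_cong G k ((g \<otimes> z) \<otimes> inv g) ((z \<otimes> g) \<otimes> inv g)"
    by (rule uc_cong_mult[OF uc_cong_sym[OF upper_central_commutes[OF assms]] uc_cong_refl])
      (use assms(2) c in simp_all)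
  moreover have "(z \<otimes> g) \<otimes> inv g = z" using assms(2) c by (simp add: m_assoc)
  ultimately show ?thesis by (simp only:)
qed

end

text \<open>Commutators with an element of the term \<open>k - Suc j\<close> lie in the term
  \<open>k - j\<close>, hence by induction in \<open>upper_central G j\<close>; this says that the
  element is central modulo that subgroup.\<close>

lemma lower_central_subset_upper_central:
  fixes G :: "'g monoid"
  assumes "group G" "lower_central G k = {\<one>\<^bsub>G\<^esub>}" "j \<le> k"
  shows "lower_central G (k - j) \<subseteq> upper_central G j"
  using assms(3)
proof (induction j)
  case 0
  show ?case using assms(2) by simp
next
  case (Suc j)
  interpret group G by fact
  obtain m where m: "k - j = Suc m" "k - Suc j = m" using Suc.prems by (metis Suc_diff_Suc Suc_le_eq)
  have sub: "lower_central G n \<subseteq> carrier G" for n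
  proof (induction n)
    case (Suc n)
    have "{x \<otimes>\<^bsub>G\<^esub> y \<otimes>\<^bsub>G\<^esub> inv\<^bsub>G\<^esub> x \<otimes>\<^bsub>G\<^esub> inv\<^bsub>G\<^esub> y | x y. x \<in> lower_central G n \<and> y \<in> carrier G} \<subseteq> carrier G"
      using Suc by auto
    then show ?case unfolding lower_central.simps by (rule generate_incl)
  qed simp
  have "x \<in> upper_central G (Suc j)" if x: "x \<in> lower_central G m" for x
  proof -
    have c: "x \<in> carrier G" using sub x by blast
    have "uc_cong G j (x \<otimes>\<^bsub>G\<^esub> y) (y \<otimes>\<^bsub>G\<^esub> x)" if y: "y \<in> carrier G" for y
    proof -
      have "x \<otimes>\<^bsub>G\<^esub> y \<otimes>\<^bsub>G\<^esub> inv\<^bsub>G\<^esub> x \<otimes>\<^bsub>G\<^esub> inv\<^bsub>G\<^esub> y \<in> lower_central G (Suc m)"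
        unfolding lower_central.simps using x y by (intro generate.incl) blast
      then have "x \<otimes>\<^bsub>G\<^esub> y \<otimes>\<^bsub>G\<^esub> inv\<^bsub>G\<^esub> x \<otimes>\<^bsub>G\<^esub> inv\<^bsub>G\<^esub> y \<in> upper_central G j"
        using Suc m by auto
      moreover have "x \<otimes>\<^bsub>G\<^esub> y = (x \<otimes>\<^bsub>G\<^esub> y \<otimes>\<^bsub>G\<^esub> inv\<^bsub>G\<^esub> x \<otimes>\<^bsub>G\<^esub> inv\<^bsub>G\<^esub> y) \<otimes>\<^bsub>G\<^esub> (y \<otimes>\<^bsub>G\<^esub> x)"
      proof -
        have "(x \<otimes>\<^bsub>G\<^esub> y \<otimes>\<^bsub>G\<^esub> inv\<^bsub>G\<^esub> x \<otimes>\<^bsub>G\<^esub> inv\<^bsub>G\<^esub> y) \<otimes>\<^bsub>G\<^esub> (y \<otimes>\<^bsub>G\<^esub> x)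
            = x \<otimes>\<^bsub>G\<^esub> y \<otimes>\<^bsub>G\<^esub> inv\<^bsub>G\<^esub> x \<otimes>\<^bsub>G\<^esub> ((inv\<^bsub>G\<^esub> y \<otimes>\<^bsub>G\<^esub> y) \<otimes>\<^bsub>G\<^esub> x)"
          using c y by (simp only: m_assoc m_closed inv_closed)
        also have "\<dots> = x \<otimes>\<^bsub>G\<^esub> y" using c y by (simp add: m_assoc)
        finally show ?thesis by simp
      qed
      ultimately show ?thesis using uc_cong_iff c y by blast
    qed
    then show ?thesis using c by (simp add: uc_cong_def upper_central.simps(2))
  qed
  then show ?case using m by blast
qed

section \<open>Alternating sums\<close>

definition asum :: "nat \<Rightarrow> (nat \<Rightarrow> 'e::real_vector) \<Rightarrow> 'e" where
  "asum n f = (\<Sum>j\<le>n. (-1) ^ j *\<^sub>R f j)"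

lemma asum_cong: "(\<And>j. j \<le> n \<Longrightarrow> f j = g j) \<Longrightarrow> asum n f = asum n g"
  unfolding asum_def by (intro sum.cong) auto

lemma asum_Suc_shift: "asum (Suc n) f = f 0 - asum n (\<lambda>j. f (Suc j))"
  unfolding asum_def by (subst sum.atMost_Suc_shift) (simp add: sum_negf)

lemma asum_diff: "asum n (\<lambda>j. f j - g j) = asum n f - asum n g"
  unfolding asum_def by (simp add: scaleR_diff_right sum_subtractf)

lemma asum_0 [simp]: "asum n (\<lambda>_. 0) = 0" unfolding asum_def by simp

lemma asum_linear: "linear h \<Longrightarrow> h (asum n f) = asum n (\<lambda>j. h (f j))"
  unfolding asum_def by (simp add: linear_sum linear_scale)

lemma asum_asum: "asum n (\<lambda>l. asum m (Y l)) = (\<Sum>(l, j)\<in>{..n} \<times> {..m}. (-1) ^ (l + j) *\<^sub>R Y l j)"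
  unfolding asum_def by (simp add: scaleR_sum_right sum.cartesian_product power_add)

lemma asum_swap: "asum n (\<lambda>l. asum m (\<lambda>j. Y l j)) = asum m (\<lambda>j. asum n (\<lambda>l. Y l j))"
  unfolding asum_def by (simp add: scaleR_sum_right) (subst sum.swap, simp add: mult.commute)

text \<open>Sending (l, m) with \<open>l \<le> m\<close> to (m + 1, l) matches equal terms of
  opposite sign.\<close>

lemma asum_simplicial_zero:
  assumes "\<And>l m. l \<le> m \<Longrightarrow> Y l m = Y (Suc m) l"
  shows "asum (Suc n) (\<lambda>l. asum n (Y l)) = 0"
proof -
  let ?f = "\<lambda>(l, m). (-1) ^ (l + m) *\<^sub>R Y l m"
  let ?S1 = "{(l, m). l \<le> m \<and> m \<le> n}" and ?S2 = "{(l, m). m < l \<and> l \<le> Suc n \<and> m \<le> n}"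
  have eq: "{..Suc n} \<times> {..n} = ?S1 \<union> ?S2" and disj: "?S1 \<inter> ?S2 = {}" by auto
  have fin: "finite ?S1" "finite ?S2"
    by (rule finite_subset[of _ "{..Suc n} \<times> {..n}"]; auto)+
  have "sum ?f ?S1 = (\<Sum>p\<in>?S2. - ?f p)"
    by (rule sum.reindex_bij_witness[of _ "\<lambda>(l, m). (m, l - 1)" "\<lambda>(l, m). (Suc m, l)"])
      (auto simp: assms add.commute)
  then have "sum ?f ?S1 + sum ?f ?S2 = 0" by (simp add: sum_negf)
  then show ?thesis unfolding asum_asum eq using sum.union_disjoint[OF fin disj, of ?f] by simp
qed

text \<open>The combinatorics of the prism operator: \<open>A a l\<close> is the \<open>l\<close>-th
  face of the \<open>a\<close>-th simplex of the prism. The faces \<open>a\<close> and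
  \<open>a + 1\<close> telescope from the end \<open>M 0\<close> to the end
  \<open>M (Suc q)\<close>; the remaining faces are prisms \<open>B\<close> over faces of the
  base.\<close>

lemma asum_prism:
  assumes lt: "\<And>a l. l < a \<Longrightarrow> a \<le> q \<Longrightarrow> A a l = B (a - 1) l"
    and eq: "\<And>a. a \<le> q \<Longrightarrow> A a a = M a" "\<And>a. a \<le> q \<Longrightarrow> A a (Suc a) = M (Suc a)"
    and gt: "\<And>a l. Suc a < l \<Longrightarrow> A a l = B a (l - 1)"
  shows "asum q (\<lambda>a. asum (Suc q) (A a)) =
    M 0 - M (Suc q) - (\<Sum>a<q. \<Sum>l\<le>q. (-1) ^ (a + l) *\<^sub>R B a l)"
proof -
  let ?f = "\<lambda>(a, l). (-1) ^ (a + l) *\<^sub>R A a l" and ?g = "\<lambda>(a, l). (-1) ^ (a + l) *\<^sub>R B a l"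
  let ?L = "{(a, l). l < a \<and> a \<le> q}" and ?D = "{(a, l). (l = a \<or> l = Suc a) \<and> a \<le> q}"
    and ?R = "{(a, l). Suc a < l \<and> l \<le> Suc q}"
  let ?L' = "{(a, l). l \<le> a \<and> a < q}" and ?R' = "{(a, l). a < l \<and> l \<le> q}"
  have S: "{..q} \<times> {..Suc q} = (?L \<union> ?R) \<union> ?D" by auto
  have fin: "finite ?L" "finite ?R" "finite ?D"
    by (rule finite_subset[of _ "{..q} \<times> {..Suc q}"]; auto)+
  have S': "{..<q} \<times> {..q} = ?L' \<union> ?R'" by auto
  have fin': "finite ?L'" "finite ?R'"
    by (rule finite_subset[of _ "{..q} \<times> {..Suc q}"]; auto)+
  have sgn: "- ((- 1) ^ (a + b - Suc 0) *\<^sub>R x) = (- 1 :: real) ^ (a + b) *\<^sub>R x" if "b < a" for a b and x :: 'a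
    using that by (cases a) auto
  have sgn': "- ((- 1) ^ (a + b - Suc 0) *\<^sub>R x) = (- 1 :: real) ^ (a + b) *\<^sub>R x" if "Suc a < b" for a b and x :: 'a
    using that by (cases b) auto
  have L: "sum ?f ?L = (\<Sum>p\<in>?L'. - ?g p)"
    by (rule sum.reindex_bij_witness[of _ "\<lambda>(a, l). (Suc a, l)" "\<lambda>(a, l). (a - 1, l)"])
      (auto simp: lt sgn)
  have R: "sum ?f ?R = (\<Sum>p\<in>?R'. - ?g p)"
    by (rule sum.reindex_bij_witness[of _ "\<lambda>(a, l). (a, Suc l)" "\<lambda>(a, l). (a, l - 1)"])
      (auto simp: gt sgn')
  have D: "sum ?f ?D = M 0 - M (Suc q)"
  proof -
    have "?D = (\<Union>a\<in>{..q}. {(a, a), (a, Suc a)})" by auto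
    then have "sum ?f ?D = (\<Sum>a\<le>q. sum ?f {(a, a), (a, Suc a)})"
      by (simp only:) (rule sum.UNION_disjoint, auto)
    also have "\<dots> = (\<Sum>a\<le>q. M a - M (Suc a))"
      by (intro sum.cong refl) (simp add: eq power_add[symmetric])
    also have "\<dots> = M 0 - M (Suc q)" by (rule sum_telescope)
    finally show ?thesis .
  qed
  have "sum ?f (?L \<union> ?R) = sum ?f ?L + sum ?f ?R" by (rule sum.union_disjoint) (use fin in auto)
  moreover have "sum ?f ((?L \<union> ?R) \<union> ?D) = sum ?f (?L \<union> ?R) + sum ?f ?D"
    by (rule sum.union_disjoint) (use fin in auto)
  ultimately have "asum q (\<lambda>a. asum (Suc q) (A a)) = sum ?f ?L + sum ?f ?R + sum ?f ?D"
    unfolding asum_asum S by (simp only:)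
  also have "\<dots> = M 0 - M (Suc q) - (sum ?g ?L' + sum ?g ?R')"
    unfolding L R D by (simp add: sum_negf)
  also have "sum ?g ?L' + sum ?g ?R' = sum ?g ({..<q} \<times> {..q})"
    unfolding S' by (rule sum.union_disjoint[symmetric]) (use fin' in auto)
  finally show ?thesis by (simp add: sum.cartesian_product)
qed

section \<open>Isometric modules\<close>

definition uc_fixed :: "'g monoid \<Rightarrow> ('g \<Rightarrow> 'e \<Rightarrow> 'e) \<Rightarrow> nat \<Rightarrow> 'e set" where
  "uc_fixed G \<rho> i = {\<xi>. \<forall>n\<in>upper_central G i. \<rho> n \<xi> = \<xi>}"

locale isometric_module = group G for G :: "'g monoid" (structure) +
  fixes T :: "'g topology" and \<rho> :: "'g \<Rightarrow> 'e::banach \<Rightarrow> 'e"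
  assumes tg: "topological_group G T" and im: "isometric_banach_module G T \<rho>"
begin

abbreviation tuples :: "nat \<Rightarrow> (nat \<Rightarrow> 'g) set" where
  "tuples n \<equiv> topspace (power_top T n)"

abbreviation Fix :: "nat \<Rightarrow> 'e set" where
  "Fix \<equiv> uc_fixed G \<rho>"

lemma topspace_T: "topspace T = carrier G"
  using tg by (simp add: topological_group_def)

lemma rho_linear: "g \<in> carrier G \<Longrightarrow> linear (\<rho> g)"
  and rho_norm: "g \<in> carrier G \<Longrightarrow> norm (\<rho> g \<xi>) = norm \<xi>"
  and rho_one: "\<rho> \<one> \<xi> = \<xi>"
  and rho_mult: "g \<in> carrier G \<Longrightarrow> h \<in> carrier G \<Longrightarrow> \<rho> (g \<otimes> h) \<xi> = \<rho> g (\<rho> h \<xi>)"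
  and rho_continuous: "continuous_map (prod_topology T euclidean) euclidean (\<lambda>(g, \<xi>). \<rho> g \<xi>)"
  using im unfolding isometric_banach_module_def by blast+

lemma rho_bounded_linear: "g \<in> carrier G \<Longrightarrow> bounded_linear (\<rho> g)"
  by (rule bounded_linear_intro[where K = 1]) (auto simp: rho_linear linear_add linear_scale rho_norm)

lemma continuous_map_mult:
  assumes "continuous_map X T f" "continuous_map X T g"
  shows "continuous_map X T (\<lambda>x. f x \<otimes> g x)"
proof -
  have "continuous_map (prod_topology T T) T (\<lambda>(x, y). x \<otimes> y)"
    using tg by (simp add: topological_group_def)
  moreover have "continuous_map X (prod_topology T T) (\<lambda>x. (f x, g x))"
    using assms by (simp add: continuous_map_pairedI)
  ultimately have "continuous_map X T ((\<lambda>(x, y). x \<otimes> y) \<circ> (\<lambda>x. (f x, g x)))" by (rule continuous_map_compose[rotated])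
  then show ?thesis by (simp add: comp_def)
qed

lemma continuous_map_m_inv:
  assumes "continuous_map X T f"
  shows "continuous_map X T (\<lambda>x. inv (f x))"
proof -
  have "continuous_map T T (m_inv G)" using tg by (simp add: topological_group_def)
  then show ?thesis using continuous_map_compose[OF assms] by (simp add: comp_def)
qed

lemma continuous_map_action:
  assumes "continuous_map X T f" "continuous_map X euclidean F"
  shows "continuous_map X euclidean (\<lambda>x. \<rho> (f x) (F x))"
proof -
  have "continuous_map X (prod_topology T euclidean) (\<lambda>x. (f x, F x))"
    using assms by (simp add: continuous_map_pairedI)
  from continuous_map_compose[OF this rho_continuous] show ?thesis by (simp add: comp_def)
qed

lemma uc_fixed_subspace: "subspace (Fix i)"
proof -
  have lin: "linear (\<rho> n)" if "n \<in> upper_central G i" for n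
    using that by (intro rho_linear upper_central_carrier)
  show ?thesis unfolding uc_fixed_def subspace_def
    by (auto simp: linear_0[OF lin] linear_add[OF lin] linear_scale[OF lin])
qed

lemma uc_fixed_closed: "closed (Fix i)"
proof -
  have "closed {\<xi>. \<rho> n \<xi> = \<xi>}" if "n \<in> upper_central G i" for n
  proof (rule closed_Collect_eq)
    show "continuous_on UNIV (\<rho> n)"
      by (rule linear_continuous_on[OF rho_bounded_linear[OF upper_central_carrier[OF that]]])
  qed (rule continuous_on_id)
  then have "closed (\<Inter>n\<in>upper_central G i. {\<xi>. \<rho> n \<xi> = \<xi>})" by (intro closed_INT ballI)
  moreover have "(\<Inter>n\<in>upper_central G i. {\<xi>. \<rho> n \<xi> = \<xi>}) = Fix i" by (auto simp: uc_fixed_def)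
  ultimately show ?thesis by simp
qed

lemma uc_fixed_invariant:
  assumes "g \<in> carrier G" "\<xi> \<in> Fix i"
  shows "\<rho> g \<xi> \<in> Fix i"
proof -
  have "\<rho> n (\<rho> g \<xi>) = \<rho> g \<xi>" if n: "n \<in> upper_central G i" for n
  proof -
    have nc: "n \<in> carrier G" using n by (rule upper_central_carrier)
    have m: "inv g \<otimes> n \<otimes> g \<in> upper_central G i"
      using normal.inv_op_closed1[OF upper_central_normal assms(1) n] .
    have "n \<otimes> g = g \<otimes> (inv g \<otimes> n \<otimes> g)" using assms(1) nc by (simp add: m_assoc[symmetric])
    then have "\<rho> n (\<rho> g \<xi>) = \<rho> g (\<rho> (inv g \<otimes> n \<otimes> g) \<xi>)"
      using rho_mult[OF nc assms(1), of \<xi>] rho_mult[of g "inv g \<otimes> n \<otimes> g" \<xi>] assms(1) nc by simp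
    then show ?thesis using m assms(2) by (simp add: uc_fixed_def)
  qed
  then show ?thesis by (simp add: uc_fixed_def)
qed

lemma uc_fixed_cong:
  assumes "uc_cong G i a b" "a \<in> carrier G" "b \<in> carrier G" "\<xi> \<in> Fix i"
  shows "\<rho> a \<xi> = \<rho> b \<xi>"
proof -
  obtain n where n: "n \<in> upper_central G i" "a = n \<otimes> b" using assms uc_cong_iff by blast
  then show ?thesis using rho_mult[OF upper_central_carrier[OF n(1)] assms(3)] uc_fixed_invariant[OF assms(3,4)]
    by (simp add: uc_fixed_def)
qed

lemma uc_fixed_commute:
  assumes "z \<in> upper_central G (Suc i)" "g \<in> carrier G" "\<xi> \<in> Fix i"
  shows "\<rho> z (\<rho> g \<xi>) = \<rho> g (\<rho> z \<xi>)"
proof -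
  have zc: "z \<in> carrier G" using assms(1) by (rule upper_central_carrier)
  have "\<rho> (z \<otimes> g) \<xi> = \<rho> (g \<otimes> z) \<xi>"
    by (rule uc_fixed_cong[OF upper_central_commutes[OF assms(1,2)]]) (use zc assms in auto)
  then show ?thesis using rho_mult zc assms by simp
qed

end

section \<open>Configurations of conjugates of a hypercentral element\<close>

text \<open>All three indices run over all naturals, so one type serves every degree and every
  number of columns; \<open>agree\<close> states which entries matter.\<close>

type_synonym 'g config = "nat \<Rightarrow> nat \<Rightarrow> nat \<Rightarrow> 'g"

abbreviation cube_top :: "'g topology \<Rightarrow> 'g config topology" where
  "cube_top T \<equiv> product_topology (\<lambda>_. product_topology (\<lambda>_. product_topology (\<lambda>_. T) UNIV) UNIV) UNIV"

definition face :: "nat \<Rightarrow> (nat \<Rightarrow> 'r) \<Rightarrow> nat \<Rightarrow> 'r" where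
  "face l P = (\<lambda>k. P (if k < l then k else Suc k))"

definition delete_column :: "nat \<Rightarrow> nat \<Rightarrow> 'g config \<Rightarrow> 'g config" where
  "delete_column t a P = (\<lambda>l k b. if k = Suc t then P l k (if b < a then b else Suc b) else P l k b)"

lemma face_face: "l \<le> m \<Longrightarrow> face m (face l P) = face l (face (Suc m) P)"
  by (auto simp: face_def fun_eq_iff)

lemma delete_column_delete_column:
  "a \<le> b \<Longrightarrow> delete_column t b (delete_column t a P) = delete_column t a (delete_column t (Suc b) P)"
  by (auto simp: delete_column_def fun_eq_iff)

lemma face_delete_column: "face l (delete_column t a P) = delete_column t a (face l P)"
  by (auto simp: delete_column_def face_def fun_eq_iff)

text \<open>The name refers to the outcome \<open>theta_power_coboundary\<close>: up to
  coboundaries, \<open>z\<close> acts unipotently on cocycles of positive degree with values in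
  \<open>V\<close>.\<close>

locale unipotence = isometric_module G T \<rho> for G :: "'g monoid" (structure) and T :: "'g topology"
    and \<rho> :: "'g \<Rightarrow> 'e::banach \<Rightarrow> 'e" +
  fixes i :: nat and z :: 'g
  assumes z: "z \<in> upper_central G (Suc i)"
begin

abbreviation "V \<equiv> Fix i"

lemma z_closed [simp]: "z \<in> carrier G"
  using z by (rule upper_central_carrier)

definition "\<theta> = (\<lambda>\<xi>. \<rho> z \<xi> - \<xi>)"

text \<open>A configuration \<open>P\<close> has a vertex \<open>x\<^sub>l = P l 0 0\<close> of the homogeneous bar resolution and auxiliary
  points \<open>P l (Suc t) a\<close> (column \<open>a\<close> of level \<open>t < i\<close>). A point of level \<open>t\<close> is a conjugate of \<open>z\<close> that
  matters only modulo the \<open>t\<close>-th centre: along a column it may vary by elements of that group, and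
  modulo the next centre all columns of a level agree with the zeroth column one level up.
  The topmost of these columns is \<open>x\<^sub>l z x\<^sub>l\<^sup>-\<^sup>1\<close>.\<close>
definition col :: "(nat \<Rightarrow> nat \<Rightarrow> 'g) \<Rightarrow> nat \<Rightarrow> 'g" where
  "col r t = (if t < i then r (Suc t) 0 else r 0 0 \<otimes> z \<otimes> inv (r 0 0))"

text \<open>Levels below \<open>t\<^sub>0\<close> are unconstrained and ignored by cochains. At
  \<open>t\<^sub>0 = i\<close> only the vertices matter, which is the homogeneous bar complex; at
  \<open>t\<^sub>0 = 0\<close> a point of level 0 is given exactly, as the zeroth centre is
  trivial.\<close>

definition conf :: "nat \<Rightarrow> 'g config set" where
  "conf t\<^sub>0 = {P. (\<forall>l k a. P l k a \<in> carrier G) \<and>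
     (\<forall>l l' t a. t\<^sub>0 \<le> t \<and> t < i \<longrightarrow> uc_cong G t (P l (Suc t) a) (P l' (Suc t) a)) \<and>
     (\<forall>l t a. t\<^sub>0 \<le> t \<and> t < i \<longrightarrow> uc_cong G (Suc t) (P l (Suc t) a) (col (P l) (Suc t)))}"

abbreviation conf_top :: "nat \<Rightarrow> 'g config topology" where
  "conf_top t \<equiv> subtopology (cube_top T) (conf t)"

lemma confI:
  assumes "\<And>l k a. P l k a \<in> carrier G"
    and "\<And>l l' t a. t\<^sub>0 \<le> t \<Longrightarrow> t < i \<Longrightarrow> uc_cong G t (P l (Suc t) a) (P l' (Suc t) a)"
    and "\<And>l t a. t\<^sub>0 \<le> t \<Longrightarrow> t < i \<Longrightarrow> uc_cong G (Suc t) (P l (Suc t) a) (col (P l) (Suc t))"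
  shows "P \<in> conf t\<^sub>0"
  using assms by (simp add: conf_def)

lemma conf_carrier: "P \<in> conf t \<Longrightarrow> P l k a \<in> carrier G"
  and conf_row: "P \<in> conf t\<^sub>0 \<Longrightarrow> t\<^sub>0 \<le> t \<Longrightarrow> t < i \<Longrightarrow> uc_cong G t (P l (Suc t) a) (P l' (Suc t) a)"
  and conf_col: "P \<in> conf t\<^sub>0 \<Longrightarrow> t\<^sub>0 \<le> t \<Longrightarrow> t < i \<Longrightarrow> uc_cong G (Suc t) (P l (Suc t) a) (col (P l) (Suc t))"
  by (auto simp: conf_def)

lemma conf_antimono: "P \<in> conf t \<Longrightarrow> t \<le> t' \<Longrightarrow> P \<in> conf t'"
  by (rule confI) (auto simp: conf_carrier conf_row conf_col)

text \<open>Auxiliary points are conjugated because they stand for conjugates such as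
  \<open>x z x\<^sup>-\<^sup>1\<close>, whose vertex \<open>x\<close> is translated.\<close>

definition act :: "'g \<Rightarrow> (nat \<Rightarrow> nat \<Rightarrow> 'g) \<Rightarrow> nat \<Rightarrow> nat \<Rightarrow> 'g" where
  "act g r = (\<lambda>k a. if k = 0 then g \<otimes> r 0 a else g \<otimes> r k a \<otimes> inv g)"

definition translate :: "'g \<Rightarrow> 'g config \<Rightarrow> 'g config" where
  "translate g P = (\<lambda>l. act g (P l))"

lemma act_closed: "g \<in> carrier G \<Longrightarrow> (\<And>k a. r k a \<in> carrier G) \<Longrightarrow> act g r k a \<in> carrier G"
  by (simp add: act_def)

lemma act_act:
  assumes "g \<in> carrier G" "h \<in> carrier G" "\<And>k a. r k a \<in> carrier G"
  shows "act g (act h r) = act (g \<otimes> h) r"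
  using assms by (auto simp: act_def fun_eq_iff m_assoc inv_mult_group)

lemma col_closed: "(\<And>k a. r k a \<in> carrier G) \<Longrightarrow> col r t \<in> carrier G"
  by (simp add: col_def)

lemma col_act:
  assumes "g \<in> carrier G" "\<And>k a. r k a \<in> carrier G"
  shows "col (act g r) t = g \<otimes> col r t \<otimes> inv g"
  using assms by (simp add: col_def act_def m_assoc inv_mult_group)

lemma translate_conf:
  assumes P: "P \<in> conf t" and g: "g \<in> carrier G"
  shows "translate g P \<in> conf t"
proof (rule confI)
  note c = conf_carrier[OF P]
  show "translate g P l k a \<in> carrier G" for l k a
    using c g by (simp add: translate_def act_closed)
  show "uc_cong G s (translate g P l (Suc s) a) (translate g P l' (Suc s) a)" if "t \<le> s" "s < i" for l l' s a
    using uc_cong_conj[OF conf_row[OF P that] c c g] by (simp add: translate_def act_def)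
  show "uc_cong G (Suc s) (translate g P l (Suc s) a) (col (translate g P l) (Suc s))" if "t \<le> s" "s < i" for l s a
    using uc_cong_conj[OF conf_col[OF P that] c col_closed g] c g
    by (simp add: translate_def col_act) (simp add: act_def)
qed

text \<open>Degree and column counts exist only as a dependence condition: rows up to
  \<open>q\<close>, and columns up to \<open>s t\<close> at each level \<open>t\<close>.\<close>

definition agree :: "nat \<Rightarrow> (nat \<Rightarrow> nat) \<Rightarrow> nat \<Rightarrow> 'g config \<Rightarrow> 'g config \<Rightarrow> bool" where
  "agree t\<^sub>0 s q P P' \<longleftrightarrow>
     (\<forall>l\<le>q. P l 0 0 = P' l 0 0 \<and> (\<forall>t a. t\<^sub>0 \<le> t \<and> t < i \<and> a \<le> s t \<longrightarrow> P l (Suc t) a = P' l (Suc t) a))"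

lemma agree_col: "agree t\<^sub>0 s q P P' \<Longrightarrow> l \<le> q \<Longrightarrow> t\<^sub>0 \<le> t \<Longrightarrow> col (P l) t = col (P' l) t"
  by (simp add: agree_def col_def)

definition cochain :: "nat \<Rightarrow> (nat \<Rightarrow> nat) \<Rightarrow> nat \<Rightarrow> ('g config \<Rightarrow> 'e) set" where
  "cochain t s q = {F. continuous_map (conf_top t) euclidean F \<and>
     (\<forall>P\<in>conf t. F P \<in> V) \<and>
     (\<forall>P\<in>conf t. \<forall>g\<in>carrier G. F (translate g P) = \<rho> g (F P)) \<and>
     (\<forall>P\<in>conf t. \<forall>P'\<in>conf t. agree t s q P P' \<longrightarrow> F P = F P')}"

lemma cochain_continuous: "F \<in> cochain t s q \<Longrightarrow> continuous_map (conf_top t) euclidean F"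
  and cochain_V: "F \<in> cochain t s q \<Longrightarrow> P \<in> conf t \<Longrightarrow> F P \<in> V"
  and cochain_equivariant: "F \<in> cochain t s q \<Longrightarrow> P \<in> conf t \<Longrightarrow> g \<in> carrier G \<Longrightarrow> F (translate g P) = \<rho> g (F P)"
  and cochain_agree: "F \<in> cochain t s q \<Longrightarrow> P \<in> conf t \<Longrightarrow> P' \<in> conf t \<Longrightarrow> agree t s q P P' \<Longrightarrow> F P = F P'"
  by (auto simp: cochain_def)

lemma topspace_conf: "topspace (conf_top t) = conf t"
  by (auto simp: topspace_T conf_def PiE_def Pi_def)

lemma continuous_map_conf:
  assumes "\<And>l k a. continuous_map X T (\<lambda>x. \<phi> x l k a)" "\<And>x. x \<in> topspace X \<Longrightarrow> \<phi> x \<in> conf t"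
  shows "continuous_map X (conf_top t) \<phi>"
  using assms by (auto simp: continuous_map_in_subtopology continuous_map_componentwise_UNIV)

lemma continuous_map_entry: "continuous_map (conf_top t) T (\<lambda>P. P l k a)"
proof -
  have 1: "continuous_map (cube_top T) (product_topology (\<lambda>_. product_topology (\<lambda>_. T) UNIV) UNIV) (\<lambda>P. P l)"
    by (rule continuous_map_product_projection) simp
  have 2: "continuous_map (product_topology (\<lambda>_. product_topology (\<lambda>_. T) UNIV) UNIV) (product_topology (\<lambda>_. T) UNIV) (\<lambda>P. P k)"
    by (rule continuous_map_product_projection) simp
  have 3: "continuous_map (product_topology (\<lambda>_. T) UNIV) T (\<lambda>P. P a)"
    by (rule continuous_map_product_projection) simp
  have "continuous_map (cube_top T) T ((\<lambda>P. P a) \<circ> ((\<lambda>P. P k) \<circ> (\<lambda>P. P l)))"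
    by (rule continuous_map_compose[OF continuous_map_compose[OF 1 2] 3])
  then show ?thesis by (simp add: comp_def continuous_map_from_subtopology)
qed

lemma continuous_map_col: "continuous_map (conf_top t) T (\<lambda>P. col (P l) t')"
  unfolding col_def
  by (cases "t' < i")
    (auto intro!: continuous_map_mult continuous_map_m_inv continuous_map_entry simp: topspace_T)

text \<open>Faces, prisms and all changes of columns are instances; \<open>dep\<close> accounts for
  the shift in degree and column counts.\<close>

lemma cochain_pullback:
  assumes F: "F \<in> cochain t s q"
    and cont: "\<And>l k a. continuous_map (conf_top t') T (\<lambda>P. \<phi> P l k a)"
    and maps: "\<And>P. P \<in> conf t' \<Longrightarrow> \<phi> P \<in> conf t"
    and equi: "\<And>P g. P \<in> conf t' \<Longrightarrow> g \<in> carrier G \<Longrightarrow> \<phi> (translate g P) = translate g (\<phi> P)"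
    and dep: "\<And>P P'. P \<in> conf t' \<Longrightarrow> P' \<in> conf t' \<Longrightarrow> agree t' s' q' P P' \<Longrightarrow> agree t s q (\<phi> P) (\<phi> P')"
  shows "(\<lambda>P. F (\<phi> P)) \<in> cochain t' s' q'"
proof -
  have "continuous_map (conf_top t') (conf_top t) \<phi>"
    by (rule continuous_map_conf) (use cont maps topspace_conf in auto)
  from continuous_map_compose[OF this cochain_continuous[OF F]]
  have "continuous_map (conf_top t') euclidean (\<lambda>P. F (\<phi> P))" by (simp add: comp_def)
  then show ?thesis unfolding cochain_def
    using cochain_V[OF F] cochain_equivariant[OF F] cochain_agree[OF F] maps equi dep by simp
qed

lemma cochain_asum:
  assumes "\<And>j. j \<le> n \<Longrightarrow> F j \<in> cochain t s q"
  shows "(\<lambda>P. asum n (\<lambda>j. F j P)) \<in> cochain t s q"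
proof -
  have "continuous_map (conf_top t) euclidean (\<lambda>P. asum n (\<lambda>j. F j P))"
    unfolding asum_def
  proof (rule continuous_map_sum)
    fix j assume "j \<in> {..n}"
    then have "continuous_map (conf_top t) euclidean (F j)"
      by (intro cochain_continuous[OF assms]) simp
    moreover have "continuous_map euclidean euclidean (\<lambda>\<xi>::'e. (- 1 :: real) ^ j *\<^sub>R \<xi>)"
      by (simp add: continuous_on_scaleR)
    ultimately show "continuous_map (conf_top t) euclidean (\<lambda>P. (- 1) ^ j *\<^sub>R F j P)"
      using continuous_map_compose[of _ euclidean "F j" euclidean] by (simp add: comp_def)
  qed simp
  moreover have "asum n (\<lambda>j. F j P) \<in> V" if "P \<in> conf t" for P
    unfolding asum_def
    by (intro subspace_sum subspace_scale uc_fixed_subspace cochain_V[OF assms that]) simp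
  moreover have "asum n (\<lambda>j. F j (translate g P)) = \<rho> g (asum n (\<lambda>j. F j P))" if "P \<in> conf t" "g \<in> carrier G" for P g
    unfolding asum_linear[OF rho_linear[OF that(2)]]
    by (rule asum_cong) (use cochain_equivariant[OF assms that] in auto)
  moreover have "asum n (\<lambda>j. F j P) = asum n (\<lambda>j. F j P')" if "P \<in> conf t" "P' \<in> conf t" "agree t s q P P'" for P P'
    by (rule asum_cong) (rule cochain_agree[OF assms that])
  ultimately show ?thesis unfolding cochain_def by simp
qed

lemma cochain_diff:
  assumes "F \<in> cochain t s q" "H \<in> cochain t s q"
  shows "(\<lambda>P. F P - H P) \<in> cochain t s q"
  using cochain_asum[of 1 "\<lambda>j. if j = 0 then F else H"] assms by (simp add: asum_def)

lemma linear_theta_pow: "linear (\<theta> ^^ m)"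
proof (induction m)
  case (Suc m)
  have "linear \<theta>" unfolding \<theta>_def by (intro linear_compose_sub rho_linear z_closed linear_ident)
  from linear_compose[OF Suc this] show ?case by (simp add: comp_def)
qed (simp add: linear_iff)

lemma cochain_theta_pow: "F \<in> cochain t s q \<Longrightarrow> (\<lambda>P. (\<theta> ^^ m) (F P)) \<in> cochain t s q"
proof (induction m)
  case (Suc m)
  let ?F = "\<lambda>P. (\<theta> ^^ m) (F P)"
  have F: "?F \<in> cochain t s q" by (rule Suc.IH[OF Suc.prems])
  have "continuous_map (conf_top t) T (\<lambda>P. z)" by (simp add: topspace_T)
  from continuous_map_action[OF this cochain_continuous[OF F]]
  have "(\<lambda>P. \<rho> z (?F P)) \<in> cochain t s q"
    unfolding cochain_def
    using cochain_V[OF F] cochain_equivariant[OF F] cochain_agree[OF F]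
      uc_fixed_invariant[OF z_closed] uc_fixed_commute[OF z] by auto
  from cochain_diff[OF this F] show ?case by (simp add: \<theta>_def)
qed simp

end

section \<open>The differentials and the prism homotopy\<close>

context unipotence begin

definition d :: "nat \<Rightarrow> ('g config \<Rightarrow> 'e) \<Rightarrow> 'g config \<Rightarrow> 'e" where
  "d q F P = asum (Suc q) (\<lambda>l. F (face l P))"

definition column_d :: "nat \<Rightarrow> nat \<Rightarrow> ('g config \<Rightarrow> 'e) \<Rightarrow> 'g config \<Rightarrow> 'e" where
  "column_d t n F P = asum (Suc n) (\<lambda>a. F (delete_column t a P))"

lemma face_conf: "P \<in> conf t \<Longrightarrow> face l P \<in> conf t"
  by (rule confI) (auto simp: face_def conf_carrier conf_row conf_col)

lemma delete_column_conf:
  assumes "P \<in> conf t" shows "delete_column t a P \<in> conf t"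
proof (rule confI)
  show "delete_column t a P l k b \<in> carrier G" for l k b
    using conf_carrier[OF assms] by (simp add: delete_column_def)
  show "uc_cong G s (delete_column t a P l (Suc s) b) (delete_column t a P l' (Suc s) b)" if "t \<le> s" "s < i" for l l' s b
    using conf_row[OF assms that] by (auto simp: delete_column_def)
  show "uc_cong G (Suc s) (delete_column t a P l (Suc s) b) (col (delete_column t a P l) (Suc s))"
    if "t \<le> s" "s < i" for l s b
  proof -
    \<comment> \<open>The constraints at levels \<open>s \<ge> t\<close> refer to \<open>col\<close>
      at \<open>Suc s\<close>, strictly above the level being altered.\<close>
    have "col (delete_column t a P l) (Suc s) = col (P l) (Suc s)"
      using that by (simp add: col_def delete_column_def)
    then show ?thesis using conf_col[OF assms that] by (auto simp: delete_column_def)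
  qed
qed

lemma face_cochain: "F \<in> cochain t s q \<Longrightarrow> (\<lambda>P. F (face l P)) \<in> cochain t s (Suc q)"
proof (rule cochain_pullback)
  show "continuous_map (conf_top t) T (\<lambda>P. face l P k b a)" for k b a
    unfolding face_def by (rule continuous_map_entry)
  show "face l (translate g P) = translate g (face l P)" for g P
    by (simp add: face_def translate_def)
  show "agree t s q (face l P) (face l P')" if "agree t s (Suc q) P P'" for P P'
    using that by (simp add: agree_def face_def)
qed (auto intro: face_conf)

lemma d_cochain: "F \<in> cochain t s q \<Longrightarrow> d q F \<in> cochain t s (Suc q)"
  unfolding d_def[abs_def] by (intro cochain_asum face_cochain)

lemma delete_column_cochain:
  assumes "F \<in> cochain t (s(t := n)) q"
  shows "(\<lambda>P. F (delete_column t a P)) \<in> cochain t (s(t := Suc n)) q"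
proof (rule cochain_pullback[OF assms])
  show "continuous_map (conf_top t) T (\<lambda>P. delete_column t a P l k b)" for l k b
    by (cases "k = Suc t") (auto simp: delete_column_def intro: continuous_map_entry)
  show "delete_column t a (translate g P) = translate g (delete_column t a P)" for P g
    by (auto simp: delete_column_def translate_def act_def fun_eq_iff)
  show "agree t (s(t := n)) q (delete_column t a P) (delete_column t a P')"
    if "agree t (s(t := Suc n)) q P P'" for P P'
    using that unfolding agree_def delete_column_def by auto
qed (rule delete_column_conf)

lemma column_d_cochain: "F \<in> cochain t (s(t := n)) q \<Longrightarrow> column_d t n F \<in> cochain t (s(t := Suc n)) q"
  unfolding column_d_def[abs_def] by (intro cochain_asum delete_column_cochain)

lemma d_d: "d (Suc q) (d q F) P = 0"
  unfolding d_def by (rule asum_simplicial_zero) (simp add: face_face)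

lemma column_d_column_d: "column_d t (Suc n) (column_d t n F) P = 0"
  unfolding column_d_def by (rule asum_simplicial_zero) (simp add: delete_column_delete_column)

lemma d_column_d: "d q (column_d t n F) P = column_d t n (d q F) P"
  unfolding d_def column_d_def by (subst asum_swap) (simp add: face_delete_column)

lemma d_theta_pow: "d q (\<lambda>P. (\<theta> ^^ m) (F P)) P = (\<theta> ^^ m) (d q F P)"
  unfolding d_def asum_linear[OF linear_theta_pow] ..

lemma column_d_theta_pow: "column_d t n (\<lambda>P. (\<theta> ^^ m) (F P)) P = (\<theta> ^^ m) (column_d t n F P)"
  unfolding column_d_def asum_linear[OF linear_theta_pow] ..

lemma d_diff: "d q (\<lambda>P. F P - H P) P = d q F P - d q H P"
  unfolding d_def asum_diff ..

lemma column_d_diff: "column_d t n (\<lambda>P. F P - H P) P = column_d t n F P - column_d t n H P"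
  unfolding column_d_def asum_diff ..

lemma d_cong: "(\<And>P. P \<in> conf t \<Longrightarrow> F P = H P) \<Longrightarrow> P \<in> conf t \<Longrightarrow> d q F P = d q H P"
  unfolding d_def by (intro asum_cong) (simp add: face_conf)

lemma column_d_cong: "(\<And>P. P \<in> conf t \<Longrightarrow> F P = H P) \<Longrightarrow> P \<in> conf t \<Longrightarrow> column_d t n F P = column_d t n H P"
  unfolding column_d_def by (intro asum_cong) (simp add: delete_column_conf)

text \<open>The complex has \<theta>-torsion cohomology at this level. In degree zero there are no
  coboundaries, so a closed cochain itself must be killed. The exponent may depend on the
  cochain.\<close>

definition acyclic_level :: "nat \<Rightarrow> bool" where
  "acyclic_level t \<longleftrightarrow> (\<forall>s q. \<forall>F\<in>cochain t s q. (\<forall>P\<in>conf t. d q F P = 0) \<longrightarrow>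
     (\<exists>m. case q of 0 \<Rightarrow> \<forall>P\<in>conf t. (\<theta> ^^ m) (F P) = 0
        | Suc q' \<Rightarrow> \<exists>B\<in>cochain t s q'. \<forall>P\<in>conf t. (\<theta> ^^ m) (F P) = d q' B P))"

text \<open>At level \<open>0\<close> the zeroth column is a single conjugate \<open>w\<close> of \<open>z\<close> modulo the \<open>i\<close>-th centre. The prism between a
  simplex and its translate by \<open>w\<close> is a simplex of configurations because \<open>w\<close> commutes with
  every auxiliary point up to its ambiguity, and \<open>w\<close> acts on coefficients as \<open>z\<close>.\<close>

definition prism :: "nat \<Rightarrow> 'g config \<Rightarrow> 'g config" where
  "prism a P = (\<lambda>k. if k \<le> a then P k else act (col (P 0) 0) (P (k - 1)))"

text \<open>Congruence modulo the trivial group is equality; if there are no levels,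
  \<open>z\<close> is central and equals all its conjugates.\<close>

lemma col_0_row:
  assumes "P \<in> conf 0" shows "col (P l) 0 = col (P l') 0"
proof (cases "i = 0")
  case True
  have "col (P l) 0 = z" for l
    unfolding col_def using uc_cong_0[OF upper_central_conj[of z 0 "P l 0 0"]] z conf_carrier[OF assms] True
    by simp
  then show ?thesis by simp
next
  case False
  then show ?thesis using uc_cong_0[OF conf_row[OF assms, of 0 l 0 l']] conf_carrier[OF assms] by (simp add: col_def)
qed

lemma col_chain:
  assumes "P \<in> conf 0" "t \<le> i" shows "uc_cong G t (col (P l) t) (col (P l) 0)"
  using assms(2)
proof (induction t)
  case (Suc t)
  note c = col_closed[of "P l", OF conf_carrier[OF assms(1)]]
  have "uc_cong G (Suc t) (col (P l) t) (col (P l) (Suc t))"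
    using conf_col[OF assms(1), of t l 0] Suc.prems by (simp add: col_def[of _ t])
  moreover have "uc_cong G (Suc t) (col (P l) t) (col (P l) 0)"
    using Suc by (intro uc_cong_Suc c) auto
  ultimately show ?case by (rule uc_cong_trans[OF uc_cong_sym])
qed simp

lemma col_0_point:
  assumes "P \<in> conf 0" "t < i" shows "uc_cong G (Suc t) (P l (Suc t) a) (col (P l) 0)"
  by (rule uc_cong_trans[OF conf_col[OF assms(1) _ assms(2)] col_chain[OF assms(1)]]) (use assms(2) in auto)

lemma col_0_z:
  assumes "P \<in> conf 0" shows "uc_cong G i (col (P l) 0) z"
proof -
  have "uc_cong G i (col (P l) i) z"
    using upper_central_conj[OF z conf_carrier[OF assms]] by (simp add: col_def)
  then show ?thesis by (rule uc_cong_trans[OF uc_cong_sym[OF col_chain[OF assms order_refl]]])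
qed

text \<open>A point of level \<open>s\<close> is congruent to \<open>?w\<close> modulo the centre of
  index \<open>Suc s\<close>, so by \<open>uc_cong_commutes\<close> conjugation by \<open>?w\<close>
  moves it only within the ambiguity allowed along a column. Original and translated rows can
  therefore be mixed.\<close>

lemma prism_conf:
  assumes P: "P \<in> conf 0" shows "prism a P \<in> conf 0"
proof -
  note c = conf_carrier[OF P]
  let ?w = "col (P 0) 0"
  have w: "?w \<in> carrier G" using c by (rule col_closed)
  have Q: "translate ?w P \<in> conf 0" by (rule translate_conf[OF P w])
  have near: "uc_cong G s (translate ?w P l (Suc s) b) (P l (Suc s) b)" if "s < i" for l s b
    using uc_cong_commutes[OF col_0_point[OF P that, of l b] c] col_0_row[OF P, of l 0] w
    by (simp add: translate_def act_def)
  have rows: "\<exists>m. prism a P l = P m \<or> prism a P l = translate ?w P m" for l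
    unfolding prism_def translate_def by auto
  have cong: "uc_cong G s (R l (Suc s) b) (P 0 (Suc s) b)" if "s < i" "R \<in> {P, translate ?w P}" for R l s b
    using that(2) conf_row[OF P _ that(1), of l b 0] uc_cong_trans[OF near[OF that(1)] conf_row[OF P _ that(1)], of l b 0]
    by auto
  show ?thesis
  proof (rule confI)
    show "prism a P l k b \<in> carrier G" for l k b
      using c w by (simp add: prism_def act_closed)
    show "uc_cong G s (prism a P l (Suc s) b) (prism a P l' (Suc s) b)" if "s < i" for l l' s b
    proof -
      have "uc_cong G s (prism a P l (Suc s) b) (P 0 (Suc s) b)" for l
        using rows[of l] cong[OF that] by auto
      from uc_cong_trans[OF this uc_cong_sym[OF this]] show ?thesis .
    qed
    show "uc_cong G (Suc s) (prism a P l (Suc s) b) (col (prism a P l) (Suc s))" if "s < i" for l s b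
      using rows[of l] conf_col[OF P _ that] conf_col[OF Q _ that] by auto
  qed
qed

lemma prism_cochain:
  assumes "F \<in> cochain 0 s (Suc q)" "a \<le> q"
  shows "(\<lambda>P. F (prism a P)) \<in> cochain 0 s q"
proof (rule cochain_pullback[OF assms(1)])
  show "continuous_map (conf_top 0) T (\<lambda>P. prism a P l k b)" for l k b
    unfolding prism_def act_def
    by (cases "l \<le> a"; cases "k = 0")
      (auto intro!: continuous_map_mult continuous_map_m_inv continuous_map_entry continuous_map_col)
  show "prism a (translate g P) = translate g (prism a P)" if P: "P \<in> conf 0" and g: "g \<in> carrier G" for P g
  proof -
    note c = conf_carrier[OF P]
    let ?w = "col (P 0) 0"
    have w: "?w \<in> carrier G" using c by (rule col_closed)
    \<comment> \<open>Translation by \<open>g\<close> replaces \<open>w\<close> by its conjugate,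
      and \<open>(g w g\<^sup>-\<^sup>1) g = g w\<close>.\<close>
    have "act (col (act g (P 0)) 0) (act g (P k)) = act g (act ?w (P k))" for k
      using w g c by (simp add: col_act act_act m_assoc)
    then show ?thesis by (auto simp: prism_def translate_def fun_eq_iff)
  qed
  show "agree 0 s (Suc q) (prism a P) (prism a P')" if "agree 0 s q P P'" for P P'
  proof -
    have "col (P 0) 0 = col (P' 0) 0" using agree_col[OF that, of 0 0] by simp
    then show ?thesis using that assms(2) unfolding agree_def prism_def act_def by auto
  qed
qed (rule prism_conf)

lemma acyclic_level_0: "acyclic_level 0"
  unfolding acyclic_level_def
proof (intro allI ballI impI)
  fix s q F
  assume F: "F \<in> cochain 0 s q" and closed: "\<forall>P\<in>conf 0. d q F P = 0"
  have key: "\<theta> (F P) = (\<Sum>a<q. \<Sum>l\<le>q. (-1) ^ (a + l) *\<^sub>R F (prism a (face l P)))" if P: "P \<in> conf 0" for P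
  proof -
    note c = conf_carrier[OF P]
    let ?w = "col (P 0) 0"
    have w: "?w \<in> carrier G" using c by (rule col_closed)
    \<comment> \<open>\<open>M 0\<close> belongs to the full translate; in \<open>M (Suc q)\<close>
      only rows beyond \<open>q\<close> are translated, which a cochain of degree \<open>q\<close>
      does not see.\<close>
    define M where "M a = F (\<lambda>k. if k < a then P k else act ?w (P k))" for a
    \<comment> \<open>Deleting row zero makes row one the reference row of the prism; the
      translating element has to stay the same.\<close>
    have w1: "col (P (Suc 0)) 0 = ?w" by (rule col_0_row[OF P])
    have "asum q (\<lambda>a. asum (Suc q) (\<lambda>l. F (face l (prism a P)))) =
        M 0 - M (Suc q) - (\<Sum>a<q. \<Sum>l\<le>q. (-1) ^ (a + l) *\<^sub>R F (prism a (face l P)))"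
    proof (rule asum_prism)
      show "F (face l (prism a P)) = F (prism (a - 1) (face l P))" if "l < a" for a l
        using that by (intro arg_cong[where f = F]) (auto simp: face_def prism_def w1 fun_eq_iff)
      show "F (face a (prism a P)) = M a" for a
        unfolding M_def by (intro arg_cong[where f = F]) (auto simp: face_def prism_def fun_eq_iff)
      show "F (face (Suc a) (prism a P)) = M (Suc a)" for a
        unfolding M_def by (intro arg_cong[where f = F]) (auto simp: face_def prism_def fun_eq_iff)
      show "F (face l (prism a P)) = F (prism a (face (l - 1) P))" if "Suc a < l" for a l
        using that by (intro arg_cong[where f = F])
          (auto simp: face_def prism_def w1 fun_eq_iff)
    qed
    moreover have "asum q (\<lambda>a. asum (Suc q) (\<lambda>l. F (face l (prism a P)))) = 0"
      using closed prism_conf[OF P] by (simp add: d_def)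
    moreover have "M 0 = \<rho> z (F P)"
    proof -
      have "M 0 = F (translate ?w P)" by (simp add: M_def translate_def)
      also have "\<dots> = \<rho> ?w (F P)" by (rule cochain_equivariant[OF F P w])
      also have "\<dots> = \<rho> z (F P)"
        by (rule uc_fixed_cong[OF col_0_z[OF P] w z_closed cochain_V[OF F P]])
      finally show ?thesis .
    qed
    moreover have "M (Suc q) = F P"
      unfolding M_def
    proof (rule cochain_agree[OF F])
      have "(\<lambda>k. if k < Suc q then P k else act ?w (P k)) = face (Suc q) (prism q P)"
        by (auto simp: face_def prism_def fun_eq_iff)
      then show "(\<lambda>k. if k < Suc q then P k else act ?w (P k)) \<in> conf 0"
        using face_conf prism_conf[OF P] by simp
    qed (use P in \<open>auto simp: agree_def\<close>)
    ultimately show ?thesis by (simp add: \<theta>_def)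
  qed
  show "\<exists>m. case q of 0 \<Rightarrow> \<forall>P\<in>conf 0. (\<theta> ^^ m) (F P) = 0
        | Suc q' \<Rightarrow> \<exists>B\<in>cochain 0 s q'. \<forall>P\<in>conf 0. (\<theta> ^^ m) (F P) = d q' B P"
  proof (cases q)
    case 0
    then show ?thesis using key by (intro exI[of _ 1]) simp
  next
    case (Suc q')
    define B where "B P = asum q' (\<lambda>a. F (prism a P))" for P
    have "B \<in> cochain 0 s q'"
      unfolding B_def[abs_def] using F Suc by (intro cochain_asum prism_cochain) auto
    moreover have "\<theta> (F P) = d q' B P" if "P \<in> conf 0" for P
    proof -
      have "d q' B P = asum q' (\<lambda>a. asum (Suc q') (\<lambda>l. F (prism a (face l P))))"
        unfolding d_def B_def by (rule asum_swap)
      also have "\<dots> = (\<Sum>a<q. \<Sum>l\<le>q. (-1) ^ (a + l) *\<^sub>R F (prism a (face l P)))"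
        by (simp only: asum_asum Suc sum.cartesian_product lessThan_Suc_atMost)
      finally show ?thesis using key[OF that] by simp
    qed
    ultimately show ?thesis using Suc by (intro exI[of _ 1]) auto
  qed
qed

end

section \<open>Descent along the levels\<close>

context unipotence begin

text \<open>The point is read in row zero for every row, so the new column is constant and its row
  condition is an equality.\<close>

definition insert_column :: "nat \<Rightarrow> 'g config \<Rightarrow> 'g config" where
  "insert_column t P = (\<lambda>l k b. if k = Suc t then (case b of 0 \<Rightarrow> col (P 0) (Suc t) | Suc b' \<Rightarrow> P l k b') else P l k b)"

definition fill_columns :: "nat \<Rightarrow> 'g config \<Rightarrow> 'g config" where
  "fill_columns t P = (\<lambda>l k b. if k = Suc t then col (P 0) (Suc t) else P l k b)"

lemma delete_insert_0: "delete_column t 0 (insert_column t P) = P"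
  by (auto simp: delete_column_def insert_column_def fun_eq_iff)

lemma delete_insert_Suc:
  "delete_column t (Suc a) (insert_column t P) = insert_column t (delete_column t a P)"
  by (auto simp: delete_column_def insert_column_def col_def fun_eq_iff split: nat.split)

text \<open>Below the top this is the row condition one level up; at the top, all conjugates of
  \<open>z\<close> agree modulo the \<open>i\<close>-th centre.\<close>

lemma col_0_cong:
  assumes P: "P \<in> conf (Suc t)" and "t < i"
  shows "uc_cong G (Suc t) (col (P 0) (Suc t)) (col (P l) (Suc t))"
proof (cases "Suc t < i")
  case True
  then show ?thesis using conf_row[OF P, of "Suc t" 0 0 l] by (simp add: col_def)
next
  case False
  then have i: "Suc t = i" using \<open>t < i\<close> by simp
  have "uc_cong G (Suc t) (col (P l) (Suc t)) z" for l
    using upper_central_conj[OF z conf_carrier[OF P]] by (simp add: col_def i)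
  from uc_cong_trans[OF this uc_cong_sym[OF this]] show ?thesis .
qed

text \<open>\<open>P\<close> may violate the conditions of level \<open>t\<close> itself. They hold
  for \<open>Q\<close> because each of its columns there is the constant new one or is copied from a
  \<open>P\<close> that satisfies them.\<close>

lemma column_point_conf:
  assumes P: "P \<in> conf (Suc t)" and "t < i"
    and eq: "\<And>l k b. k \<noteq> Suc t \<Longrightarrow> Q l k b = P l k b"
    and new: "\<And>b. (\<forall>l. Q l (Suc t) b = col (P 0) (Suc t)) \<or> (\<exists>b'. P \<in> conf t \<and> (\<forall>l. Q l (Suc t) b = P l (Suc t) b'))"
  shows "Q \<in> conf t"
proof (rule confI)
  note c = conf_carrier[OF P]
  have colQ: "col (Q l) s = col (P l) s" if "s \<noteq> t" for l s
    using that eq by (simp add: col_def)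
  have cc: "col (P l) s \<in> carrier G" for l s using c by (rule col_closed)
  show "Q l k b \<in> carrier G" for l k b
    using new[of b] eq[of k l b] c cc by (cases "k = Suc t") auto
  show "uc_cong G s (Q l (Suc s) b) (Q l' (Suc s) b)" if s: "t \<le> s" "s < i" for l l' s b
  proof (cases "s = t")
    case True
    then show ?thesis using new[of b] conf_row[of P t t l _ l'] \<open>t < i\<close> by auto
  next
    case False
    then show ?thesis using conf_row[OF P _ s(2)] s eq by simp
  qed
  show "uc_cong G (Suc s) (Q l (Suc s) b) (col (Q l) (Suc s))" if s: "t \<le> s" "s < i" for l s b
  proof (cases "s = t")
    case True
    then show ?thesis using new[of b] conf_col[of P t t l] \<open>t < i\<close> col_0_cong[OF P \<open>t < i\<close>] colQ by auto
  next
    case False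
    then show ?thesis using conf_col[OF P _ s(2)] s eq colQ by simp
  qed
qed

lemma insert_column_conf:
  assumes P: "P \<in> conf t" and "t < i" shows "insert_column t P \<in> conf t"
proof (rule column_point_conf[OF conf_antimono[OF P] \<open>t < i\<close>])
  show "(\<forall>l. insert_column t P l (Suc t) b = col (P 0) (Suc t)) \<or>
      (\<exists>b'. P \<in> conf t \<and> (\<forall>l. insert_column t P l (Suc t) b = P l (Suc t) b'))" for b
    using P by (cases b) (auto simp: insert_column_def)
qed (simp_all add: insert_column_def)

lemma fill_columns_conf:
  assumes P: "P \<in> conf (Suc t)" and "t < i" shows "fill_columns t P \<in> conf t"
  by (rule column_point_conf[OF P \<open>t < i\<close>]) (simp_all add: fill_columns_def)

lemma col_translate:
  assumes "P \<in> conf t" "g \<in> carrier G"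
  shows "col (translate g P l) s = g \<otimes> col (P l) s \<otimes> inv g"
  unfolding translate_def by (rule col_act[OF assms(2) conf_carrier[OF assms(1)]])

lemma insert_column_cochain:
  assumes F: "F \<in> cochain t (s(t := Suc n)) q" and "t < i"
  shows "(\<lambda>P. F (insert_column t P)) \<in> cochain t (s(t := n)) q"
proof (rule cochain_pullback[OF F])
  show "continuous_map (conf_top t) T (\<lambda>P. insert_column t P l k b)" for l k b
    by (cases "k = Suc t"; cases b) (auto simp: insert_column_def intro: continuous_map_entry continuous_map_col)
  show "insert_column t (translate g P) = translate g (insert_column t P)" if "P \<in> conf t" "g \<in> carrier G" for P g
  proof -
    have "insert_column t (translate g P) l k b = translate g (insert_column t P) l k b" for l k b
      using col_translate[OF that]
      by (cases "k = Suc t"; cases b) (auto simp: insert_column_def translate_def act_def)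
    then show ?thesis by (simp add: fun_eq_iff)
  qed
  show "agree t (s(t := Suc n)) q (insert_column t P) (insert_column t P')" if a: "agree t (s(t := n)) q P P'" for P P'
  proof -
    have "col (P 0) (Suc t) = col (P' 0) (Suc t)" by (rule agree_col[OF a]) auto
    then show ?thesis using a unfolding agree_def insert_column_def by (auto split: nat.split)
  qed
qed (rule insert_column_conf[OF _ \<open>t < i\<close>])

lemma fill_columns_cochain:
  assumes F: "F \<in> cochain t (s(t := 0)) q" and "t < i"
  shows "(\<lambda>P. F (fill_columns t P)) \<in> cochain (Suc t) s q"
proof (rule cochain_pullback[OF F])
  show "continuous_map (conf_top (Suc t)) T (\<lambda>P. fill_columns t P l k b)" for l k b
    by (cases "k = Suc t") (auto simp: fill_columns_def intro: continuous_map_entry continuous_map_col)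
  show "fill_columns t (translate g P) = translate g (fill_columns t P)" if "P \<in> conf (Suc t)" "g \<in> carrier G" for P g
  proof -
    have "fill_columns t (translate g P) l k b = translate g (fill_columns t P) l k b" for l k b
      using col_translate[OF that] by (auto simp: fill_columns_def translate_def act_def)
    then show ?thesis by (simp add: fun_eq_iff)
  qed
  show "agree t (s(t := 0)) q (fill_columns t P) (fill_columns t P')" if a: "agree (Suc t) s q P P'" for P P'
  proof -
    have "col (P 0) (Suc t) = col (P' 0) (Suc t)" by (rule agree_col[OF a]) auto
    then show ?thesis using a unfolding agree_def fill_columns_def by auto
  qed
qed (rule fill_columns_conf[OF _ \<open>t < i\<close>])

text \<open>An extra degeneracy: deleting the inserted column gives back \<open>P\<close>, and
  deleting any later column commutes with the insertion.\<close>

lemma column_contraction: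
  assumes "\<And>P. P \<in> conf t \<Longrightarrow> column_d t (Suc n) F P = 0" "P \<in> conf t" "t < i"
  shows "column_d t n (\<lambda>P. F (insert_column t P)) P = F P"
proof -
  have "0 = asum (Suc (Suc n)) (\<lambda>a. F (delete_column t a (insert_column t P)))"
    using assms(1)[OF insert_column_conf[OF assms(2,3)]] by (simp add: column_d_def)
  also have "\<dots> = F P - asum (Suc n) (\<lambda>a. F (insert_column t (delete_column t a P)))"
    unfolding asum_Suc_shift[of "Suc n"] delete_insert_0 delete_insert_Suc ..
  finally show ?thesis by (simp add: column_d_def)
qed

lemma cochain_antimono_level:
  assumes F: "F \<in> cochain (Suc t) s q" shows "F \<in> cochain t (s(t := 0)) q"
proof -
  have "(\<lambda>P. F P) \<in> cochain t (s(t := 0)) q"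
    by (rule cochain_pullback[OF F])
      (auto intro: continuous_map_entry conf_antimono simp: agree_def)
  then show ?thesis .
qed

text \<open>The double complex argument for the columns of level \<open>t\<close>: a cochain closed in both directions is,
  up to a power of \<open>\<theta>\<close>, the coboundary of a cochain closed in the column direction. The column
  direction is exact by \<open>column_contraction\<close>.\<close>
lemma descent:
  assumes acyc: "acyclic_level t" and t: "t < i"
  shows "F \<in> cochain t (s(t := n)) q \<Longrightarrow> (\<And>P. P \<in> conf t \<Longrightarrow> d q F P = 0) \<Longrightarrow>
    (\<And>P. P \<in> conf t \<Longrightarrow> column_d t n F P = 0) \<Longrightarrow>
    \<exists>m. case q of 0 \<Rightarrow> \<forall>P\<in>conf t. (\<theta> ^^ m) (F P) = 0
      | Suc q' \<Rightarrow> \<exists>B\<in>cochain t (s(t := n)) q'. \<forall>P\<in>conf t. column_d t n B P = 0 \<and> (\<theta> ^^ m) (F P) = d q' B P"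
proof (induction q arbitrary: F n)
  case 0
  from acyc[unfolded acyclic_level_def, rule_format, OF 0(1)] 0(2) show ?case by auto
next
  case (Suc q')
  obtain m B\<^sub>0 where B\<^sub>0: "B\<^sub>0 \<in> cochain t (s(t := n)) q'" "\<And>P. P \<in> conf t \<Longrightarrow> (\<theta> ^^ m) (F P) = d q' B\<^sub>0 P"
    using acyc[unfolded acyclic_level_def, rule_format, OF Suc.prems(1)] Suc.prems(2) by auto
  \<comment> \<open>The failure of the primitive to be closed in the column direction. It has one
    degree less and one column more, hence the induction is over all \<open>n\<close>.\<close>
  let ?D = "column_d t n B\<^sub>0"
  have D: "?D \<in> cochain t (s(t := Suc n)) q'" by (rule column_d_cochain[OF B\<^sub>0(1)])
  have dD: "d q' ?D P = 0" if P: "P \<in> conf t" for P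
  proof -
    have "d q' ?D P = column_d t n (d q' B\<^sub>0) P" by (rule d_column_d)
    also have "\<dots> = column_d t n (\<lambda>P. (\<theta> ^^ m) (F P)) P" by (rule column_d_cong[OF _ P]) (simp add: B\<^sub>0)
    also have "\<dots> = 0" using Suc.prems(3)[OF P] linear_0[OF linear_theta_pow] by (simp add: column_d_theta_pow)
    finally show ?thesis .
  qed
  obtain m' where IH: "case q' of 0 \<Rightarrow> \<forall>P\<in>conf t. (\<theta> ^^ m') (?D P) = 0
      | Suc q'' \<Rightarrow> \<exists>B\<in>cochain t (s(t := Suc n)) q''. \<forall>P\<in>conf t. column_d t (Suc n) B P = 0 \<and> (\<theta> ^^ m') (?D P) = d q'' B P"
    using Suc.IH[OF D dD column_d_column_d] by blast
  let ?B = "\<lambda>P. (\<theta> ^^ m') (B\<^sub>0 P)"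
  have B: "?B \<in> cochain t (s(t := n)) q'" by (rule cochain_theta_pow[OF B\<^sub>0(1)])
  have dB: "(\<theta> ^^ (m' + m)) (F P) = d q' ?B P" if "P \<in> conf t" for P
    using B\<^sub>0(2)[OF that] by (simp add: d_theta_pow funpow_add)
  have "\<exists>B\<in>cochain t (s(t := n)) q'. \<forall>P\<in>conf t. column_d t n B P = 0 \<and> (\<theta> ^^ (m' + m)) (F P) = d q' B P"
  proof (cases q')
    case 0
    then have "column_d t n ?B P = 0" if "P \<in> conf t" for P using IH that by (simp add: column_d_theta_pow)
    then show ?thesis using B dB by blast
  next
    case (Suc q'')
    then obtain B\<^sub>1 where B\<^sub>1: "B\<^sub>1 \<in> cochain t (s(t := Suc n)) q''"
      "\<And>P. P \<in> conf t \<Longrightarrow> column_d t (Suc n) B\<^sub>1 P = 0" "\<And>P. P \<in> conf t \<Longrightarrow> (\<theta> ^^ m') (?D P) = d q'' B\<^sub>1 P"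
      using IH by auto
    let ?A = "\<lambda>P. B\<^sub>1 (insert_column t P)"
    have A: "?A \<in> cochain t (s(t := n)) q''" by (rule insert_column_cochain[OF B\<^sub>1(1) t])
    \<comment> \<open>By contraction \<open>?A\<close> is a column primitive of
      \<open>B\<^sub>1\<close>, so subtracting \<open>d q'' ?A\<close> cancels the column
      differential of \<open>?B\<close>; since \<open>d\<close> squares to zero, \<open>d\<close> of
      the primitive is unchanged.\<close>
    let ?C = "\<lambda>P. ?B P - d q'' ?A P"
    have "?C \<in> cochain t (s(t := n)) q'" using cochain_diff[OF B] d_cochain[OF A] Suc by simp
    moreover have "column_d t n ?C P = 0" if P: "P \<in> conf t" for P
    proof -
      have "column_d t n (d q'' ?A) P = d q'' (column_d t n ?A) P" by (rule d_column_d[symmetric])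
      also have "\<dots> = d q'' B\<^sub>1 P"
        by (rule d_cong[OF _ P]) (rule column_contraction[OF B\<^sub>1(2) _ t])
      finally show ?thesis using B\<^sub>1(3)[OF P] by (simp add: column_d_diff column_d_theta_pow)
    qed
    moreover have "(\<theta> ^^ (m' + m)) (F P) = d q' ?C P" if "P \<in> conf t" for P
      using dB[OF that] d_d[of q'' ?A P] Suc by (simp add: d_diff)
    ultimately show ?thesis by blast
  qed
  then show ?case by (intro exI[of _ "m' + m"]) simp
qed

text \<open>A cochain with one column at level \<open>t\<close> and zero column differential does
  not depend on that column, so it descends to level \<open>Suc t\<close>. \<open>descent\<close>
  supplies a primitive of this kind.\<close>

lemma acyclic_level_Suc:
  assumes acyc: "acyclic_level t" and t: "t < i"
  shows "acyclic_level (Suc t)"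
  unfolding acyclic_level_def
proof (intro allI ballI impI)
  fix s q F
  assume F: "F \<in> cochain (Suc t) s q" and closed: "\<forall>P\<in>conf (Suc t). d q F P = 0"
  have F': "F \<in> cochain t (s(t := 0)) q" by (rule cochain_antimono_level[OF F])
  have fill: "F P = F (fill_columns t P)" "fill_columns t P \<in> conf t" "fill_columns t P \<in> conf (Suc t)"
    if P: "P \<in> conf (Suc t)" for P
  proof -
    show "fill_columns t P \<in> conf t" by (rule fill_columns_conf[OF P t])
    then show *: "fill_columns t P \<in> conf (Suc t)" by (rule conf_antimono) simp
    show "F P = F (fill_columns t P)"
      by (rule cochain_agree[OF F P *]) (simp add: agree_def fill_columns_def)
  qed
  have "column_d t 0 F P = 0" if P: "P \<in> conf t" for P
  proof -
    have "F (delete_column t 0 P) = F (delete_column t 1 P)"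
      by (rule cochain_agree[OF F conf_antimono[OF delete_column_conf[OF P]] conf_antimono[OF delete_column_conf[OF P]]])
        (auto simp: agree_def delete_column_def)
    then show ?thesis by (simp add: column_d_def asum_def)
  qed
  from descent[OF acyc t F' _ this] closed conf_antimono[of _ t "Suc t"]
  obtain m where m: "case q of 0 \<Rightarrow> \<forall>P\<in>conf t. (\<theta> ^^ m) (F P) = 0
      | Suc q' \<Rightarrow> \<exists>B\<in>cochain t (s(t := 0)) q'. \<forall>P\<in>conf t. column_d t 0 B P = 0 \<and> (\<theta> ^^ m) (F P) = d q' B P"
    by auto
  show "\<exists>m. case q of 0 \<Rightarrow> \<forall>P\<in>conf (Suc t). (\<theta> ^^ m) (F P) = 0
        | Suc q' \<Rightarrow> \<exists>B\<in>cochain (Suc t) s q'. \<forall>P\<in>conf (Suc t). (\<theta> ^^ m) (F P) = d q' B P"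
  proof (cases q)
    case 0
    have "(\<theta> ^^ m) (F P) = 0" if "P \<in> conf (Suc t)" for P
      using m 0 fill(1,2)[OF that] by simp
    then show ?thesis using 0 by (intro exI[of _ m]) simp
  next
    case (Suc q')
    then obtain B where B: "B \<in> cochain t (s(t := 0)) q'" "\<And>P. P \<in> conf t \<Longrightarrow> column_d t 0 B P = 0"
      "\<And>P. P \<in> conf t \<Longrightarrow> (\<theta> ^^ m) (F P) = d q' B P" using m by auto
    let ?B = "\<lambda>P. B (fill_columns t P)"
    have B': "?B \<in> cochain (Suc t) s q'" by (rule fill_columns_cochain[OF B(1) t])
    \<comment> \<open>\<open>insert_column t P\<close> has two columns that matter: deleting the
      first gives \<open>P\<close>, and deleting the second gives what \<open>B\<close> cannot
      distinguish from \<open>fill_columns t P\<close>.\<close>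
    have eq: "B P = ?B P" if P: "P \<in> conf t" for P
    proof -
      let ?P = "insert_column t P"
      have I: "?P \<in> conf t" by (rule insert_column_conf[OF P t])
      have "B (delete_column t 0 ?P) = B (delete_column t 1 ?P)"
        using B(2)[OF I] by (simp add: column_d_def asum_def)
      then have "B P = B (delete_column t 1 ?P)" by (simp add: delete_insert_0)
      also have "\<dots> = ?B P"
      proof (rule cochain_agree[OF B(1) delete_column_conf[OF I] fill(2)[OF conf_antimono[OF P]]])
        show "agree t (s(t := 0)) q' (delete_column t 1 ?P) (fill_columns t P)"
          by (auto simp: agree_def delete_column_def insert_column_def fill_columns_def)
      qed simp
      finally show ?thesis .
    qed
    \<comment> \<open>\<open>P\<close> need not satisfy the conditions of level \<open>t\<close>,
      where the identity for \<open>B\<close> is known, so it is first replaced by its filling.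
      Neither \<open>F\<close> nor \<open>?B\<close> sees the change.\<close>
    have "(\<theta> ^^ m) (F P) = d q' ?B P" if P: "P \<in> conf (Suc t)" for P
    proof -
      let ?Q = "fill_columns t P"
      have "(\<theta> ^^ m) (F P) = d q' B ?Q" using fill[OF P] B(3) by simp
      also have "\<dots> = d q' ?B P"
        unfolding d_def
      proof (rule asum_cong)
        fix l
        have "B (face l ?Q) = ?B (face l ?Q)" by (rule eq[OF face_conf[OF fill(2)[OF P]]])
        also have "\<dots> = ?B (face l P)"
          by (rule cochain_agree[OF B' face_conf[OF fill(3)[OF P]] face_conf[OF P]])
            (simp add: agree_def face_def fill_columns_def)
        finally show "B (face l ?Q) = ?B (face l P)" .
      qed
      finally show ?thesis .
    qed
    then show ?thesis using B' Suc by (intro exI[of _ m]) auto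
  qed
qed

lemma acyclic_level_all: "t \<le> i \<Longrightarrow> acyclic_level t"
  by (induction t) (auto intro: acyclic_level_0 acyclic_level_Suc)

end

section \<open>Inhomogeneous cochains\<close>

lemma asum_ends:
  "asum (Suc n) f = f 0 + (\<Sum>j<n. (-1) ^ Suc j *\<^sub>R f (Suc j)) + (-1) ^ Suc n *\<^sub>R f (Suc n)"
  unfolding asum_def sum.atMost_Suc[of _ n] lessThan_Suc_atMost[symmetric]
  by (subst sum.lessThan_Suc_shift) simp

lemma topspace_power_top: "topspace (power_top T n) = PiE {..<n} (\<lambda>_. topspace T)"
  by (simp add: power_top_def)

context unipotence begin

definition differences :: "nat \<Rightarrow> 'g config \<Rightarrow> nat \<Rightarrow> 'g" where
  "differences n P = restrict (\<lambda>j. inv (P j 0 0) \<otimes> P (Suc j) 0 0) {..<n}"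

definition homogenize :: "nat \<Rightarrow> ((nat \<Rightarrow> 'g) \<Rightarrow> 'e) \<Rightarrow> 'g config \<Rightarrow> 'e" where
  "homogenize n c P = \<rho> (P 0 0 0) (c (differences n P))"

text \<open>Constant from \<open>n\<close> on: a tuple is undefined there, whereas every row of a
  configuration must lie in the group.\<close>

primrec partial_product :: "nat \<Rightarrow> (nat \<Rightarrow> 'g) \<Rightarrow> nat \<Rightarrow> 'g" where
  "partial_product n g 0 = \<one>"
| "partial_product n g (Suc l) = (if l < n then partial_product n g l \<otimes> g l else partial_product n g l)"

text \<open>The auxiliary entries are filler; for \<open>conf i\<close> any group element would
  do.\<close>

definition vertices :: "nat \<Rightarrow> (nat \<Rightarrow> 'g) \<Rightarrow> 'g config" where
  "vertices n g = (\<lambda>l k a. if k = 0 then partial_product n g l else z)"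

lemma differences_topspace: "P \<in> conf i \<Longrightarrow> differences n P \<in> tuples n"
  using conf_carrier[of P i] by (auto simp: differences_def topspace_power_top topspace_T)

lemma conf_i: "P \<in> conf i \<longleftrightarrow> (\<forall>l k a. P l k a \<in> carrier G)"
  by (auto simp: conf_def)

lemma vertices_conf: "g \<in> tuples n \<Longrightarrow> vertices n g \<in> conf i"
proof -
  assume g: "g \<in> tuples n"
  have "partial_product n g l \<in> carrier G" for l
    using g by (induction l) (auto simp: topspace_power_top topspace_T PiE_def Pi_def)
  then show ?thesis by (simp add: conf_i vertices_def)
qed

lemma differences_vertices:
  assumes g: "g \<in> tuples n"
  shows "differences n (vertices n g) = g"
proof (rule extensionalityI)
  show "differences n (vertices n g) \<in> extensional {..<n}" by (simp add: differences_def)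
  show "g \<in> extensional {..<n}" using g by (simp add: topspace_power_top PiE_def)
  fix j assume j: "j \<in> {..<n}"
  have "partial_product n g j \<in> carrier G" using conf_carrier[OF vertices_conf[OF g], of j 0 0] by (simp add: vertices_def)
  moreover have "g j \<in> carrier G" using g j by (auto simp: topspace_power_top topspace_T)
  ultimately show "differences n (vertices n g) j = g j"
    using j by (simp add: differences_def vertices_def m_assoc[symmetric])
qed

lemma partial_product_differences:
  assumes P: "P \<in> conf i" and "l \<le> n"
  shows "P 0 0 0 \<otimes> partial_product n (differences n P) l = P l 0 0"
  using assms(2)
proof (induction l)
  case 0
  then show ?case using conf_carrier[OF P] by simp
next
  case (Suc l)
  note c = conf_carrier[OF P]
  have pc: "partial_product n (differences n P) l \<in> carrier G"
    using conf_carrier[OF vertices_conf[OF differences_topspace[OF P]], of n l 0 0] by (simp add: vertices_def)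
  have "P 0 0 0 \<otimes> partial_product n (differences n P) (Suc l)
      = (P 0 0 0 \<otimes> partial_product n (differences n P) l) \<otimes> (inv (P l 0 0) \<otimes> P (Suc l) 0 0)"
    using Suc.prems c pc by (simp add: differences_def m_assoc)
  also have "\<dots> = P (Suc l) 0 0" using Suc c by (simp add: m_assoc[symmetric])
  finally show ?case .
qed

lemma homogenize_cochain:
  assumes c: "c \<in> cochains T n" and V: "\<And>x. x \<in> tuples n \<Longrightarrow> c x \<in> V"
  shows "homogenize n c \<in> cochain i s n"
proof -
  have "continuous_map (conf_top i) (power_top T n) (differences n)"
    unfolding power_top_def continuous_map_componentwise differences_def
    by (auto intro!: continuous_map_mult continuous_map_m_inv continuous_map_entry)
  from continuous_map_compose[OF this] c
  have "continuous_map (conf_top i) euclidean (\<lambda>P. c (differences n P))"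
    by (auto simp: cochains_def comp_def)
  from continuous_map_action[OF continuous_map_entry this]
  have "continuous_map (conf_top i) euclidean (homogenize n c)"
    unfolding homogenize_def[abs_def] .
  moreover have "homogenize n c P \<in> V" if "P \<in> conf i" for P
    unfolding homogenize_def
    by (rule uc_fixed_invariant[OF conf_carrier[OF that] V[OF differences_topspace[OF that]]])
  moreover have "homogenize n c (translate g P) = \<rho> g (homogenize n c P)" if P: "P \<in> conf i" and g: "g \<in> carrier G" for P g
  proof -
    note cc = conf_carrier[OF P]
    have "inv (g \<otimes> P j 0 0) \<otimes> (g \<otimes> P (Suc j) 0 0) = inv (P j 0 0) \<otimes> P (Suc j) 0 0" for j
    proof -
      have "inv (g \<otimes> P j 0 0) \<otimes> (g \<otimes> P (Suc j) 0 0) = inv (P j 0 0) \<otimes> ((inv g \<otimes> g) \<otimes> P (Suc j) 0 0)"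
        using cc g by (simp only: inv_mult_group m_assoc m_closed inv_closed)
      then show ?thesis using cc g by simp
    qed
    then have "differences n (translate g P) = differences n P"
      by (simp add: differences_def translate_def act_def)
    then show ?thesis using rho_mult[OF g cc] by (simp add: homogenize_def translate_def act_def)
  qed
  moreover have "homogenize n c P = homogenize n c P'" if "agree i s n P P'" for P P'
  proof -
    have "differences n P = differences n P'" "P 0 0 0 = P' 0 0 0"
      using that by (auto simp: differences_def agree_def fun_eq_iff)
    then show ?thesis by (simp add: homogenize_def)
  qed
  ultimately show ?thesis unfolding cochain_def by simp
qed

lemma d_homogenize:
  assumes P: "P \<in> conf i"
  shows "d n (homogenize n c) P = homogenize (Suc n) (coboundary G \<rho> n c) P"
proof -
  note cc = conf_carrier[OF P]
  let ?x = "\<lambda>j. P j 0 0"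
  define g where "g = differences (Suc n) P"
  have g: "g j = inv (?x j) \<otimes> ?x (Suc j)" if "j \<le> n" for j
    using that by (simp add: g_def differences_def)
  have first: "homogenize n c (face 0 P) = \<rho> (?x 0) (\<rho> (g 0) (c (restrict (\<lambda>j. g (Suc j)) {..<n})))"
  proof -
    have "differences n (face 0 P) = restrict (\<lambda>j. g (Suc j)) {..<n}"
      by (auto simp: differences_def face_def g fun_eq_iff)
    moreover have "?x 0 \<otimes> g 0 = ?x 1" using cc by (simp add: g m_assoc[symmetric])
    then have "\<rho> (?x 1) \<xi> = \<rho> (?x 0) (\<rho> (g 0) \<xi>)" for \<xi>
      using rho_mult[of "?x 0" "g 0" \<xi>] cc by (simp add: g)
    ultimately show ?thesis by (simp add: homogenize_def face_def)
  qed
  have middle: "homogenize n c (face (Suc j) P)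
      = \<rho> (?x 0) (c (restrict (\<lambda>k. if k < j then g k else if k = j then g j \<otimes> g (Suc j) else g (Suc k)) {..<n}))"
    if j: "j < n" for j
  proof -
    have "g j \<otimes> g (Suc j) = inv (?x j) \<otimes> ?x (Suc (Suc j))"
    proof -
      have "g j \<otimes> g (Suc j) = inv (?x j) \<otimes> ((?x (Suc j) \<otimes> inv (?x (Suc j))) \<otimes> ?x (Suc (Suc j)))"
        using cc j by (simp only: g m_assoc m_closed inv_closed Suc_leI less_imp_le)
      then show ?thesis using cc by simp
    qed
    then have "differences n (face (Suc j) P)
        = restrict (\<lambda>k. if k < j then g k else if k = j then g j \<otimes> g (Suc j) else g (Suc k)) {..<n}"
      by (auto simp: differences_def face_def g fun_eq_iff)
    then show ?thesis by (simp add: homogenize_def face_def)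
  qed
  have last: "homogenize n c (face (Suc n) P) = \<rho> (?x 0) (c (restrict g {..<n}))"
  proof -
    have "differences n (face (Suc n) P) = restrict g {..<n}"
      by (auto simp: differences_def face_def g fun_eq_iff)
    then show ?thesis by (simp add: homogenize_def face_def)
  qed
  have lin: "linear (\<rho> (?x 0))" by (rule rho_linear[OF cc])
  show ?thesis
    unfolding d_def asum_ends homogenize_def[of "Suc n"] g_def[symmetric] coboundary_def
    unfolding linear_add[OF lin] linear_sum[OF lin] linear_scale[OF lin] first last
    by (simp add: middle)
qed

text \<open>On the rows that matter, a configuration is the translate by its zeroth vertex of the
  one rebuilt from its successive differences, so equivariance recovers \<open>B\<close> from
  \<open>b\<close>.\<close>

lemma cochain_dehomogenize:
  assumes B: "B \<in> cochain i s n"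
  defines "b \<equiv> \<lambda>g. B (vertices n g)"
  shows "b \<in> cochains T n" "\<And>g. g \<in> tuples n \<Longrightarrow> b g \<in> V"
    "\<And>P. P \<in> conf i \<Longrightarrow> homogenize n b P = B P"
proof -
  have proj: "continuous_map (power_top T n) T (\<lambda>g. g l)" if "l < n" for l
    unfolding power_top_def using that by (intro continuous_map_product_projection) simp
  have pp: "continuous_map (power_top T n) T (\<lambda>g. partial_product n g l)" for l
  proof (induction l)
    case (Suc l)
    then show ?case using continuous_map_mult[OF Suc proj[of l]] by (cases "l < n") simp_all
  qed (simp add: topspace_T)
  have "continuous_map (power_top T n) (conf_top i) (vertices n)"
  proof (rule continuous_map_conf)
    show "continuous_map (power_top T n) T (\<lambda>g. vertices n g l k a)" for l k a
      using pp by (cases "k = 0") (simp_all add: vertices_def topspace_T)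
  qed (rule vertices_conf)
  from continuous_map_compose[OF this cochain_continuous[OF B]]
  show "b \<in> cochains T n" by (simp add: cochains_def b_def comp_def)
  show "b g \<in> V" if "g \<in> tuples n" for g
    unfolding b_def by (rule cochain_V[OF B vertices_conf[OF that]])
  show "homogenize n b P = B P" if P: "P \<in> conf i" for P
  proof -
    let ?Q = "vertices n (differences n P)"
    have Q: "?Q \<in> conf i" by (rule vertices_conf[OF differences_topspace[OF P]])
    have "homogenize n b P = B (translate (P 0 0 0) ?Q)"
      unfolding homogenize_def b_def by (rule cochain_equivariant[OF B Q conf_carrier[OF P], symmetric])
    also have "\<dots> = B P"
    proof (rule cochain_agree[OF B translate_conf[OF Q conf_carrier[OF P]] P])
      show "agree i s n (translate (P 0 0 0) ?Q) P"
        using partial_product_differences[OF P] by (auto simp: agree_def translate_def act_def vertices_def)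
    qed
    finally show ?thesis .
  qed
qed

theorem theta_power_coboundary:
  assumes c: "c \<in> cocycles G T \<rho> (Suc n)" and V: "\<And>x. x \<in> tuples (Suc n) \<Longrightarrow> c x \<in> V"
  shows "\<exists>m. \<exists>b\<in>cochains T n. (\<forall>x\<in>tuples n. b x \<in> V) \<and>
    (\<forall>x\<in>tuples (Suc n). (\<theta> ^^ m) (c x) = coboundary G \<rho> n b x)"
proof -
  \<comment> \<open>The column counts are arbitrary, as no level is left at
    \<open>i\<close>.\<close>
  define s :: "nat \<Rightarrow> nat" where "s = (\<lambda>_. 0)"
  have cc: "c \<in> cochains T (Suc n)" using c by (simp add: cocycles_def)
  have F: "homogenize (Suc n) c \<in> cochain i s (Suc n)" by (rule homogenize_cochain[OF cc V])
  have "d (Suc n) (homogenize (Suc n) c) P = 0" if P: "P \<in> conf i" for P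
    using c differences_topspace[OF P] linear_0[OF rho_linear[OF conf_carrier[OF P]]]
    unfolding d_homogenize[OF P] by (simp add: homogenize_def cocycles_def)
  then obtain m B where B: "B \<in> cochain i s n" "\<And>P. P \<in> conf i \<Longrightarrow> (\<theta> ^^ m) (homogenize (Suc n) c P) = d n B P"
    using acyclic_level_all[OF order_refl, unfolded acyclic_level_def, rule_format, OF F] by auto
  define b where "b = (\<lambda>g. B (vertices n g))"
  note b = cochain_dehomogenize[OF B(1), folded b_def]
  have "(\<theta> ^^ m) (c x) = coboundary G \<rho> n b x" if x: "x \<in> tuples (Suc n)" for x
  proof -
    let ?P = "vertices (Suc n) x"
    have P: "?P \<in> conf i" by (rule vertices_conf[OF x])
    have hom: "homogenize (Suc n) f ?P = f x" for f
      using differences_vertices[OF x] by (simp add: homogenize_def vertices_def rho_one)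
    have "(\<theta> ^^ m) (c x) = d n B ?P" using B(2)[OF P] hom by simp
    also have "\<dots> = d n (homogenize n b) ?P" by (rule d_cong[OF _ P]) (simp add: b(3))
    also have "\<dots> = coboundary G \<rho> n b x" unfolding d_homogenize[OF P] hom ..
    finally show ?thesis .
  qed
  moreover have "b x \<in> V" if "x \<in> tuples n" for x
    using b(2)[OF that] by (simp add: b_def)
  ultimately show ?thesis using b(1) by (intro exI[of _ m] bexI[of _ b]) simp_all
qed

end

section \<open>Limits of coboundaries\<close>

context isometric_module begin

lemma coboundary_args:
  assumes "x \<in> tuples (Suc n)"
  shows "x 0 \<in> carrier G" "restrict (\<lambda>i. x (Suc i)) {..<n} \<in> tuples n"
    "restrict x {..<n} \<in> tuples n"
    "i < n \<Longrightarrow> restrict (\<lambda>j. if j < i then x j else if j = i then x i \<otimes> x (Suc i) else x (Suc j)) {..<n} \<in> tuples n"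
proof -
  have x: "x j \<in> carrier G" if "j < Suc n" for j
    using assms that by (auto simp: topspace_power_top topspace_T)
  show "x 0 \<in> carrier G" "restrict (\<lambda>i. x (Suc i)) {..<n} \<in> tuples n"
    "restrict x {..<n} \<in> tuples n"
    "i < n \<Longrightarrow> restrict (\<lambda>j. if j < i then x j else if j = i then x i \<otimes> x (Suc i) else x (Suc j)) {..<n} \<in> tuples n"
    using x by (auto simp: topspace_power_top topspace_T)
qed

text \<open>Linearity and equivariance are asked only on \<open>W\<close> so that \<open>h\<close>
  may be an ergodic projection, for which they are established only on
  \<open>V\<^sub>i\<close>.\<close>

lemma coboundary_commute:
  assumes W: "subspace W" "\<And>g \<xi>. g \<in> carrier G \<Longrightarrow> \<xi> \<in> W \<Longrightarrow> \<rho> g \<xi> \<in> W"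
    and add: "\<And>\<xi> \<eta>. \<xi> \<in> W \<Longrightarrow> \<eta> \<in> W \<Longrightarrow> h (\<xi> + \<eta>) = h \<xi> + h \<eta>"
    and scale: "\<And>r \<xi>. \<xi> \<in> W \<Longrightarrow> h (r *\<^sub>R \<xi>) = r *\<^sub>R h \<xi>"
    and comm: "\<And>g \<xi>. g \<in> carrier G \<Longrightarrow> \<xi> \<in> W \<Longrightarrow> h (\<rho> g \<xi>) = \<rho> g (h \<xi>)"
    and c: "\<And>x. x \<in> tuples n \<Longrightarrow> c x \<in> W"
    and x: "x \<in> tuples (Suc n)"
  shows "coboundary G \<rho> n (\<lambda>x. h (c x)) x = h (coboundary G \<rho> n c x)"
proof -
  note a = coboundary_args[OF x]
  have sum: "h (sum f I) = (\<Sum>i\<in>I. h (f i)) \<and> sum f I \<in> W" if "finite I" "\<And>i. i \<in> I \<Longrightarrow> f i \<in> W" for f :: "nat \<Rightarrow> 'e" and I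
    using that
  proof (induction I rule: finite_induct)
    case empty
    then show ?case using scale[OF subspace_0[OF W(1)], of 0] subspace_0[OF W(1)] by simp
  next
    case (insert i I)
    then show ?case using add[of "f i" "sum f I"] subspace_add[OF W(1)] by simp
  qed
  let ?m = "\<lambda>i. (-1) ^ Suc i *\<^sub>R c (restrict (\<lambda>j. if j < i then x j else if j = i then x i \<otimes> x (Suc i) else x (Suc j)) {..<n})"
  have m: "?m i \<in> W" "h (?m i) = (-1) ^ Suc i *\<^sub>R h (c (restrict (\<lambda>j. if j < i then x j else if j = i then x i \<otimes> x (Suc i) else x (Suc j)) {..<n}))"
    if "i < n" for i
    by (rule subspace_scale[OF W(1) c[OF a(4)[OF that]]], rule scale[OF c[OF a(4)[OF that]]])
  have sm: "h (sum ?m {..<n}) = (\<Sum>i<n. h (?m i))" "sum ?m {..<n} \<in> W" using sum[of "{..<n}" ?m] m by auto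
  have f: "\<rho> (x 0) (c (restrict (\<lambda>i. x (Suc i)) {..<n})) \<in> W" using W(2)[OF a(1) c[OF a(2)]] .
  have l: "(-1) ^ Suc n *\<^sub>R c (restrict x {..<n}) \<in> W" using subspace_scale[OF W(1) c[OF a(3)]] .
  show ?thesis
    unfolding coboundary_def add[OF subspace_add[OF W(1) f sm(2)] l] add[OF f sm(2)] sm(1)
      comm[OF a(1) c[OF a(2)]] scale[OF c[OF a(3)]]
    by (simp add: m(2) del: power_Suc)
qed

lemma coboundary_add:
  assumes "x \<in> tuples (Suc n)"
  shows "coboundary G \<rho> n (\<lambda>x. b x + b' x) x = coboundary G \<rho> n b x + coboundary G \<rho> n b' x"
  unfolding coboundary_def linear_add[OF rho_linear[OF coboundary_args(1)[OF assms]]] scaleR_add_right sum.distrib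
  by (simp only: add_ac)

lemma coboundary_scale:
  assumes "x \<in> tuples (Suc n)"
  shows "coboundary G \<rho> n (\<lambda>x. r *\<^sub>R b x) x = r *\<^sub>R coboundary G \<rho> n b x"
proof (rule coboundary_commute[where W = UNIV and h = "\<lambda>\<xi>. r *\<^sub>R \<xi>", OF subspace_UNIV])
  show "r *\<^sub>R \<rho> g \<xi> = \<rho> g (r *\<^sub>R \<xi>)" if "g \<in> carrier G" for g \<xi>
    using linear_scale[OF rho_linear[OF that]] by simp
qed (use assms in \<open>simp_all add: scaleR_add_right\<close>)

text \<open>Primitives are required to have values in \<open>V\<^sub>i\<close>: there
  \<open>\<rho> z\<close> commutes with the group and hence sends limits of coboundaries to limits
  of coboundaries.\<close>

definition approx :: "nat \<Rightarrow> nat \<Rightarrow> ((nat \<Rightarrow> 'g) \<Rightarrow> 'e) set" where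
  "approx i n = {c. \<forall>K. compactin (power_top T (Suc n)) K \<longrightarrow> (\<forall>\<epsilon>>0. \<exists>b\<in>cochains T n.
     (\<forall>x\<in>tuples n. b x \<in> Fix i) \<and> (\<forall>x\<in>K. norm (c x - coboundary G \<rho> n b x) < \<epsilon>))}"

lemma approxE:
  assumes "c \<in> approx i n" "compactin (power_top T (Suc n)) K" "\<epsilon> > 0"
  obtains b where "b \<in> cochains T n" "\<And>x. x \<in> tuples n \<Longrightarrow> b x \<in> Fix i"
    "\<And>x. x \<in> K \<Longrightarrow> norm (c x - coboundary G \<rho> n b x) < \<epsilon>"
  using assms unfolding approx_def by blast

lemma approxI:
  assumes "\<And>K \<epsilon>. compactin (power_top T (Suc n)) K \<Longrightarrow> K \<subseteq> tuples (Suc n) \<Longrightarrow> \<epsilon> > 0 \<Longrightarrow> \<exists>b\<in>cochains T n.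
     (\<forall>x\<in>tuples n. b x \<in> Fix i) \<and> (\<forall>x\<in>K. norm (c x - coboundary G \<rho> n b x) < \<epsilon>)"
  shows "c \<in> approx i n"
  unfolding approx_def using assms compactin_subset_topspace by blast

lemma approx_limit:
  assumes "\<And>K \<epsilon>. compactin (power_top T (Suc n)) K \<Longrightarrow> \<epsilon> > 0 \<Longrightarrow> \<exists>c'\<in>approx i n. \<forall>x\<in>K. norm (c x - c' x) < \<epsilon>"
  shows "c \<in> approx i n"
proof (rule approxI)
  fix K and \<epsilon> :: real
  assume K: "compactin (power_top T (Suc n)) K" and \<epsilon>: "\<epsilon> > 0"
  then obtain c' where c': "c' \<in> approx i n" "\<And>x. x \<in> K \<Longrightarrow> norm (c x - c' x) < \<epsilon> / 2"
    using assms[OF K, of "\<epsilon> / 2"] by auto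
  obtain b where b: "b \<in> cochains T n" "\<And>x. x \<in> tuples n \<Longrightarrow> b x \<in> Fix i"
    "\<And>x. x \<in> K \<Longrightarrow> norm (c' x - coboundary G \<rho> n b x) < \<epsilon> / 2"
    using approxE[OF c'(1) K, of "\<epsilon> / 2"] \<epsilon> by auto
  have "norm (c x - coboundary G \<rho> n b x) < \<epsilon>" if "x \<in> K" for x
    using norm_triangle_ineq[of "c x - c' x" "c' x - coboundary G \<rho> n b x"] c'(2)[OF that] b(3)[OF that] by simp
  then show "\<exists>b\<in>cochains T n. (\<forall>x\<in>tuples n. b x \<in> Fix i) \<and>
      (\<forall>x\<in>K. norm (c x - coboundary G \<rho> n b x) < \<epsilon>)" using b by blast
qed

lemma approx_cong:
  assumes "c \<in> approx i n" "\<And>x. x \<in> tuples (Suc n) \<Longrightarrow> c' x = c x"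
  shows "c' \<in> approx i n"
proof (rule approx_limit)
  fix K and \<epsilon> :: real assume "compactin (power_top T (Suc n)) K" "\<epsilon> > 0"
  then show "\<exists>c\<in>approx i n. \<forall>x\<in>K. norm (c' x - c x) < \<epsilon>"
    using assms compactin_subset_topspace[of "power_top T (Suc n)" K] by (intro bexI[of _ c]) auto
qed

lemma cochains_add: "b \<in> cochains T n \<Longrightarrow> b' \<in> cochains T n \<Longrightarrow> (\<lambda>x. b x + b' x) \<in> cochains T n"
  unfolding cochains_def by (simp add: continuous_map_add)

lemma cochains_compose:
  assumes "b \<in> cochains T n" "continuous_on W h" "\<And>x. x \<in> tuples n \<Longrightarrow> b x \<in> W"
  shows "(\<lambda>x. h (b x)) \<in> cochains T n"
proof -
  have "continuous_map (power_top T n) (top_of_set W) b"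
    using assms by (auto simp: cochains_def continuous_map_in_subtopology)
  moreover have "continuous_map (top_of_set W) euclidean h" using assms by simp
  ultimately have "continuous_map (power_top T n) euclidean (h \<circ> b)" by (rule continuous_map_compose)
  then show ?thesis by (simp add: cochains_def comp_def)
qed

lemma approx_add:
  assumes "c \<in> approx i n" "c' \<in> approx i n"
  shows "(\<lambda>x. c x + c' x) \<in> approx i n"
proof (rule approxI)
  fix K and \<epsilon> :: real
  assume K: "compactin (power_top T (Suc n)) K" "K \<subseteq> tuples (Suc n)" and \<epsilon>: "\<epsilon> > 0"
  obtain b where b: "b \<in> cochains T n" "\<And>x. x \<in> tuples n \<Longrightarrow> b x \<in> Fix i"
    "\<And>x. x \<in> K \<Longrightarrow> norm (c x - coboundary G \<rho> n b x) < \<epsilon> / 2"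
    using approxE[OF assms(1) K(1), of "\<epsilon> / 2"] \<epsilon> by auto
  obtain b' where b': "b' \<in> cochains T n" "\<And>x. x \<in> tuples n \<Longrightarrow> b' x \<in> Fix i"
    "\<And>x. x \<in> K \<Longrightarrow> norm (c' x - coboundary G \<rho> n b' x) < \<epsilon> / 2"
    using approxE[OF assms(2) K(1), of "\<epsilon> / 2"] \<epsilon> by auto
  have "norm (c x + c' x - coboundary G \<rho> n (\<lambda>x. b x + b' x) x) < \<epsilon>" if x: "x \<in> K" for x
    unfolding coboundary_add[OF subsetD[OF K(2) x]]
    using norm_triangle_ineq[of "c x - coboundary G \<rho> n b x" "c' x - coboundary G \<rho> n b' x"] b(3)[OF x] b'(3)[OF x]
    by (simp add: algebra_simps)
  moreover have "b x + b' x \<in> Fix i" if "x \<in> tuples n" for x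
    by (rule subspace_add[OF uc_fixed_subspace b(2)[OF that] b'(2)[OF that]])
  ultimately show "\<exists>b\<in>cochains T n. (\<forall>x\<in>tuples n. b x \<in> Fix i) \<and>
      (\<forall>x\<in>K. norm (c x + c' x - coboundary G \<rho> n b x) < \<epsilon>)"
    using cochains_add[OF b(1) b'(1)] by (intro bexI[of _ "\<lambda>x. b x + b' x"]) auto
qed

lemma approx_linear:
  assumes c: "c \<in> approx i n" and h: "bounded_linear h"
    and inv: "\<And>\<xi>. \<xi> \<in> Fix i \<Longrightarrow> h \<xi> \<in> Fix i"
    and comm: "\<And>g \<xi>. g \<in> carrier G \<Longrightarrow> \<xi> \<in> Fix i \<Longrightarrow> h (\<rho> g \<xi>) = \<rho> g (h \<xi>)"
  shows "(\<lambda>x. h (c x)) \<in> approx i n"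
proof (rule approxI)
  fix K and \<epsilon> :: real
  assume K: "compactin (power_top T (Suc n)) K" "K \<subseteq> tuples (Suc n)" and \<epsilon>: "\<epsilon> > 0"
  interpret h: bounded_linear h by fact
  obtain M where M: "M > 0" "\<And>\<xi>. norm (h \<xi>) \<le> norm \<xi> * M" using h.pos_bounded by blast
  obtain b where b: "b \<in> cochains T n" "\<And>x. x \<in> tuples n \<Longrightarrow> b x \<in> Fix i"
    "\<And>x. x \<in> K \<Longrightarrow> norm (c x - coboundary G \<rho> n b x) < \<epsilon> / M"
    using approxE[OF c K(1), of "\<epsilon> / M"] \<epsilon> M(1) by auto
  have "norm (h (c x) - coboundary G \<rho> n (\<lambda>x. h (b x)) x) < \<epsilon>" if x: "x \<in> K" for x
  proof -
    have "coboundary G \<rho> n (\<lambda>x. h (b x)) x = h (coboundary G \<rho> n b x)"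
      by (rule coboundary_commute[OF uc_fixed_subspace uc_fixed_invariant _ _ comm b(2) subsetD[OF K(2) x]])
        (simp_all add: h.add h.scaleR)
    then have "norm (h (c x) - coboundary G \<rho> n (\<lambda>x. h (b x)) x) = norm (h (c x - coboundary G \<rho> n b x))"
      by (simp add: h.diff)
    also have "\<dots> \<le> norm (c x - coboundary G \<rho> n b x) * M" by (rule M)
    also have "\<dots> < \<epsilon>" using b(3)[OF x] M(1) by (simp add: field_simps)
    finally show ?thesis .
  qed
  moreover have "(\<lambda>x. h (b x)) \<in> cochains T n"
    by (rule cochains_compose[OF b(1), of UNIV]) (auto intro: linear_continuous_on h)
  ultimately show "\<exists>b\<in>cochains T n. (\<forall>x\<in>tuples n. b x \<in> Fix i) \<and>
      (\<forall>x\<in>K. norm (h (c x) - coboundary G \<rho> n b x) < \<epsilon>)"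
    using b(2) inv by (intro bexI[of _ "\<lambda>x. h (b x)"]) auto
qed

lemma approx_scale: "c \<in> approx i n \<Longrightarrow> (\<lambda>x. r *\<^sub>R c x) \<in> approx i n"
  by (erule approx_linear[OF _ bounded_linear_scaleR_right subspace_scale[OF uc_fixed_subspace]])
    (assumption, rule linear_scale[OF rho_linear, symmetric])

lemma approx_diff: "c \<in> approx i n \<Longrightarrow> c' \<in> approx i n \<Longrightarrow> (\<lambda>x. c x - c' x) \<in> approx i n"
  using approx_add[OF _ approx_scale[of c' i n "-1"]] by simp

lemma approx_zero: "(\<lambda>_. 0) \<in> approx i n"
proof (rule approxI)
  fix K and \<epsilon> :: real
  assume K: "K \<subseteq> tuples (Suc n)" and \<epsilon>: "\<epsilon> > 0"
  have "coboundary G \<rho> n (\<lambda>_. 0) x = 0" if "x \<in> K" for x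
    using coboundary_scale[OF subsetD[OF K that], of 0 "\<lambda>_. 0"] by simp
  then show "\<exists>b\<in>cochains T n. (\<forall>x\<in>tuples n. b x \<in> Fix i) \<and>
      (\<forall>x\<in>K. norm (0 - coboundary G \<rho> n b x) < \<epsilon>)"
    using \<epsilon> subspace_0[OF uc_fixed_subspace] by (intro bexI[of _ "\<lambda>_. 0"]) (auto simp: cochains_def)
qed

lemma approx_sum:
  fixes N :: nat
  assumes "\<And>k. k < N \<Longrightarrow> c k \<in> approx i n" shows "(\<lambda>x. \<Sum>k<N. c k x) \<in> approx i n"
  using assms by (induction N) (auto simp: approx_zero intro!: approx_add)

lemma approx_coboundary:
  assumes "b \<in> cochains T n" "\<And>x. x \<in> tuples n \<Longrightarrow> b x \<in> Fix i"
  shows "coboundary G \<rho> n b \<in> approx i n"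
  by (rule approxI, rule bexI[of _ b]) (use assms in auto)

lemma uc_fixed_0: "Fix 0 = UNIV"
  by (auto simp: uc_fixed_def rho_one)

lemma approx_level_0:
  assumes "c \<in> approx i n" shows "c \<in> approx 0 n"
proof (rule approxI)
  fix K and \<epsilon> :: real assume "compactin (power_top T (Suc n)) K" "\<epsilon> > 0"
  from approxE[OF assms this] obtain b where "b \<in> cochains T n" "\<And>x. x \<in> K \<Longrightarrow> norm (c x - coboundary G \<rho> n b x) < \<epsilon>"
    by metis
  then show "\<exists>b\<in>cochains T n. (\<forall>x\<in>tuples n. b x \<in> Fix 0) \<and>
      (\<forall>x\<in>K. norm (c x - coboundary G \<rho> n b x) < \<epsilon>)"
    unfolding uc_fixed_0 by (intro bexI[of _ b]) auto
qed

lemma approx_0_compact_open_closure: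
  assumes "c \<in> approx 0 n"
  shows "c \<in> compact_open_closure T (Suc n) (coboundaries G T \<rho> (Suc n))"
  unfolding compact_open_closure_def
proof (intro CollectI allI impI)
  fix K and \<epsilon> :: real assume "compactin (power_top T (Suc n)) K" "\<epsilon> > 0"
  from approxE[OF assms this] obtain b where b: "b \<in> cochains T n" "\<And>x. x \<in> K \<Longrightarrow> norm (c x - coboundary G \<rho> n b x) < \<epsilon>"
    by metis
  have "coboundary G \<rho> n b \<in> coboundaries G T \<rho> (Suc n)" using b(1) by (simp add: coboundaries_def)
  then show "\<exists>b\<in>coboundaries G T \<rho> (Suc n). \<forall>x\<in>K. norm (c x - b x) < \<epsilon>" using b(2) by blast
qed

end

section \<open>Lowering the power of \<theta> to one\<close>

context unipotence begin

lemma approx_rho: "c \<in> approx i n \<Longrightarrow> (\<lambda>x. \<rho> z (c x)) \<in> approx i n"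
proof (rule approx_linear[where h = "\<rho> z"])
  show "\<rho> z (\<rho> g \<xi>) = \<rho> g (\<rho> z \<xi>)" if "g \<in> carrier G" "\<xi> \<in> V" for g \<xi>
    using that by (rule uc_fixed_commute[OF z])
  show "\<rho> z \<xi> \<in> V" if "\<xi> \<in> V" for \<xi> using that by (rule uc_fixed_invariant[OF z_closed])
qed (assumption, rule rho_bounded_linear[OF z_closed])

text \<open>Powers of \<open>z\<close> change \<open>\<theta> (w x)\<close> only by limits of
  coboundaries, so it may be replaced by its Cesaro means. These telescope to a difference of two
  vectors of norm at most \<open>M\<close>, divided by \<open>N\<close>.\<close>

lemma approx_theta_reduce:
  assumes w: "w \<in> cochains T (Suc n)"
    and \<theta>\<theta>: "(\<lambda>x. \<theta> (\<theta> (w x))) \<in> approx i n"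
  shows "(\<lambda>x. \<theta> (w x)) \<in> approx i n"
proof (rule approx_limit)
  fix K and \<epsilon> :: real
  assume K: "compactin (power_top T (Suc n)) K" and \<epsilon>: "\<epsilon> > 0"
  let ?U = "\<rho> z"
  have U: "linear ?U" by (rule rho_linear) simp
  have "compactin euclidean (w ` K)" by (rule image_compactin[OF K]) (use w in \<open>simp add: cochains_def\<close>)
  then have "bounded (w ` K)" unfolding compactin_euclidean_iff by (rule compact_imp_bounded)
  then obtain M where M: "\<And>x. x \<in> K \<Longrightarrow> norm (w x) \<le> M" "M > 0" unfolding bounded_pos by blast
  obtain N where N: "2 * M / \<epsilon> < real N" using reals_Archimedean2 by blast
  have Npos: "real N > 0" by (rule less_trans[OF _ N]) (use M(2) \<epsilon> in simp)
  have pow: "(\<lambda>x. (?U ^^ k) (\<theta> (w x)) - \<theta> (w x)) \<in> approx i n" for k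
  proof (induction k)
    case 0 then show ?case by (simp add: approx_zero)
  next
    case (Suc k)
    have eq: "(?U ^^ Suc k) (\<theta> (w x)) - \<theta> (w x) = ?U ((?U ^^ k) (\<theta> (w x)) - \<theta> (w x)) + \<theta> (\<theta> (w x))" for x
    proof -
      have "?U ((?U ^^ k) (\<theta> (w x)) - \<theta> (w x)) = (?U ^^ Suc k) (\<theta> (w x)) - ?U (\<theta> (w x))"
        using linear_diff[OF U] by simp
      then show ?thesis using fun_cong[OF \<theta>_def, of "\<theta> (w x)"] by simp
    qed
    show ?case unfolding eq by (rule approx_add[OF approx_rho[OF Suc] \<theta>\<theta>])
  qed
  \<comment> \<open>The sign makes \<open>\<theta> (w x) - ?c x\<close> exactly the Cesaro mean of
    \<open>\<theta> (w x)\<close>.\<close>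
  let ?c = "\<lambda>x. (- 1 / real N) *\<^sub>R (\<Sum>k<N. (?U ^^ k) (\<theta> (w x)) - \<theta> (w x))"
  have c: "?c \<in> approx i n" by (rule approx_scale, rule approx_sum, rule pow)
  have "norm (\<theta> (w x) - ?c x) < \<epsilon>" if x: "x \<in> K" for x
  proof -
    have Ulin: "linear (?U ^^ k)" for k
    proof (induction k)
      case (Suc k)
      from linear_compose[OF Suc U] show ?case by (simp add: comp_def)
    qed (simp add: linear_iff)
    have Unorm: "norm ((?U ^^ k) \<xi>) = norm \<xi>" for k \<xi> by (induction k) (simp_all add: rho_norm)
    have "(\<Sum>k<N. (?U ^^ k) (\<theta> (w x))) = (\<Sum>k<N. (?U ^^ Suc k) (w x) - (?U ^^ k) (w x))"
    proof (rule sum.cong[OF refl])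
      fix k
      have "(?U ^^ k) (\<theta> (w x)) = (?U ^^ k) (?U (w x)) - (?U ^^ k) (w x)"
        unfolding fun_cong[OF \<theta>_def] by (rule linear_diff[OF Ulin])
      then show "(?U ^^ k) (\<theta> (w x)) = (?U ^^ Suc k) (w x) - (?U ^^ k) (w x)"
        by (simp only: funpow_Suc_right comp_apply)
    qed
    also have "\<dots> = (?U ^^ N) (w x) - w x" using sum_lessThan_telescope[of "\<lambda>k. (?U ^^ k) (w x)" N] by (simp only: funpow_0)
    finally have tele: "(\<Sum>k<N. (?U ^^ k) (\<theta> (w x))) = (?U ^^ N) (w x) - w x" .
    have "\<theta> (w x) - ?c x = (1 / real N) *\<^sub>R ((?U ^^ N) (w x) - w x)"
    proof -
      have "?c x = (- 1 / real N) *\<^sub>R (((?U ^^ N) (w x) - w x) - real N *\<^sub>R \<theta> (w x))"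
        unfolding sum_subtractf tele by (simp only: sum_constant_scaleR card_lessThan)
      also have "\<dots> = (- 1 / real N) *\<^sub>R ((?U ^^ N) (w x) - w x) + \<theta> (w x)"
        unfolding scaleR_diff_right[of "- 1 / real N"] scaleR_scaleR using Npos by simp
      finally show ?thesis by simp
    qed
    then have "norm (\<theta> (w x) - ?c x) = norm ((?U ^^ N) (w x) - w x) / real N" by simp
    also have "\<dots> \<le> (norm (w x) + norm (w x)) / real N"
      using norm_triangle_ineq4[of "(?U ^^ N) (w x)" "w x"] Unorm by (simp add: divide_right_mono)
    also have "\<dots> \<le> (2 * M) / real N" using M(1)[OF x] by (intro divide_right_mono) auto
    also have "\<dots> < \<epsilon>" using N Npos \<epsilon> by (simp add: pos_divide_less_eq mult.commute)
    finally show ?thesis .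
  qed
  then show "\<exists>c'\<in>approx i n. \<forall>x\<in>K. norm (\<theta> (w x) - c' x) < \<epsilon>"
    by (intro bexI[OF _ c] ballI)
qed

lemma theta_approx:
  assumes c: "c \<in> cocycles G T \<rho> (Suc n)" and V: "\<And>x. x \<in> tuples (Suc n) \<Longrightarrow> c x \<in> V"
  shows "(\<lambda>x. \<rho> z (c x) - c x) \<in> approx i n"
proof -
  have cc: "c \<in> cochains T (Suc n)" using c by (simp add: cocycles_def)
  have pow_c: "(\<lambda>x. (\<theta> ^^ k) (c x)) \<in> cochains T (Suc n)" for k
  proof (induction k)
    case (Suc k)
    have "continuous_on UNIV \<theta>"
      unfolding \<theta>_def using linear_continuous_on[OF rho_bounded_linear[OF z_closed]] by (intro continuous_intros)
    from cochains_compose[OF Suc this UNIV_I] show ?case by (simp only: funpow.simps comp_apply)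
  qed (simp add: cc)
  have "\<exists>m. \<exists>b\<in>cochains T n. (\<forall>x\<in>tuples n. b x \<in> V) \<and>
    (\<forall>x\<in>tuples (Suc n). (\<theta> ^^ m) (c x) = coboundary G \<rho> n b x)"
    by (rule theta_power_coboundary[OF c V])
  then obtain m b where b0: "b \<in> cochains T n" "\<forall>x\<in>tuples n. b x \<in> V"
    "\<forall>x\<in>tuples (Suc n). (\<theta> ^^ m) (c x) = coboundary G \<rho> n b x" by blast
  then have b: "b \<in> cochains T n" "\<And>x. x \<in> tuples n \<Longrightarrow> b x \<in> V"
    "\<And>x. x \<in> tuples (Suc n) \<Longrightarrow> (\<theta> ^^ m) (c x) = coboundary G \<rho> n b x" by simp_all
  have "(\<lambda>x. (\<theta> ^^ m) (c x)) \<in> approx i n"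
    by (rule approx_cong[OF approx_coboundary[OF b(1,2)] b(3)])
  \<comment> \<open>One more \<theta> is applied so that the exponent is positive even if
    \<open>m = 0\<close>; the induction below then stops at exponent one.\<close>
  from approx_diff[OF approx_rho[OF this] this]
  have "(\<lambda>x. \<theta> ((\<theta> ^^ m) (c x))) \<in> approx i n" unfolding fun_cong[OF \<theta>_def] .
  then have "(\<lambda>x. (\<theta> ^^ Suc m) (c x)) \<in> approx i n" by (simp only: funpow.simps comp_apply)
  then have "(\<lambda>x. (\<theta> ^^ Suc 0) (c x)) \<in> approx i n"
  proof (induction m)
    case (Suc m)
    have "(\<lambda>x. \<theta> ((\<theta> ^^ m) (c x))) \<in> approx i n"
      by (rule approx_theta_reduce[OF pow_c[of m]]) (use Suc.prems in \<open>simp only: funpow.simps comp_apply\<close>)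
    then show ?case by (intro Suc.IH) (simp only: funpow.simps comp_apply)
  qed
  then have "(\<lambda>x. \<theta> (c x)) \<in> approx i n" by (simp only: funpow.simps comp_apply id_apply)
  then show ?thesis unfolding fun_cong[OF \<theta>_def] .
qed

end

section \<open>Ergodic projections and the vanishing theorem\<close>

lemma topspace_weak_topology: "topspace (weak_topology :: 'e::real_normed_vector topology) = UNIV"
  using closedin_subset[OF closedin_weak_zero[OF bounded_linear_zero]] by auto

locale wap_module = isometric_module G T \<rho> for G :: "'g monoid" (structure) and T :: "'g topology"
    and \<rho> :: "'g \<Rightarrow> 'e::banach \<Rightarrow> 'e" +
  assumes wap: "weakly_almost_periodic G \<rho>"
begin

abbreviation ops :: "nat \<Rightarrow> ('e \<Rightarrow> 'e) set" where
  "ops i \<equiv> \<rho> ` upper_central G (Suc i)"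

abbreviation averages :: "nat \<Rightarrow> ('e \<Rightarrow> 'e) set" where
  "averages i \<equiv> convex_averages (ops i)"

lemma commuting_contractions: "commuting_contractions (ops i) (Fix i)"
proof (rule commuting_contractions.intro)
  let ?Z = "upper_central G (Suc i)"
  have c: "n \<in> carrier G" if "n \<in> ?Z" for n using that by (rule upper_central_carrier)
  show "\<rho> ` ?Z \<noteq> {}" using subgroup.one_closed[OF upper_central_subgroup] by blast
  show "subspace (Fix i)" by (rule uc_fixed_subspace)
  show "closed (Fix i)" by (rule uc_fixed_closed)
  fix u assume "u \<in> \<rho> ` ?Z"
  then obtain a where a: "a \<in> ?Z" "u = \<rho> a" by blast
  show "linear u" unfolding a(2) by (rule rho_linear[OF c[OF a(1)]])
  show "norm (u x) \<le> norm x" for x unfolding a(2) by (simp add: rho_norm[OF c[OF a(1)]])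
  show "u x \<in> Fix i" if "x \<in> Fix i" for x
    unfolding a(2) by (rule uc_fixed_invariant[OF c[OF a(1)] that])
  fix v assume "v \<in> \<rho> ` ?Z"
  then obtain b where b: "b \<in> ?Z" "v = \<rho> b" by blast
  show "u \<circ> v \<in> \<rho> ` ?Z"
  proof (rule image_eqI)
    show "u \<circ> v = \<rho> (a \<otimes> b)" using rho_mult[OF c[OF a(1)] c[OF b(1)]] by (auto simp: a(2) b(2))
    show "a \<otimes> b \<in> ?Z" by (rule subgroup.m_closed[OF upper_central_subgroup a(1) b(1)])
  qed
  show "u (v x) = v (u x)" if "x \<in> Fix i" for x
    unfolding a(2) b(2) by (rule uc_fixed_commute[OF a(1) c[OF b(1)] that])
qed

lemma average_fixed: "a \<in> averages i \<Longrightarrow> \<eta> \<in> Fix (Suc i) \<Longrightarrow> a \<eta> = \<eta>"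
proof (induction rule: convex_averages.induct)
  case (convex a b t)
  then show ?case by (simp add: scaleR_add_left[symmetric])
qed (auto simp: uc_fixed_def)

lemma average_rho:
  assumes "a \<in> averages i" "g \<in> carrier G" "\<xi> \<in> Fix i"
  shows "a (\<rho> g \<xi>) = \<rho> g (a \<xi>)"
  using assms(1)
proof (induction rule: convex_averages.induct)
  case (base u)
  then obtain n where "n \<in> upper_central G (Suc i)" "u = \<rho> n" by blast
  then show ?case using uc_fixed_commute assms(2,3) by simp
next
  case (convex a b t)
  then show ?case using linear_add[OF rho_linear[OF assms(2)]] linear_scale[OF rho_linear[OF assms(2)]] by simp
qed

lemma average_approx:
  assumes c: "c \<in> cocycles G T \<rho> (Suc n)"
    and V: "\<And>x. x \<in> tuples (Suc n) \<Longrightarrow> c x \<in> Fix i"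
    and a: "a \<in> averages i"
  shows "(\<lambda>x. a (c x) - c x) \<in> approx i n"
  using a
proof (induction rule: convex_averages.induct)
  case (base u)
  then obtain s where s: "s \<in> upper_central G (Suc i)" "u = \<rho> s" by blast
  interpret unipotence G T \<rho> i s by unfold_locales (rule s(1))
  show ?case unfolding s(2) by (rule theta_approx[OF c V])
next
  case (convex a b t)
  have eq: "t *\<^sub>R a (c x) + (1 - t) *\<^sub>R b (c x) - c x = t *\<^sub>R (a (c x) - c x) + (1 - t) *\<^sub>R (b (c x) - c x)" for x
    by (simp add: algebra_simps)
  show ?case unfolding eq by (rule approx_add[OF approx_scale[OF convex.IH(1)] approx_scale[OF convex.IH(2)]])
qed

text \<open>The limit is chosen pointwise; linearity, equivariance and contraction all follow later
  from \<open>proj_simultaneous\<close>, without a separate uniqueness argument.\<close>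

definition proj :: "nat \<Rightarrow> 'e \<Rightarrow> 'e" where
  "proj i \<xi> = (SOME \<eta>. \<eta> \<in> Fix (Suc i) \<and> (\<forall>\<epsilon>>0. \<exists>a\<in>averages i. norm (a \<xi> - \<eta>) < \<epsilon>))"

lemma proj:
  assumes \<xi>: "\<xi> \<in> Fix i"
  shows "proj i \<xi> \<in> Fix (Suc i)" "\<epsilon> > 0 \<Longrightarrow> \<exists>a\<in>averages i. norm (a \<xi> - proj i \<xi>) < \<epsilon>"
proof -
  interpret commuting_contractions "ops i" "Fix i"
    by (rule commuting_contractions)
  let ?O = "(\<lambda>g. \<rho> g \<xi>) ` carrier G"
  define K where "K = (weak_topology closure_of ?O :: 'e set)"
  have K: "compactin weak_topology K" using wap unfolding K_def weakly_almost_periodic_def by blast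
  have sub: "?O \<subseteq> K" unfolding K_def by (rule closure_of_subset) (simp add: topspace_weak_topology)
  have "u \<xi> \<in> K" if u: "u \<in> ops i" for u
  proof -
    obtain n where n: "n \<in> upper_central G (Suc i)" "u = \<rho> n" using u by blast
    show ?thesis unfolding n(2) using sub upper_central_carrier[OF n(1)] by blast
  qed
  then have "\<exists>\<eta>\<in>Fix i. (\<forall>u\<in>ops i. u \<eta> = \<eta>) \<and>
      (\<forall>\<epsilon>>0. \<exists>a\<in>averages i. norm (a \<xi> - \<eta>) < \<epsilon>)"
    by (rule mean_ergodic[where \<xi> = \<xi> and K = K, OF \<xi> K])
  then obtain \<eta> where \<eta>: "\<forall>u\<in>ops i. u \<eta> = \<eta>"
    "\<forall>\<epsilon>>0. \<exists>a\<in>averages i. norm (a \<xi> - \<eta>) < \<epsilon>" by blast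
  have "\<eta> \<in> Fix (Suc i)" using \<eta>(1) by (simp add: uc_fixed_def)
  with \<eta>(2) have "\<exists>\<eta>. \<eta> \<in> Fix (Suc i) \<and> (\<forall>\<epsilon>>0. \<exists>a\<in>averages i. norm (a \<xi> - \<eta>) < \<epsilon>)" by blast
  from someI_ex[OF this]
  show "proj i \<xi> \<in> Fix (Suc i)" "\<epsilon> > 0 \<Longrightarrow> \<exists>a\<in>averages i. norm (a \<xi> - proj i \<xi>) < \<epsilon>"
    unfolding proj_def by auto
qed

text \<open>Averages fix the limit vectors and contract distances, so composing with a further
  average does not spoil an approximation already reached.\<close>

lemma proj_simultaneous:
  assumes "finite X" "X \<subseteq> Fix i" "\<epsilon> > 0"
  shows "\<exists>a\<in>averages i. \<forall>\<xi>\<in>X. norm (a \<xi> - proj i \<xi>) < \<epsilon>"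
  using assms(1,2)
proof (induction rule: finite_induct)
  case empty
  have "0 \<in> Fix i" by (rule subspace_0[OF uc_fixed_subspace])
  from proj(2)[OF this \<open>\<epsilon> > 0\<close>] show ?case by blast
next
  case (insert \<xi> X)
  interpret commuting_contractions "ops i" "Fix i"
    by (rule commuting_contractions)
  obtain a where a: "a \<in> averages i" "\<And>\<xi>. \<xi> \<in> X \<Longrightarrow> norm (a \<xi> - proj i \<xi>) < \<epsilon>" using insert by auto
  have \<xi>: "\<xi> \<in> Fix i" using insert by simp
  obtain b where b: "b \<in> averages i" "norm (b \<xi> - proj i \<xi>) < \<epsilon>" using proj(2)[OF \<xi> \<open>\<epsilon> > 0\<close>] by blast
  have step: "norm (a' (b' \<eta>) - proj i \<eta>) < \<epsilon>"
    if "a' \<in> averages i" "norm (b' \<eta> - proj i \<eta>) < \<epsilon>" "\<eta> \<in> Fix i" for a' b' \<eta>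
    using avg_lipschitz[OF that(1), of "b' \<eta>" "proj i \<eta>"] average_fixed[OF that(1) proj(1)[OF that(3)]] that(2) by simp
  have "norm (a (b \<eta>) - proj i \<eta>) < \<epsilon>" if "\<eta> \<in> insert \<xi> X" for \<eta>
  proof (cases "\<eta> = \<xi>")
    case True
    then show ?thesis using step[where a' = a and b' = b and \<eta> = \<xi>] a(1) b(2) \<xi> by simp
  next
    case False
    then have \<eta>: "\<eta> \<in> X" "\<eta> \<in> Fix i" using that insert.prems by auto
    show ?thesis using step[where a' = b and b' = a and \<eta> = \<eta>] b(1) a(2)[OF \<eta>(1)] \<eta>(2) avg_comm[OF a(1) b(1) \<eta>(2)] by simp
  qed
  then show ?case using avg_comp[OF a(1) b(1)] by (intro bexI[of _ "\<lambda>x. a (b x)"]) auto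
qed

lemma proj_lipschitz:
  assumes "\<xi> \<in> Fix i" "\<eta> \<in> Fix i"
  shows "norm (proj i \<xi> - proj i \<eta>) \<le> norm (\<xi> - \<eta>)"
proof (rule field_le_epsilon)
  interpret commuting_contractions "ops i" "Fix i"
    by (rule commuting_contractions)
  fix e :: real assume "e > 0"
  then obtain a where a: "a \<in> averages i" "norm (a \<xi> - proj i \<xi>) < e / 2" "norm (a \<eta> - proj i \<eta>) < e / 2"
    using proj_simultaneous[of "{\<xi>, \<eta>}" i "e / 2"] assms by auto
  have eq: "proj i \<xi> - proj i \<eta> = (a \<xi> - a \<eta>) + ((a \<eta> - proj i \<eta>) - (a \<xi> - proj i \<xi>))" by simp
  show "norm (proj i \<xi> - proj i \<eta>) \<le> norm (\<xi> - \<eta>) + e"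
    unfolding eq
    using norm_triangle_ineq[of "a \<xi> - a \<eta>" "(a \<eta> - proj i \<eta>) - (a \<xi> - proj i \<xi>)"]
      norm_triangle_ineq4[of "a \<eta> - proj i \<eta>" "a \<xi> - proj i \<xi>"] avg_lipschitz[OF a(1), of \<xi> \<eta>] a(2,3) by linarith
qed

lemma proj_rho:
  assumes g: "g \<in> carrier G" and \<xi>: "\<xi> \<in> Fix i"
  shows "proj i (\<rho> g \<xi>) = \<rho> g (proj i \<xi>)"
proof -
  have "norm (proj i (\<rho> g \<xi>) - \<rho> g (proj i \<xi>)) \<le> 0 + e" if "e > 0" for e
  proof -
    obtain a where a: "a \<in> averages i" "norm (a \<xi> - proj i \<xi>) < e / 2" "norm (a (\<rho> g \<xi>) - proj i (\<rho> g \<xi>)) < e / 2"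
      using proj_simultaneous[of "{\<xi>, \<rho> g \<xi>}" i "e / 2"] \<xi> uc_fixed_invariant[OF g \<xi>] \<open>e > 0\<close> by auto
    have "norm (a (\<rho> g \<xi>) - \<rho> g (proj i \<xi>)) = norm (a \<xi> - proj i \<xi>)"
      using rho_norm[OF g, of "a \<xi> - proj i \<xi>"] by (simp add: average_rho[OF a(1) g \<xi>] linear_diff[OF rho_linear[OF g]])
    then show ?thesis
      using norm_triangle_ineq4[of "a (\<rho> g \<xi>) - \<rho> g (proj i \<xi>)" "a (\<rho> g \<xi>) - proj i (\<rho> g \<xi>)"] a(2,3) by simp
  qed
  from field_le_epsilon[OF this] show ?thesis by simp
qed

lemma proj_linear:
  assumes \<xi>: "\<xi> \<in> Fix i" and \<eta>: "\<eta> \<in> Fix i"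
  shows "proj i (\<xi> + \<eta>) = proj i \<xi> + proj i \<eta>" "proj i (r *\<^sub>R \<xi>) = r *\<^sub>R proj i \<xi>"
proof -
  interpret commuting_contractions "ops i" "Fix i"
    by (rule commuting_contractions)
  have V: "\<xi> + \<eta> \<in> Fix i" "r *\<^sub>R \<xi> \<in> Fix i"
    using subsp \<xi> \<eta> by (auto intro: subspace_add subspace_scale)
  have "norm (proj i (\<xi> + \<eta>) - (proj i \<xi> + proj i \<eta>)) \<le> 0 + e" if "e > 0" for e
  proof -
    obtain a where a: "a \<in> averages i" "norm (a \<xi> - proj i \<xi>) < e / 3" "norm (a \<eta> - proj i \<eta>) < e / 3"
      "norm (a (\<xi> + \<eta>) - proj i (\<xi> + \<eta>)) < e / 3"
      using proj_simultaneous[of "{\<xi>, \<eta>, \<xi> + \<eta>}" i "e / 3"] \<xi> \<eta> V \<open>e > 0\<close> by auto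
    have eq: "proj i (\<xi> + \<eta>) - (proj i \<xi> + proj i \<eta>) =
        (a \<xi> - proj i \<xi>) + ((a \<eta> - proj i \<eta>) - (a (\<xi> + \<eta>) - proj i (\<xi> + \<eta>)))"
      using linear_add[OF avg_linear[OF a(1)], of \<xi> \<eta>] by simp
    show ?thesis
      unfolding eq
      using norm_triangle_ineq[of "a \<xi> - proj i \<xi>" "(a \<eta> - proj i \<eta>) - (a (\<xi> + \<eta>) - proj i (\<xi> + \<eta>))"]
        norm_triangle_ineq4[of "a \<eta> - proj i \<eta>" "a (\<xi> + \<eta>) - proj i (\<xi> + \<eta>)"] a(2-4) by linarith
  qed
  from field_le_epsilon[OF this] show "proj i (\<xi> + \<eta>) = proj i \<xi> + proj i \<eta>" by simp
  have "norm (proj i (r *\<^sub>R \<xi>) - r *\<^sub>R proj i \<xi>) \<le> 0 + e" if "e > 0" for e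
  proof -
    define \<delta> where "\<delta> = e / (\<bar>r\<bar> + 1)"
    have \<delta>: "\<delta> > 0" unfolding \<delta>_def using \<open>e > 0\<close> by (intro divide_pos_pos) auto
    obtain a where a: "a \<in> averages i" "norm (a \<xi> - proj i \<xi>) < \<delta>" "norm (a (r *\<^sub>R \<xi>) - proj i (r *\<^sub>R \<xi>)) < \<delta>"
      using proj_simultaneous[of "{\<xi>, r *\<^sub>R \<xi>}" i \<delta>] \<xi> V \<delta> by auto
    have "proj i (r *\<^sub>R \<xi>) - r *\<^sub>R proj i \<xi> = r *\<^sub>R (a \<xi> - proj i \<xi>) - (a (r *\<^sub>R \<xi>) - proj i (r *\<^sub>R \<xi>))"
      using linear_scale[OF avg_linear[OF a(1)], of r \<xi>] by (simp add: scaleR_diff_right)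
    also have "norm \<dots> \<le> \<bar>r\<bar> * norm (a \<xi> - proj i \<xi>) + norm (a (r *\<^sub>R \<xi>) - proj i (r *\<^sub>R \<xi>))"
      using norm_triangle_ineq4[of "r *\<^sub>R (a \<xi> - proj i \<xi>)" "a (r *\<^sub>R \<xi>) - proj i (r *\<^sub>R \<xi>)"] by simp
    also have "\<dots> \<le> \<bar>r\<bar> * \<delta> + \<delta>" using a(2,3) by (intro add_mono mult_left_mono) auto
    also have "\<dots> = (\<bar>r\<bar> + 1) * \<delta>" by (simp add: algebra_simps)
    also have "\<dots> = e" unfolding \<delta>_def by simp
    finally show ?thesis by simp
  qed
  from field_le_epsilon[OF this] show "proj i (r *\<^sub>R \<xi>) = r *\<^sub>R proj i \<xi>" by simp
qed

lemma proj_cocycle: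
  assumes c: "c \<in> cocycles G T \<rho> n"
    and V: "\<And>x. x \<in> tuples n \<Longrightarrow> c x \<in> Fix i"
  shows "(\<lambda>x. proj i (c x)) \<in> cocycles G T \<rho> n"
proof -
  have "continuous_on (Fix i) (proj i)"
    unfolding continuous_on_iff
  proof (intro ballI allI impI)
    fix \<xi> and e :: real assume \<xi>: "\<xi> \<in> Fix i" and e: "e > 0"
    have "dist (proj i \<eta>) (proj i \<xi>) < e" if "\<eta> \<in> Fix i" "dist \<eta> \<xi> < e" for \<eta>
      using proj_lipschitz[OF that(1) \<xi>] that(2) by (simp add: dist_norm)
    then show "\<exists>d>0. \<forall>\<eta>\<in>Fix i. dist \<eta> \<xi> < d \<longrightarrow> dist (proj i \<eta>) (proj i \<xi>) < e"
      using e by (intro exI[of _ e]) simp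
  qed
  then have "(\<lambda>x. proj i (c x)) \<in> cochains T n"
    using c V by (intro cochains_compose[of c n "Fix i" "proj i"]) (simp_all add: cocycles_def)
  moreover have "coboundary G \<rho> n (\<lambda>x. proj i (c x)) x = 0" if x: "x \<in> tuples (Suc n)" for x
  proof -
    have "coboundary G \<rho> n (\<lambda>x. proj i (c x)) x = proj i (coboundary G \<rho> n c x)"
      by (rule coboundary_commute[OF uc_fixed_subspace uc_fixed_invariant proj_linear(1) proj_linear(2) proj_rho V x])
    also have "coboundary G \<rho> n c x = 0" using c x by (simp add: cocycles_def)
    also have "proj i 0 = 0"
      using proj_linear(2)[of 0 i 0 0] subspace_0[OF uc_fixed_subspace] by simp
    finally show ?thesis .
  qed
  ultimately show ?thesis by (simp add: cocycles_def)
qed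

text \<open>The values on a compact set have a finite net. One average close to the projection on
  the net is uniformly close on all values, because both maps are contracting, and
  \<open>average_approx\<close> deals with that average.\<close>

lemma diff_proj_approx:
  assumes c: "c \<in> cocycles G T \<rho> (Suc n)"
    and V: "\<And>x. x \<in> tuples (Suc n) \<Longrightarrow> c x \<in> Fix i"
  shows "(\<lambda>x. c x - proj i (c x)) \<in> approx i n"
proof (rule approx_limit)
  interpret commuting_contractions "ops i" "Fix i"
    by (rule commuting_contractions)
  fix K and \<epsilon> :: real
  assume K: "compactin (power_top T (Suc n)) K" and \<epsilon>: "\<epsilon> > 0"
  have "continuous_map (power_top T (Suc n)) euclidean c" using c by (simp add: cocycles_def cochains_def)
  from image_compactin[OF K this] have cK: "compact (c ` K)" by simp
  have cV: "c ` K \<subseteq> Fix i" using compactin_subset_topspace[OF K] V by blast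
  obtain X where X: "X \<subseteq> c ` K" "finite X" "c ` K \<subseteq> (\<Union>\<xi>\<in>X. ball \<xi> (\<epsilon> / 3))"
  proof (rule compactE_image[OF cK, where C = "c ` K" and f = "\<lambda>\<xi>. ball \<xi> (\<epsilon> / 3)"])
    show "c ` K \<subseteq> (\<Union>\<xi>\<in>c ` K. ball \<xi> (\<epsilon> / 3))" using \<epsilon> by force
  qed (rule open_ball, rule that, assumption+)
  obtain a where a: "a \<in> averages i" "\<And>\<xi>. \<xi> \<in> X \<Longrightarrow> norm (a \<xi> - proj i \<xi>) < \<epsilon> / 3"
    using proj_simultaneous[OF X(2) order_trans[OF X(1) cV], of "\<epsilon> / 3"] \<epsilon> by auto
  have "norm (a (c x) - proj i (c x)) < \<epsilon>" if x: "x \<in> K" for x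
  proof -
    obtain \<xi> where \<xi>: "\<xi> \<in> X" "norm (c x - \<xi>) < \<epsilon> / 3"
      using X(3) x by (auto simp: dist_norm norm_minus_commute)
    have V': "\<xi> \<in> Fix i" "c x \<in> Fix i" using \<xi>(1) X(1) cV x by auto
    have eq: "a (c x) - proj i (c x) = (a (c x) - a \<xi>) + ((a \<xi> - proj i \<xi>) - (proj i (c x) - proj i \<xi>))" by simp
    show ?thesis
      unfolding eq
      using norm_triangle_ineq[of "a (c x) - a \<xi>" "(a \<xi> - proj i \<xi>) - (proj i (c x) - proj i \<xi>)"]
        norm_triangle_ineq4[of "a \<xi> - proj i \<xi>" "proj i (c x) - proj i \<xi>"]
        avg_lipschitz[OF a(1), of "c x" \<xi>] proj_lipschitz[OF V'(2,1)] a(2)[OF \<xi>(1)] \<xi>(2) by linarith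
  qed
  moreover have "(\<lambda>x. (-1) *\<^sub>R (a (c x) - c x)) \<in> approx i n"
    by (rule approx_scale[OF average_approx[OF c V a(1)]])
  ultimately show "\<exists>c'\<in>approx i n. \<forall>x\<in>K. norm (c x - proj i (c x) - c' x) < \<epsilon>"
    by (intro bexI[of _ "\<lambda>x. (-1) *\<^sub>R (a (c x) - c x)"]) auto
qed

text \<open>The induction climbs from \<open>Fix k\<close>, which is zero, towards
  \<open>Fix 0\<close>, which is the whole module; at \<open>j = k\<close> the condition on values
  is vacuous.\<close>

lemma cocycle_approx:
  assumes "upper_central G k = carrier G" "fixed_vectors G \<rho> = {0}"
  shows "c \<in> cocycles G T \<rho> (Suc n) \<Longrightarrow>
    (\<And>x. x \<in> tuples (Suc n) \<Longrightarrow> c x \<in> Fix (k - j)) \<Longrightarrow> c \<in> approx 0 n"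
proof (induction j arbitrary: c)
  case 0
  have "Fix k = {0}" using assms by (simp add: uc_fixed_def fixed_vectors_def)
  then show ?case using 0(2) by (intro approx_cong[OF approx_zero]) simp
next
  case (Suc j)
  show ?case
  proof (cases "j < k")
    case False
    \<comment> \<open>Truncated subtraction: both sides are zero.\<close>
    then have "k - Suc j = k - j" by simp
    then show ?thesis using Suc.prems(2) by (intro Suc.IH[OF Suc.prems(1)]) simp
  next
    case True
    define i where "i = k - Suc j"
    have i: "k - j = Suc i" using True by (simp add: i_def)
    have V: "c x \<in> Fix i" if "x \<in> tuples (Suc n)" for x
      using Suc.prems(2)[OF that] by (simp add: i_def)
    have "(\<lambda>x. proj i (c x)) \<in> approx 0 n"
      by (rule Suc.IH[OF proj_cocycle[OF Suc.prems(1) V]]) (use proj(1)[OF V] i in auto)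
    from approx_add[OF approx_level_0[OF diff_proj_approx[OF Suc.prems(1) V]] this]
    show ?thesis by simp
  qed
qed

theorem nilpotent_reduced_cohomology_vanishes:
  assumes k: "upper_central G k = carrier G" and no_fixed: "fixed_vectors G \<rho> = {0}"
  shows "reduced_cohomology_vanishes G T \<rho> n"
  unfolding reduced_cohomology_vanishes_def
proof
  fix c assume c: "c \<in> cocycles G T \<rho> n"
  show "c \<in> compact_open_closure T n (coboundaries G T \<rho> n)"
  proof (cases n)
    case (Suc m)
    have "c \<in> approx 0 m"
      by (rule cocycle_approx[OF k no_fixed, where j = k]) (use c Suc in \<open>simp_all add: uc_fixed_0\<close>)
    from approx_0_compact_open_closure[OF this] show ?thesis using Suc by simp
  next
    case 0
    \<comment> \<open>In degree zero the only coboundary is zero, so the cocycle itself must vanish: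
      its value at the empty tuple is a fixed vector.\<close>
    have "c x = 0" if x: "x \<in> tuples 0" for x
    proof -
      have x0: "x = (\<lambda>_. undefined)" using x by (simp add: topspace_power_top)
      have "\<rho> g (c x) = c x" if g: "g \<in> carrier G" for g
      proof -
        let ?y = "restrict (\<lambda>_. g) {..<Suc 0}"
        have "?y \<in> tuples (Suc 0)" using g by (auto simp: topspace_power_top topspace_T)
        then have "coboundary G \<rho> 0 c ?y = 0" using c 0 by (simp add: cocycles_def)
        then show ?thesis by (simp add: coboundary_def x0 restrict_def)
      qed
      then have "c x \<in> fixed_vectors G \<rho>" by (simp add: fixed_vectors_def)
      then show ?thesis using no_fixed by simp
    qed
    then have "c x = 0" if "compactin (power_top T 0) K" "x \<in> K" for x K
      using compactin_subset_topspace[OF that(1)] that(2) by blast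
    then show ?thesis using 0 unfolding compact_open_closure_def coboundaries_def by auto
  qed
qed

end

section \<open>Nilpotency of Mal'cev groups\<close>

lemma malcev_group_upper_central:
  fixes G :: "'g monoid"
  assumes "malcev_group TYPE('n::finite) TYPE('l) G T"
  shows "\<exists>k. upper_central G k = carrier G"
proof -
  obtain L :: "'l monoid" and X f where L: "csc_nilpotent_lie_group TYPE('n) L X"
    and f: "f \<in> hom G L" "embedding_map T X f" and tg: "topological_group G T"
    using assms unfolding malcev_group_def by blast
  interpret G: group G using tg by (simp add: topological_group_def)
  have gL: "group L" using L by (auto simp: csc_nilpotent_lie_group_def topological_group_def nilpotent_group_def)
  interpret f: group_hom G L f using gL G.is_group f(1) by (simp add: group_hom_def group_hom_axioms_def)
  have inj: "inj_on f (carrier G)"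
    using f(2) tg unfolding embedding_map_def by (auto dest!: homeomorphic_imp_injective_map simp: topological_group_def)
  have "\<exists>k. lower_central L k = {\<one>\<^bsub>L\<^esub>}"
    using L unfolding csc_nilpotent_lie_group_def nilpotent_group_def
  proof (elim disjE conjE)
    assume "carrier L = {\<one>\<^bsub>L\<^esub>}"
    then show ?thesis by (intro exI[of _ 0]) simp
  qed
  then obtain k where k: "lower_central L k = {\<one>\<^bsub>L\<^esub>}" by blast
  \<comment> \<open>A homomorphism respects commutators, so \<open>f\<close> carries the series of
    \<open>G\<close> into that of \<open>L\<close>; injectivity then pulls back triviality.\<close>
  have sub: "lower_central G j \<subseteq> carrier G \<and> f ` lower_central G j \<subseteq> lower_central L j" for j
  proof (induction j)
    case 0
    then show ?case by auto
  next
    case (Suc j)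
    let ?C = "{x \<otimes>\<^bsub>G\<^esub> y \<otimes>\<^bsub>G\<^esub> inv\<^bsub>G\<^esub> x \<otimes>\<^bsub>G\<^esub> inv\<^bsub>G\<^esub> y | x y. x \<in> lower_central G j \<and> y \<in> carrier G}"
    let ?D = "{x \<otimes>\<^bsub>L\<^esub> y \<otimes>\<^bsub>L\<^esub> inv\<^bsub>L\<^esub> x \<otimes>\<^bsub>L\<^esub> inv\<^bsub>L\<^esub> y | x y. x \<in> lower_central L j \<and> y \<in> carrier L}"
    have C: "?C \<subseteq> carrier G" using Suc by auto
    have "f ` ?C \<subseteq> ?D"
    proof
      fix w assume "w \<in> f ` ?C"
      then obtain x y where xy: "x \<in> lower_central G j" "y \<in> carrier G"
        "w = f (x \<otimes>\<^bsub>G\<^esub> y \<otimes>\<^bsub>G\<^esub> inv\<^bsub>G\<^esub> x \<otimes>\<^bsub>G\<^esub> inv\<^bsub>G\<^esub> y)" by blast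
      have "x \<in> carrier G" "f x \<in> lower_central L j" using Suc xy(1) by auto
      then have "w = f x \<otimes>\<^bsub>L\<^esub> f y \<otimes>\<^bsub>L\<^esub> inv\<^bsub>L\<^esub> f x \<otimes>\<^bsub>L\<^esub> inv\<^bsub>L\<^esub> f y" using xy by simp
      then show "w \<in> ?D" using \<open>f x \<in> lower_central L j\<close> f.hom_closed[OF xy(2)] by blast
    qed
    then have "f ` generate G ?C \<subseteq> generate L ?D"
      unfolding f.generate_img[OF C, symmetric] by (rule group.mono_generate[OF gL])
    then show ?case using G.generate_incl[OF C] by simp
  qed
  have "lower_central G k \<subseteq> {\<one>\<^bsub>G\<^esub>}"
  proof
    fix x assume x: "x \<in> lower_central G k"
    then have x: "f x = f \<one>\<^bsub>G\<^esub>" "x \<in> carrier G" using sub[of k] k by auto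
    from inj_onD[OF inj x G.one_closed] show "x \<in> {\<one>\<^bsub>G\<^esub>}" by simp
  qed
  moreover have "\<one>\<^bsub>G\<^esub> \<in> lower_central G k" by (cases k) (auto intro: generate.one)
  ultimately have "lower_central G k = {\<one>\<^bsub>G\<^esub>}" by blast
  from lower_central_subset_upper_central[OF G.is_group this order_refl]
  have "carrier G \<subseteq> upper_central G k" by simp
  with subgroup.subset[OF G.upper_central_subgroup] show ?thesis by (intro exI[of _ k] equalityI)
qed

theorem theorem5p8:
  fixes G :: "'g monoid" and T :: "'g topology" and \<rho> :: "'g \<Rightarrow> 'e::banach \<Rightarrow> 'e"
  assumes "malcev_group TYPE('n::finite) TYPE('l) G T"
    and "isometric_banach_module G T \<rho>"
    and "weakly_almost_periodic G \<rho>"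
    and "fixed_vectors G \<rho> = {0}"
  shows "\<forall>n. reduced_cohomology_vanishes G T \<rho> n"
proof -
  have tg: "topological_group G T" using assms(1) by (simp add: malcev_group_def)
  interpret group G using tg by (simp add: topological_group_def)
  interpret wap_module G T \<rho> by unfold_locales (fact tg assms)+
  obtain k where "upper_central G k = carrier G" using malcev_group_upper_central[OF assms(1)] by blast
  from nilpotent_reduced_cohomology_vanishes[OF this assms(4)] show ?thesis by (rule allI)
qed

end
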